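(* Let $L=(L(t))_{t\ge0}$ be a real-valued Lévy process and let $T\ge0$ be a random variable independent of $L$ and not almost surely equal to $0$. Put $M_L(v)=E[e^{vL(1)}]$, $K_L=\log M_L$, $M_T(v)=E[e^{vT}]$, $K_T=\log M_T$, and $$p_L=\sup\{s:M_L(s)<\infty\},\qquad p_T=\sup\{s:M_T(s)<\infty\}.$$ Let $F$ be the distribution function of $L(T)$ (whose moment generating function is $M(v)=\exp[K_T(K_L(v))]$) and $\bar F=1-F$. Assume $p_L,p_T>0$. Then, with asymptotics as $x\to\infty$: (i.1) If $K_L(p)=p_T$ for some $p\in[0,p_L)$ and $M_T$ satisfies either Criterion I or Criterion II (at $p_T$), then $\log\bar F(x)\sim-px$. (i.2) If $K_L(p)=p_T$ for $p=p_L$, and each of $M_T$ (at $p_T$) and $M_L$ (at $p_L$) satisfies either Criterion I or Criterion II, then $\log\bar F(x)\sim-px$. (ii) If $K_L(p)<p_T$ for all $p\in[0,p_L]$ and $M_L$ satisfies either Criterion I or Criterion II (at $p_L$), then $\log\bar F(x)\sim-p_Lx$.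
   Context: Let $G$ be the moment generating function of a probability measure on $\mathbb{R}$ and let $r=\sup\{s:G(s)<\infty\}$, with $r\in(0,\infty)$. $G$ satisfies Criterion I (at $r$) if for some integer $n\ge0$, some $\rho>0$ and some $l\in R_0$ one has $G^{(n)}(r-s)\sim s^{-\rho}l(1/s)$ as $s\to0+$, where $G^{(n)}$ is the $n$-th derivative ($G^{(0)}=G$). $G$ satisfies Criterion II (at $r$) if for some $\rho>0$ and some $l\in R_0$ one has $\log G(r-s)\sim s^{-\rho}l(1/s)$ as $s\to0+$. $R_0$ denotes the class of functions slowly varying at infinity: positive measurable functions $l$, defined on a neighbourhood of $+\infty$, with $l(\lambda x)/l(x)\to1$ as $x\to\infty$ for every $\lambda>0$. $g\sim h$ means that the ratio $g/h$ tends to $1$ in the indicated limit. *)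

theory Defs
  imports "HOL-Probability.Probability"
begin

definition mgf :: "real measure \<Rightarrow> real \<Rightarrow> ennreal" where
  "mgf \<mu> s = (\<integral>\<^sup>+ x. ennreal (exp (s * x)) \<partial>\<mu>)"

definition cgf :: "real measure \<Rightarrow> real \<Rightarrow> ereal" where
  "cgf \<mu> s = (if mgf \<mu> s = \<infinity> then \<infinity> else ereal (ln (enn2real (mgf \<mu> s))))"

definition critical_exponent :: "real measure \<Rightarrow> ereal" where
  "critical_exponent \<mu> = Sup {ereal s | s. mgf \<mu> s < \<infinity>}"

text \<open>Slow variation at infinity, for functions defined on some \<open>{A..}\<close>; the values of \<open>l\<close>
  below \<open>A\<close> are irrelevant.\<close>

definition slowly_varying :: "(real \<Rightarrow> real) \<Rightarrow> bool" where
  "slowly_varying l \<longleftrightarrow>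
     (\<exists>A. l \<in> borel_measurable (lebesgue_on {A..}) \<and> (\<forall>x\<ge>A. 0 < l x)) \<and>
     (\<forall>c>0. ((\<lambda>x. l (c * x) / l x) \<longlongrightarrow> 1) at_top)"

text \<open>Both criteria are taken at the critical exponent \<open>r\<close> of \<open>\<mu>\<close>, and include the requirement
  \<open>0 < r < \<infinity>\<close>.  The generating function is finite on \<open>[0, r)\<close>, so for small \<open>s > 0\<close> nothing is
  lost by passing to real values.\<close>

definition criterion_I :: "real measure \<Rightarrow> bool" where
  "criterion_I \<mu> \<longleftrightarrow>
     (\<exists>r>0. critical_exponent \<mu> = ereal r \<and>
       (\<exists>n::nat. \<exists>\<rho>>0. \<exists>l. slowly_varying l \<and>
         (\<lambda>s. (deriv ^^ n) (\<lambda>v. enn2real (mgf \<mu> v)) (r - s))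
           \<sim>[at_right 0] (\<lambda>s. s powr (- \<rho>) * l (1 / s))))"

definition criterion_II :: "real measure \<Rightarrow> bool" where
  "criterion_II \<mu> \<longleftrightarrow>
     (\<exists>r>0. critical_exponent \<mu> = ereal r \<and>
       (\<exists>\<rho>>0. \<exists>l. slowly_varying l \<and>
         (\<lambda>s. ln (enn2real (mgf \<mu> (r - s)))) \<sim>[at_right 0] (\<lambda>s. s powr (- \<rho>) * l (1 / s))))"

text \<open>Time is indexed by the reals, but only times \<open>t \<ge> 0\<close> are constrained.  Stochastic continuity
  is not listed: it follows from the other conditions.\<close>

definition levy_process :: "'a measure \<Rightarrow> (real \<Rightarrow> 'a \<Rightarrow> real) \<Rightarrow> bool" where
  "levy_process M L \<longleftrightarrow>
     prob_space M \<and>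
     (\<forall>t\<ge>0. L t \<in> borel_measurable M) \<and>
     (AE \<omega> in M. L 0 \<omega> = 0) \<and>
     (\<forall>n (t :: nat \<Rightarrow> real). 0 \<le> t 0 \<and> (\<forall>i<n. t i < t (Suc i)) \<longrightarrow>
        prob_space.indep_vars M (\<lambda>_. borel) (\<lambda>i \<omega>. L (t (Suc i)) \<omega> - L (t i) \<omega>) {..<n}) \<and>
     (\<forall>s\<ge>0. \<forall>t\<ge>0. distr M borel (\<lambda>\<omega>. L (s + t) \<omega> - L s \<omega>) = distr M borel (L t)) \<and>
     (AE \<omega> in M. \<forall>t\<ge>0.
        ((\<lambda>u. L u \<omega>) \<longlongrightarrow> L t \<omega>) (at_right t) \<and>
        (0 < t \<longrightarrow> (\<exists>y. ((\<lambda>u. L u \<omega>) \<longlongrightarrow> y) (at_left t))))"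

text \<open>Independence of \<open>T\<close> from the sigma-algebra generated by the whole process.\<close>

definition indep_of_process :: "'a measure \<Rightarrow> ('a \<Rightarrow> real) \<Rightarrow> (real \<Rightarrow> 'a \<Rightarrow> real) \<Rightarrow> bool" where
  "indep_of_process M T L \<longleftrightarrow>
     prob_space.indep_set M
       (sets (vimage_algebra (space M) T borel))
       (sets (vimage_algebra (space M) (\<lambda>\<omega>. \<lambda>t\<in>{0..}. L t \<omega>) (\<Pi>\<^sub>M t\<in>{0..}. borel)))"

text \<open>Paths are regular only almost surely, and \<open>T\<close> may be negative on a null set, so \<open>L(T)\<close> is
  measurable with respect to the completion of \<open>M\<close>, but perhaps not with respect to \<open>M\<close> itself.\<close>

definition law_at_random_time ::
    "'a measure \<Rightarrow> (real \<Rightarrow> 'a \<Rightarrow> real) \<Rightarrow> ('a \<Rightarrow> real) \<Rightarrow> real measure" where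
  "law_at_random_time M L T = distr (completion M) borel (\<lambda>\<omega>. L (T \<omega>) \<omega>)"

end

theory Submission
  imports Defs
begin

text \<open>
  Upper bounds are exponential Chebyshev bounds: \<open>E exp (v L(T)) \<le> M\<^sub>T (K\<^sub>L v)\<close> is finite for \<open>v\<close> below
  the claimed rate.  For the lower bounds, the criteria are used only through regular variation, at the
  critical exponent \<open>r\<close>, of the moments \<open>\<integral>\<^bsub>x>0\<^esub> x\<^sup>N exp ((r - s) x)\<close> (Criterion I) or of the logarithm of
  the generating function (Criterion II), as \<open>s \<rightarrow> 0\<close>.  Regular variation passes from order \<open>N\<close> to
  \<open>N + 1\<close>, and for large \<open>N\<close> the tilted law \<open>x\<^sup>N exp ((r - s) x) \<mu>(dx)\<close> concentrates in a narrow window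
  around a multiple of \<open>1 / s\<close>.  Hence every window \<open>[(1 - \<delta>) y, (1 + \<delta>) y]\<close> with \<open>y\<close> large carries at
  least \<open>exp (- r (1 + 2 \<delta>) y)\<close> of the mass of \<open>\<mu>\<close>.

  In case (i.1) a large \<open>L(T)\<close> comes from \<open>T\<close> in such a window around \<open>x / K'(p)\<close> together with the typical
  behaviour of \<open>L\<close> under tilting by \<open>p\<close>.  In cases (i.2) and (ii) the generating function of \<open>L(1)\<close> is finite
  at the critical exponent, so only Criterion I with \<open>n \<ge> 1\<close> is possible, and \<open>T\<close> merely has to exceed some
  small dyadic \<open>a > 0\<close>.  The high moments of a sum of two independent copies are asymptotically dominated by
  the terms in which one copy carries the full power (one big jump), so regular variation descends from
  \<open>L(1)\<close> to \<open>L(1/2)\<close>, \<open>L(1/4)\<close>, \<dots>, and in particular to \<open>L(a)\<close>.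
\<close>

section \<open>Regular variation at the origin\<close>

text \<open>In case (i.1) the costs add up as follows, with D = K'(p) and K(p) = p_T: keeping T near
  u = x / D costs exp (- p_T u), the deviation of L(u) to x costs exp (- (p D - p_T) u), and the
  product is exp (- p x). In the other cases L supplies the whole exponent, but T may live on very
  short times while the criterion speaks of L(1) only; this forces the descent to small dyadic
  times, after which an independent increment that is not too negative covers all longer times.
  Windows need a high order N because a law tilted near a singularity of index \<sigma> behaves like
  a Gamma law of shape \<sigma> and rate s, with mean \<sigma> / s and relative width 1 / sqrt
  \<sigma>; each extra power raises \<sigma> by one. Under Criterion II the diverging logarithm
  takes over the role of \<sigma>. L(T) is handled without joint measurability of the paths: T is
  rounded up to a grid, independence is used at countably many times, and right-continuity with
  Fatou's lemma returns to T. Fatou yields one-sided estimates, which suffice at the logarithmic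
  scale.\<close>

definition regvar0 :: "real \<Rightarrow> (real \<Rightarrow> real) \<Rightarrow> bool" where
  "regvar0 \<rho> f \<longleftrightarrow> filterlim f at_top (at_right 0) \<and>
     (\<forall>c>0. ((\<lambda>s. f (c * s) / f s) \<longlongrightarrow> c powr (- \<rho>)) (at_right 0))"

lemma filterlim_mult_at_right_0:
  fixes c :: real
  assumes "0 < c"
  shows "filterlim (\<lambda>s. c * s) (at_right 0) (at_right 0)"
proof -
  have "((\<lambda>s. c * s) \<longlongrightarrow> c * 0) (at_right 0)"
    by (intro tendsto_intros)
  moreover have "\<forall>\<^sub>F s in at_right 0. c * s \<in> {0<..} \<and> c * s \<noteq> 0"
    using eventually_at_right_less[of "0::real"] by eventually_elim (use assms in auto)
  ultimately show ?thesis
    by (auto simp: filterlim_at)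
qed

lemma slowly_varying_ratio:
  assumes l: "slowly_varying l"
    and f: "f \<sim>[at_right 0] (\<lambda>s. s powr (- \<rho>) * l (1 / s))"
    and c: "0 < c"
  shows "\<forall>\<^sub>F s in at_right 0. 0 < f s"
    and "((\<lambda>s. f (c * s) / f s) \<longlongrightarrow> c powr (- \<rho>)) (at_right 0)"
proof -
  define b where "b s = s powr (- \<rho>) * l (1 / s)" for s
  have fb: "f \<sim>[at_right 0] b"
    using f unfolding b_def .
  obtain A where A: "\<And>x. x \<ge> A \<Longrightarrow> 0 < l x"
    using l unfolding slowly_varying_def by blast
  have inv: "filterlim (\<lambda>s::real. 1 / s) at_top (at_right 0)"
    using filterlim_inverse_at_top_right by (simp add: inverse_eq_divide)
  have lpos: "\<forall>\<^sub>F s in at_right 0. 0 < l (1 / s)"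
    using filterlim_at_top[THEN iffD1, OF inv, rule_format, of A] by eventually_elim (rule A)
  have pos: "\<forall>\<^sub>F s in at_right (0::real). 0 < s"
    by (rule eventually_at_right_less)
  have bpos: "\<forall>\<^sub>F s in at_right 0. 0 < b s"
    using lpos pos by eventually_elim (auto simp: b_def)
  show fpos: "\<forall>\<^sub>F s in at_right 0. 0 < f s"
    using asymp_equiv_eventually_pos_iff[OF fb] bpos by eventually_elim auto
  have "((\<lambda>x. l ((1 / c) * x) / l x) \<longlongrightarrow> 1) at_top"
    using l c unfolding slowly_varying_def by (meson divide_pos_pos zero_less_one)
  then have "((\<lambda>s. l ((1 / c) * (1 / s)) / l (1 / s)) \<longlongrightarrow> 1) (at_right 0)"
    by (rule filterlim_compose[OF _ inv])
  then have "((\<lambda>s. c powr (-\<rho>) * (l ((1 / c) * (1 / s)) / l (1 / s))) \<longlongrightarrow> c powr (-\<rho>) * 1) (at_right 0)"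
    by (intro tendsto_intros)
  moreover have "\<forall>\<^sub>F s in at_right 0. c powr (-\<rho>) * (l ((1 / c) * (1 / s)) / l (1 / s)) = b (c * s) / b s"
    using pos by eventually_elim (use c in \<open>auto simp: b_def powr_mult\<close>)
  ultimately have lim: "((\<lambda>s. b (c * s) / b s) \<longlongrightarrow> c powr (-\<rho>)) (at_right 0)"
    by (simp add: tendsto_cong)
  have "(\<lambda>s. f (c * s)) \<sim>[at_right 0] (\<lambda>s. b (c * s))"
    by (rule asymp_equiv_compose'[OF fb filterlim_mult_at_right_0[OF c]])
  then have "(\<lambda>s. f (c * s) / f s) \<sim>[at_right 0] (\<lambda>s. b (c * s) / b s)"
    using fb by (rule asymp_equiv_intros)
  then show "((\<lambda>s. f (c * s) / f s) \<longlongrightarrow> c powr (- \<rho>)) (at_right 0)"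
    using lim by (metis asymp_equiv_symI tendsto_asymp_equiv_cong)
qed

text \<open>Ratio limits for fixed c, without uniformity in c, give divergence only along a
  geometric sequence. Monotonicity of \<open>hmom\<close> later extends it to the full limit s
  \<rightarrow> 0.\<close>

lemma ratio_blowup:
  fixes f :: "real \<Rightarrow> real"
  assumes \<rho>: "0 < \<rho>"
    and pos: "\<forall>\<^sub>F s in at_right 0. 0 < f s"
    and lim: "((\<lambda>s. f (1/2 * s) / f s) \<longlongrightarrow> (1/2) powr (- \<rho>)) (at_right 0)"
  obtains S where "\<And>k. 0 < S k" "S \<longlonglongrightarrow> (0::real)" "filterlim (\<lambda>k::nat. f (S k)) at_top sequentially"
proof -
  \<comment> \<open>The midpoint of 1 and the limit: for small s every halving multiplies f by at
    least q > 1.\<close>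
  define q where "q = (1 + (1/2) powr (- \<rho>)) / 2"
  have "1 < (1/2::real) powr (-\<rho>)"
    using \<rho> by (simp add: powr_minus powr_divide)
  then have q: "1 < q" "q < (1/2) powr (-\<rho>)"
    by (auto simp: q_def)
  have "\<forall>\<^sub>F s in at_right 0. q < f (1/2 * s) / f s"
    using lim q(2) by (rule order_tendstoD)
  then have "\<forall>\<^sub>F s in at_right 0. q < f (1/2 * s) / f s \<and> 0 < f s"
    using pos by eventually_elim auto
  then obtain s0 where s0: "0 < s0" and *: "\<And>s. 0 < s \<Longrightarrow> s < s0 \<Longrightarrow> q < f (1/2 * s) / f s \<and> 0 < f s"
    by (auto simp: eventually_at_right_field)
  define S where "S k = s0 / 2 * (1/2)^k" for k :: nat
  have S: "0 < S k" "S k < s0" for k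
  proof -
    have "(1/2::real)^k \<le> 1" by (simp add: power_le_one)
    then have "s0 / 2 * (1/2)^k \<le> s0 / 2 * 1"
      using s0 by (intro mult_left_mono) auto
    then show "0 < S k" "S k < s0" using s0 by (auto simp: S_def)
  qed
  have SSuc: "S (Suc k) = 1/2 * S k" for k
    by (simp add: S_def)
  have grow: "q ^ k * f (S 0) \<le> f (S k)" for k
  proof (induction k)
    case (Suc k)
    have "q * f (S k) \<le> f (S (Suc k))"
      using *[OF S, of k] unfolding SSuc by (auto simp: less_divide_eq)
    moreover have "q * (q ^ k * f (S 0)) \<le> q * f (S k)"
      using Suc q by simp
    ultimately show ?case by simp
  qed simp
  have "filterlim (\<lambda>k. f (S 0) * q ^ k) at_top sequentially"
    using *[OF S, of 0] q
    by (intro filterlim_tendsto_pos_mult_at_top[OF tendsto_const]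
        filterlim_at_infinity_imp_filterlim_at_top[OF filterlim_realpow_sequentially_gt1]) auto
  then have "filterlim (\<lambda>k. f (S k)) at_top sequentially"
    by (rule filterlim_at_top_mono) (use grow in \<open>auto simp: mult.commute\<close>)
  moreover have "S \<longlonglongrightarrow> s0 / 2 * 0"
    unfolding S_def by (intro tendsto_intros LIMSEQ_power_zero) auto
  ultimately show ?thesis
    using that[of S] S by auto
qed

lemma antimono_filterlim_at_top:
  fixes h :: "real \<Rightarrow> real"
  assumes b: "0 < b" and anti: "\<And>s t. 0 < s \<Longrightarrow> s \<le> t \<Longrightarrow> t < b \<Longrightarrow> h t \<le> h s"
    and unb: "\<And>C. \<exists>s. 0 < s \<and> s < b \<and> C \<le> h s"
  shows "filterlim h at_top (at_right 0)"
  unfolding filterlim_at_top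
proof
  fix C
  obtain s where s: "0 < s" "s < b" "C \<le> h s"
    using unb by blast
  then show "\<forall>\<^sub>F t in at_right 0. C \<le> h t"
    unfolding eventually_at_right_field
    by (intro exI[of _ s]) (use anti in \<open>auto intro: order_trans[OF s(3) anti]\<close>)
qed

lemma regvar0_asymp_equiv:
  assumes f: "regvar0 \<rho> f" and c: "0 < c" and fh: "f \<sim>[at_right 0] (\<lambda>s. c * h s)"
  shows "regvar0 \<rho> h"
proof -
  have lim: "filterlim f at_top (at_right 0)"
    using f by (simp add: regvar0_def)
  have "filterlim (\<lambda>s. c * h s) at_top (at_right 0)"
    using asymp_equiv_at_top_transfer[OF fh lim] .
  then have "filterlim (\<lambda>s. inverse c * (c * h s)) at_top (at_right 0)"
    using c by (intro filterlim_tendsto_pos_mult_at_top[OF tendsto_const, of "inverse c"]) auto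
  moreover have "(\<lambda>s. inverse c * (c * h s)) = h"
    using c by auto
  ultimately have 1: "filterlim h at_top (at_right 0)"
    by simp
  have "((\<lambda>s. h (d * s) / h s) \<longlongrightarrow> d powr (- \<rho>)) (at_right 0)" if d: "0 < d" for d
  proof -
    have "((\<lambda>s. f (d * s) / f s) \<longlongrightarrow> d powr (- \<rho>)) (at_right 0)"
      using f d by (simp add: regvar0_def)
    moreover have "(\<lambda>s. f (d * s)) \<sim>[at_right 0] (\<lambda>s. c * h (d * s))"
      by (rule asymp_equiv_compose'[OF fh filterlim_mult_at_right_0[OF d]])
    then have "(\<lambda>s. f (d * s) / f s) \<sim>[at_right 0] (\<lambda>s. (c * h (d * s)) / (c * h s))"
      using fh by (rule asymp_equiv_intros)
    ultimately have "((\<lambda>s. (c * h (d * s)) / (c * h s)) \<longlongrightarrow> d powr (- \<rho>)) (at_right 0)"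
      by (simp add: tendsto_asymp_equiv_cong)
    then show ?thesis using c by simp
  qed
  with 1 show ?thesis by (simp add: regvar0_def)
qed

lemma asymp_equiv_bounded_diff:
  fixes f h :: "real \<Rightarrow> real"
  assumes h: "filterlim h at_top F" and d: "\<forall>\<^sub>F s in F. \<bar>f s - h s\<bar> \<le> C"
  shows "f \<sim>[F] h"
proof (rule asymp_equivI')
  have ev: "\<forall>\<^sub>F s in F. 0 < h s"
    using h by (simp add: filterlim_at_top_dense)
  have "((\<lambda>s. f s / h s - 1) \<longlongrightarrow> 0) F"
  proof (rule Lim_null_comparison)
    show "\<forall>\<^sub>F s in F. norm (f s / h s - 1) \<le> C / h s"
      using ev d
    proof eventually_elim
      case (elim s)
      then have "f s / h s - 1 = (f s - h s) / h s" by (simp add: field_simps)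
      then show ?case using elim by (simp add: divide_right_mono)
    qed
    show "((\<lambda>s. C / h s) \<longlongrightarrow> 0) F"
      using h by (rule real_tendsto_divide_at_top[OF tendsto_const])
  qed
  then show "((\<lambda>s. f s / h s) \<longlongrightarrow> 1) F"
    by (simp add: LIM_zero_iff)
qed

lemma regvar0_of_ratio:
  assumes lim: "filterlim f at_top (at_right 0)"
    and "\<And>c. 0 < c \<Longrightarrow> ((\<lambda>s. f (c * s) / f s) \<longlongrightarrow> c powr (- \<rho>)) (at_right 0)"
  shows "regvar0 \<rho> f"
  using assms by (simp add: regvar0_def)

lemma powr_difference_quotient:
  fixes \<rho> :: real
  shows "((\<lambda>c. (1 - c powr (-\<rho>)) / (c - 1)) \<longlongrightarrow> \<rho>) (at 1)"
proof -
  have "((\<lambda>c::real. c powr (-\<rho>)) has_real_derivative (-\<rho>)) (at 1)"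
    by (auto intro!: derivative_eq_intros)
  then have "((\<lambda>c. (c powr (-\<rho>) - 1) / (c - 1)) \<longlongrightarrow> -\<rho>) (at 1)"
    by (simp add: has_field_derivative_iff)
  then have "((\<lambda>c. - ((c powr (-\<rho>) - 1) / (c - 1))) \<longlongrightarrow> - (-\<rho>)) (at 1)"
    by (rule tendsto_minus)
  then show ?thesis by (simp add: minus_divide_left)
qed

text \<open>A monotone density theorem. \<open>conv\<close> is the tangent inequality of a convex f
  with derivative - g. Divided by (c - 1) f(s), it bounds s g(s) / f(s) from below when c > 1 and,
  the sign being reversed, from above when c < 1. Both bounds tend to \<rho> as c \<rightarrow> 1,
  so g(s) is asymptotic to \<rho> f(s) / s.\<close>

lemma regvar0_step:
  fixes f g :: "real \<Rightarrow> real"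
  assumes f: "regvar0 \<rho> f" and \<rho>: "0 < \<rho>"
    and conv: "\<And>c. 0 < c \<Longrightarrow> \<forall>\<^sub>F s in at_right 0. f s - f (c * s) \<le> (c - 1) * s * g s"
  shows "regvar0 (\<rho> + 1) g"
proof -
  have flim: "filterlim f at_top (at_right 0)"
    and rat: "\<And>c. 0 < c \<Longrightarrow> ((\<lambda>s. f (c * s) / f s) \<longlongrightarrow> c powr (- \<rho>)) (at_right 0)"
    using f by (auto simp: regvar0_def)
  have fpos: "\<forall>\<^sub>F s in at_right 0. 0 < f s"
    using flim by (simp add: filterlim_at_top_dense)
  have pos: "\<forall>\<^sub>F s in at_right (0::real). 0 < s"
    by (rule eventually_at_right_less)
  have key: "((\<lambda>s. s * g s / f s) \<longlongrightarrow> \<rho>) (at_right 0)"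
  proof (rule order_tendstoI)
    fix a assume a: "a < \<rho>"
    have "\<forall>\<^sub>F c in at 1. a < (1 - c powr (-\<rho>)) / (c - 1)"
      by (rule order_tendstoD(1)[OF powr_difference_quotient a])
    then have "\<forall>\<^sub>F c in at_right 1. a < (1 - c powr (-\<rho>)) / (c - 1)"
      by (simp add: eventually_at_split)
    then have "\<forall>\<^sub>F c in at_right 1. a < (1 - c powr (-\<rho>)) / (c - 1) \<and> 1 < c"
      using eventually_at_right_less[of "1::real"] by eventually_elim auto
    then obtain c where c: "1 < c" "a < (1 - c powr (-\<rho>)) / (c - 1)"
      using eventually_happens'[OF trivial_limit_at_right_real] by blast
    have "((\<lambda>s. (1 - f (c * s) / f s) / (c - 1)) \<longlongrightarrow> (1 - c powr (-\<rho>)) / (c - 1)) (at_right 0)"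
      using c by (intro tendsto_intros rat) auto
    then have "\<forall>\<^sub>F s in at_right 0. a < (1 - f (c * s) / f s) / (c - 1)"
      using c(2) by (rule order_tendstoD)
    moreover have "\<forall>\<^sub>F s in at_right 0. f s - f (c * s) \<le> (c - 1) * s * g s"
      using conv c by simp
    ultimately show "\<forall>\<^sub>F s in at_right 0. a < s * g s / f s"
      using fpos
    proof eventually_elim
      case (elim s)
      have "(1 - f (c * s) / f s) / (c - 1) = (f s - f (c * s)) / (f s * (c - 1))"
        using elim c by (simp add: field_simps)
      also have "\<dots> \<le> ((c - 1) * s * g s) / (f s * (c - 1))"
        using elim c by (intro divide_right_mono) auto
      also have "\<dots> = s * g s / f s"
        using elim c by (simp add: field_simps)
      finally show ?case using elim by simp
    qed
  next
    fix a assume a: "\<rho> < a"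
    have "\<forall>\<^sub>F c in at 1. (1 - c powr (-\<rho>)) / (c - 1) < a"
      by (rule order_tendstoD(2)[OF powr_difference_quotient a])
    then have "\<forall>\<^sub>F c in at_left 1. (1 - c powr (-\<rho>)) / (c - 1) < a"
      by (simp add: eventually_at_split)
    moreover have "\<forall>\<^sub>F c in at_left 1. 0 < c \<and> c < (1::real)"
      unfolding eventually_at_left_field by (intro exI[of _ 0]) auto
    ultimately have "\<forall>\<^sub>F c in at_left 1. (1 - c powr (-\<rho>)) / (c - 1) < a \<and> 0 < c \<and> c < 1"
      by eventually_elim auto
    then obtain c where c: "0 < c" "c < 1" "(1 - c powr (-\<rho>)) / (c - 1) < a"
      using eventually_happens'[OF trivial_limit_at_left_real] by blast
    have "((\<lambda>s. (1 - f (c * s) / f s) / (c - 1)) \<longlongrightarrow> (1 - c powr (-\<rho>)) / (c - 1)) (at_right 0)"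
      using c by (intro tendsto_intros rat) auto
    then have "\<forall>\<^sub>F s in at_right 0. (1 - f (c * s) / f s) / (c - 1) < a"
      using c(3) by (rule order_tendstoD)
    moreover have "\<forall>\<^sub>F s in at_right 0. f s - f (c * s) \<le> (c - 1) * s * g s"
      using conv c by simp
    ultimately show "\<forall>\<^sub>F s in at_right 0. s * g s / f s < a"
      using fpos
    proof eventually_elim
      case (elim s)
      have "s * g s / f s = ((c - 1) * s * g s) / (f s * (c - 1))"
        using elim c by (simp add: field_simps)
      also have "\<dots> \<le> (f s - f (c * s)) / (f s * (c - 1))"
        using elim c by (intro divide_right_mono_neg) (auto simp: mult_nonneg_nonpos)
      also have "\<dots> = (1 - f (c * s) / f s) / (c - 1)"
        using elim c by (simp add: field_simps)
      finally show ?case using elim by simp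
    qed
  qed
  have sinv: "filterlim (\<lambda>s::real. inverse s) at_top (at_right 0)"
    by (rule filterlim_inverse_at_top_right)
  have "filterlim (\<lambda>s. (s * g s / f s) * (f s * inverse s)) at_top (at_right 0)"
    by (rule filterlim_tendsto_pos_mult_at_top[OF key \<rho> filterlim_at_top_mult_at_top[OF flim sinv]])
  moreover have ev: "\<forall>\<^sub>F s in at_right 0. (s * g s / f s) * (f s * inverse s) = g s"
    using fpos pos by eventually_elim (auto simp: field_simps)
  ultimately have glim: "filterlim g at_top (at_right 0)"
    using filterlim_cong[OF refl refl ev] by simp
  moreover have "((\<lambda>s. g (c * s) / g s) \<longlongrightarrow> c powr (- (\<rho> + 1))) (at_right 0)" if c: "0 < c" for c
  proof -
    note cs = filterlim_mult_at_right_0[OF c]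
    have key': "((\<lambda>s. (c * s) * g (c * s) / f (c * s)) \<longlongrightarrow> \<rho>) (at_right 0)"
      by (rule filterlim_compose[OF key cs])
    have fpos': "\<forall>\<^sub>F s in at_right 0. 0 < f (c * s)"
      by (rule eventually_compose_filterlim[OF fpos cs])
    have gpos: "\<forall>\<^sub>F s in at_right 0. 0 < g s"
      using glim by (simp add: filterlim_at_top_dense)
    \<comment> \<open>The two factors with limit \<rho> cancel; the remaining 1 / c is what raises
      the index by one.\<close>
    have "((\<lambda>s. ((c * s) * g (c * s) / f (c * s)) / (s * g s / f s) * (f (c * s) / f s) / c) \<longlongrightarrow>
        \<rho> / \<rho> * c powr (-\<rho>) / c) (at_right 0)"
      using \<rho> c by (intro tendsto_intros key key' rat) auto
    moreover have "\<rho> / \<rho> * c powr (-\<rho>) / c = c powr (-(\<rho>+1))"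
      using \<rho> c by (simp add: powr_diff)
    moreover have "\<forall>\<^sub>F s in at_right 0. ((c * s) * g (c * s) / f (c * s)) / (s * g s / f s) * (f (c * s) / f s) / c
        = g (c * s) / g s"
      using fpos fpos' gpos pos by eventually_elim (use c in \<open>auto simp: field_simps\<close>)
    ultimately show ?thesis
      using tendsto_cong by force
  qed
  ultimately show ?thesis by (simp add: regvar0_def)
qed

section \<open>Tilted moments\<close>

lemma power_abs_le_exp:
  fixes x \<eta> :: real
  assumes "0 < \<eta>"
  shows "\<bar>x\<bar> ^ N \<le> fact N / \<eta> ^ N * exp (\<eta> * \<bar>x\<bar>)"
proof -
  define z where "z = \<eta> * \<bar>x\<bar>"
  have z: "0 \<le> z" using assms by (simp add: z_def)
  obtain t where t: "exp z = (\<Sum>m<Suc N. z ^ m / fact m) + exp t / fact (Suc N) * z ^ Suc N"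
    using Maclaurin_exp_le[of z "Suc N"] by blast
  have "z ^ N / fact N \<le> (\<Sum>m<Suc N. z ^ m / fact m)"
    using z by (intro member_le_sum) auto
  also have "\<dots> \<le> exp z"
    unfolding t using z by simp
  finally have "z ^ N \<le> fact N * exp z"
    by (simp add: field_simps)
  then have "\<eta> ^ N * \<bar>x\<bar> ^ N \<le> fact N * exp (\<eta> * \<bar>x\<bar>)"
    by (simp add: z_def power_mult_distrib)
  then show ?thesis
    using assms by (simp add: field_simps)
qed

lemma exp_second_order_bound:
  fixes z :: real
  shows "\<bar>exp z - 1 - z\<bar> \<le> z\<^sup>2 * exp \<bar>z\<bar>"
proof -
  obtain t where t: "\<bar>t\<bar> \<le> \<bar>z\<bar>" "exp z = (\<Sum>m<2. z ^ m / fact m) + exp t / fact 2 * z ^ 2"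
    using Maclaurin_exp_le[of z 2] by blast
  have "exp z - 1 - z = exp t / 2 * z\<^sup>2"
    using t(2) by (simp add: numeral_2_eq_2)
  then have "\<bar>exp z - 1 - z\<bar> = exp t / 2 * z\<^sup>2"
    by (simp only:) (simp add: abs_mult)
  also have "\<dots> \<le> exp \<bar>z\<bar> * z\<^sup>2"
  proof (intro mult_right_mono)
    have "exp t \<le> exp \<bar>z\<bar>" using t(1) by simp
    then show "exp t / 2 \<le> exp \<bar>z\<bar>" using exp_gt_zero[of t] by linarith
  qed auto
  finally show ?thesis by (simp add: mult.commute)
qed

text \<open>Lets moments be differentiated under the integral from one integrable bound on the
  second-order remainder, without a limit theorem.\<close>

lemma DERIV_quadratic_error:
  fixes f :: "real \<Rightarrow> real"
  assumes "0 < \<eta>" and "\<And>h. \<bar>h\<bar> < \<eta> \<Longrightarrow> \<bar>f (v + h) - f v - h * D\<bar> \<le> C * h\<^sup>2"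
  shows "(f has_real_derivative D) (at v)"
  unfolding DERIV_def
proof (rule LIM_zero_cancel, rule Lim_null_comparison)
  have ev: "\<forall>\<^sub>F h in at 0. \<bar>h\<bar> < \<eta> \<and> h \<noteq> 0"
    unfolding eventually_at by (intro exI[of _ \<eta>]) (use assms in auto)
  show "\<forall>\<^sub>F h in at 0. norm ((f (v + h) - f v) / h - D) \<le> C * \<bar>h\<bar>"
    using ev
  proof eventually_elim
    case (elim h)
    have "(f (v + h) - f v) / h - D = (f (v + h) - f v - h * D) / h"
      using elim by (simp add: field_simps)
    then have "norm ((f (v + h) - f v) / h - D) = \<bar>f (v + h) - f v - h * D\<bar> / \<bar>h\<bar>"
      by simp
    also have "\<dots> \<le> C * h\<^sup>2 / \<bar>h\<bar>"
      using assms(2)[of h] elim by (intro divide_right_mono) auto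
    also have "\<dots> = C * \<bar>h\<bar>"
      by (cases "h \<ge> 0") (auto simp: power2_eq_square)
    finally show ?case .
  qed
  have "((\<lambda>h. C * \<bar>h\<bar>) \<longlongrightarrow> C * \<bar>0\<bar>) (at (0::real))"
    by (intro tendsto_intros)
  then show "((\<lambda>h. C * \<bar>h\<bar>) \<longlongrightarrow> 0) (at (0::real))" by simp
qed

text \<open>Nothing is said about the rate r itself, where the generating function may be finite or
  infinite. Nor must r be the critical exponent: case (i.1) uses the locale for \<open>L 1\<close>
  at a smaller rate.\<close>

locale exp_moments = prob_space \<mu> for \<mu> :: "real measure" +
  fixes r :: real
  assumes sets_eq[measurable_cong, simp]: "sets \<mu> = sets borel"
    and r_pos: "0 < r"
    and integrable_exp: "\<And>v. 0 \<le> v \<Longrightarrow> v < r \<Longrightarrow> integrable \<mu> (\<lambda>x. exp (v * x))"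
begin

text \<open>The common majorant of the integrands at all rates within \<eta> of v. The power is
  absorbed by a further exponential of rate \<kappa>, and the result is dominated by the
  exponentials at the two rates v \<plusminus> (\<eta> + \<kappa>).\<close>

lemma integrable_weight:
  assumes v: "0 < v - \<eta>" "v + \<eta> < r" "0 \<le> \<eta>"
  shows "integrable \<mu> (\<lambda>x. \<bar>x\<bar> ^ N * exp (v * x + \<eta> * \<bar>x\<bar>))"
proof -
  \<comment> \<open>Half of the smaller gap between v \<plusminus> \<eta> and the ends of (0,
    r).\<close>
  define \<kappa> where "\<kappa> = min (v - \<eta>) (r - (v + \<eta>)) / 2"
  have \<kappa>: "0 < \<kappa>" "0 < v - (\<eta> + \<kappa>)" "v + (\<eta> + \<kappa>) < r"
    using v by (auto simp: \<kappa>_def min_def field_simps)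
  define C where "C = fact N / \<kappa> ^ N"
  have C: "0 \<le> C" using \<kappa> by (simp add: C_def)
  have int: "integrable \<mu> (\<lambda>x. C * (exp ((v + (\<eta> + \<kappa>)) * x) + exp ((v - (\<eta> + \<kappa>)) * x)))"
    using \<kappa> v by (intro integrable_mult_right Bochner_Integration.integrable_add integrable_exp) auto
  show ?thesis
  proof (rule Bochner_Integration.integrable_bound[OF int])
    show "AE x in \<mu>. norm (\<bar>x\<bar> ^ N * exp (v * x + \<eta> * \<bar>x\<bar>))
        \<le> norm (C * (exp ((v + (\<eta> + \<kappa>)) * x) + exp ((v - (\<eta> + \<kappa>)) * x)))"
    proof (rule AE_I2)
      fix x
      have "\<bar>x\<bar> ^ N * exp (v * x + \<eta> * \<bar>x\<bar>) \<le> C * exp (\<kappa> * \<bar>x\<bar>) * exp (v * x + \<eta> * \<bar>x\<bar>)"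
        unfolding C_def using power_abs_le_exp[OF \<kappa>(1), of x N] by (intro mult_right_mono) auto
      also have "\<dots> = C * exp (v * x + (\<eta> + \<kappa>) * \<bar>x\<bar>)"
        by (simp add: exp_add algebra_simps)
      also have "\<dots> \<le> C * (exp ((v + (\<eta> + \<kappa>)) * x) + exp ((v - (\<eta> + \<kappa>)) * x))"
        using C by (intro mult_left_mono) (cases "0 \<le> x"; auto simp: algebra_simps)+
      finally show "norm (\<bar>x\<bar> ^ N * exp (v * x + \<eta> * \<bar>x\<bar>))
          \<le> norm (C * (exp ((v + (\<eta> + \<kappa>)) * x) + exp ((v - (\<eta> + \<kappa>)) * x)))"
        using C by (simp add: abs_mult)
    qed
  qed measurable
qed

lemma integrable_moment:
  assumes v: "0 < v" "v < r" and [measurable]: "B \<in> sets borel"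
  shows "integrable \<mu> (\<lambda>x. indicator B x * (x ^ N * exp (v * x)))"
proof (rule Bochner_Integration.integrable_bound)
  show "integrable \<mu> (\<lambda>x. \<bar>x\<bar> ^ N * exp (v * x + 0 * \<bar>x\<bar>))"
    using v by (intro integrable_weight) auto
qed (auto simp: abs_mult power_abs indicator_def)

text \<open>With B = UNIV this is the N-th derivative of the generating function; B = {0<..} gives
  the version that is monotone in the rate.\<close>

definition mom :: "real set \<Rightarrow> nat \<Rightarrow> real \<Rightarrow> real" where
  "mom B N v = (\<integral>x. indicator B x * (x ^ N * exp (v * x)) \<partial>\<mu>)"

lemma mom_has_derivative:
  assumes v: "0 < v" "v < r" and B[measurable]: "B \<in> sets borel"
  shows "(mom B N has_real_derivative mom B (Suc N) v) (at v)"
proof -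
  define \<eta> where "\<eta> = min v (r - v) / 2"
  have \<eta>: "0 < \<eta>" "0 < v - \<eta>" "v + \<eta> < r"
    using v by (auto simp: \<eta>_def min_def field_simps)
  define C where "C = (\<integral>x. \<bar>x\<bar> ^ (N + 2) * exp (v * x + \<eta> * \<bar>x\<bar>) \<partial>\<mu>)"
  have intC: "integrable \<mu> (\<lambda>x. \<bar>x\<bar> ^ (N + 2) * exp (v * x + \<eta> * \<bar>x\<bar>))"
    using \<eta> by (intro integrable_weight) auto
  show ?thesis
  proof (rule DERIV_quadratic_error[OF \<eta>(1)])
    fix h assume h: "\<bar>h\<bar> < \<eta>"
    let ?f = "\<lambda>M u x. indicator B x * (x ^ M * exp (u * x)) :: real"
    have vh: "0 < v + h" "v + h < r" using h \<eta> by auto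
    note ints = integrable_moment[OF v B] integrable_moment[OF vh B]
    have eq: "mom B N (v + h) - mom B N v - h * mom B (Suc N) v
        = (\<integral>x. ?f N (v + h) x - ?f N v x - h * ?f (Suc N) v x \<partial>\<mu>)"
      unfolding mom_def
      by (intro has_bochner_integral_integral_eq[symmetric] has_bochner_integral_diff
          has_bochner_integral_mult_right has_bochner_integral_integrable ints)
    have "\<bar>mom B N (v + h) - mom B N v - h * mom B (Suc N) v\<bar> \<le> (\<integral>x. h\<^sup>2 * (\<bar>x\<bar> ^ (N + 2) * exp (v * x + \<eta> * \<bar>x\<bar>)) \<partial>\<mu>)"
      unfolding eq
    proof (rule order_trans[OF integral_abs_bound], rule integral_mono)
      show "integrable \<mu> (\<lambda>x. \<bar>?f N (v + h) x - ?f N v x - h * ?f (Suc N) v x\<bar>)"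
        using ints by (intro integrable_abs Bochner_Integration.integrable_diff integrable_mult_right)
      show "integrable \<mu> (\<lambda>x. h\<^sup>2 * (\<bar>x\<bar> ^ (N + 2) * exp (v * x + \<eta> * \<bar>x\<bar>)))"
        using intC by (rule integrable_mult_right)
      fix x
      have eq: "?f N (v + h) x - ?f N v x - h * ?f (Suc N) v x
          = indicator B x * x ^ N * exp (v * x) * (exp (h * x) - 1 - h * x)"
        by (simp add: exp_add algebra_simps)
      have "\<bar>?f N (v + h) x - ?f N v x - h * ?f (Suc N) v x\<bar> \<le> \<bar>x\<bar> ^ N * exp (v * x) * \<bar>exp (h * x) - 1 - h * x\<bar>"
        unfolding eq by (auto simp: abs_mult power_abs indicator_def)
      also have "\<dots> \<le> \<bar>x\<bar> ^ N * exp (v * x) * ((h * x)\<^sup>2 * exp \<bar>h * x\<bar>)"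
        by (intro mult_left_mono exp_second_order_bound) auto
      also have "\<dots> \<le> \<bar>x\<bar> ^ N * exp (v * x) * ((h * x)\<^sup>2 * exp (\<eta> * \<bar>x\<bar>))"
      proof (intro mult_left_mono)
        show "exp \<bar>h * x\<bar> \<le> exp (\<eta> * \<bar>x\<bar>)"
          using h mult_right_mono[of "\<bar>h\<bar>" \<eta> "\<bar>x\<bar>"] by (simp add: abs_mult)
      qed auto
      also have "\<dots> = h\<^sup>2 * (\<bar>x\<bar> ^ (N + 2) * exp (v * x + \<eta> * \<bar>x\<bar>))"
        by (simp add: exp_add power_add power_mult_distrib power2_eq_square)
      finally show "\<bar>?f N (v + h) x - ?f N v x - h * ?f (Suc N) v x\<bar>
          \<le> h\<^sup>2 * (\<bar>x\<bar> ^ (N + 2) * exp (v * x + \<eta> * \<bar>x\<bar>))" .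
    qed
    also have "\<dots> = C * h\<^sup>2"
      unfolding C_def using intC by simp
    finally show "\<bar>mom B N (v + h) - mom B N v - h * mom B (Suc N) v\<bar> \<le> C * h\<^sup>2" .
  qed
qed

lemma mgf_eq_integral:
  assumes "integrable \<mu> (\<lambda>x. exp (v * x))"
  shows "mgf \<mu> v = ennreal (\<integral>x. exp (v * x) \<partial>\<mu>)"
  unfolding mgf_def using assms by (intro nn_integral_eq_integral) auto

lemma mgf_eq_mom:
  assumes "0 < v" "v < r"
  shows "enn2real (mgf \<mu> v) = mom UNIV 0 v"
  using mgf_eq_integral[OF integrable_exp, of v] assms by (simp add: mom_def)

lemma deriv_mgf:
  assumes "0 < v" "v < r"
  shows "(deriv ^^ n) (\<lambda>v. enn2real (mgf \<mu> v)) v = mom UNIV n v"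
  using assms
proof (induction n arbitrary: v)
  case 0
  then show ?case by (simp add: mgf_eq_mom)
next
  case (Suc n)
  have "\<forall>\<^sub>F w in nhds v. w \<in> {0<..<r}"
    using Suc.prems by (intro eventually_nhds_in_open) auto
  then have "\<forall>\<^sub>F w in nhds v. (deriv ^^ n) (\<lambda>v. enn2real (mgf \<mu> v)) w = mom UNIV n w"
    by eventually_elim (use Suc.IH in auto)
  then have "deriv ((deriv ^^ n) (\<lambda>v. enn2real (mgf \<mu> v))) v = deriv (mom UNIV n) v"
    by (rule deriv_cong_ev) simp
  also have "\<dots> = mom UNIV (Suc n) v"
    using Suc.prems by (intro DERIV_imp_deriv mom_has_derivative) auto
  finally show ?case by simp
qed

text \<open>Discarding the negative axis changes the moments by a bounded amount only, and makes them monotone in \<open>s\<close>.\<close>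

definition hmom :: "nat \<Rightarrow> real \<Rightarrow> real" where
  "hmom N s = mom {0<..} N (r - s)"

lemma hmom_nonneg: "0 \<le> hmom N s"
  unfolding hmom_def mom_def by (intro integral_nonneg_AE AE_I2) (auto simp: indicator_def)

lemma hmom_antimono:
  assumes "0 < s" "s \<le> t" "t < r"
  shows "hmom N t \<le> hmom N s"
  unfolding hmom_def mom_def
proof (intro integral_mono integrable_moment)
  fix x
  have "(r - t) * x \<le> (r - s) * x" if "0 < x"
    using assms that by (intro mult_right_mono) auto
  then show "indicator {0<..} x * (x ^ N * exp ((r - t) * x)) \<le> indicator {0<..} x * (x ^ N * exp ((r - s) * x))"
    by (auto simp: indicator_def intro!: mult_left_mono)
qed (use assms in auto)

text \<open>Tangent-line inequality: \<open>- hmom (Suc N)\<close> is the derivative of the convex function \<open>hmom N\<close>.\<close>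

lemma hmom_convex:
  assumes "0 < s" "s < r" "0 < t" "t < r"
  shows "hmom N s - hmom N t \<le> (t - s) * hmom (Suc N) s"
proof -
  have ints: "integrable \<mu> (\<lambda>x. indicator {0<..} x * (x ^ M * exp ((r - s) * x)))"
    "integrable \<mu> (\<lambda>x. indicator {0<..} x * (x ^ M * exp ((r - t) * x)))" for M
    using assms by (auto intro!: integrable_moment)
  have "hmom N s - hmom N t = (\<integral>x. indicator {0<..} x * (x ^ N * exp ((r - s) * x)) -
      indicator {0<..} x * (x ^ N * exp ((r - t) * x)) \<partial>\<mu>)"
    unfolding hmom_def mom_def using ints by simp
  also have "\<dots> \<le> (\<integral>x. (t - s) * (indicator {0<..} x * (x ^ Suc N * exp ((r - s) * x))) \<partial>\<mu>)"
  proof (rule integral_mono)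
    fix x
    show "indicator {0<..} x * (x ^ N * exp ((r - s) * x)) - indicator {0<..} x * (x ^ N * exp ((r - t) * x))
       \<le> (t - s) * (indicator {0<..} x * (x ^ Suc N * exp ((r - s) * x)))"
    proof (cases "0 < x")
      case True
      define E1 E2 where "E1 = exp ((r - s) * x)" and "E2 = exp ((s - t) * x)"
      have e: "exp ((r - t) * x) = E1 * E2"
        unfolding E1_def E2_def by (simp add: algebra_simps flip: exp_add)
      have "(t - s) * x = - ((s - t) * x)" by (simp add: algebra_simps)
      then have "1 - E2 \<le> (t - s) * x"
        unfolding E2_def using exp_ge_add_one_self[of "(s - t) * x"] by linarith
      then have "x ^ N * E1 * (1 - E2) \<le> x ^ N * E1 * ((t - s) * x)"
        using True by (intro mult_left_mono) (auto simp: E1_def)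
      then show ?thesis
        using True unfolding e E1_def[symmetric] by (simp add: algebra_simps)
    qed auto
  qed (intro Bochner_Integration.integrable_diff integrable_mult_right ints)+
  also have "\<dots> = (t - s) * hmom (Suc N) s"
    unfolding hmom_def mom_def by (simp del: power_Suc)
  finally show ?thesis .
qed

lemma hmom_regvar_Suc:
  assumes "regvar0 \<rho> (hmom N)" "0 < \<rho>"
  shows "regvar0 (\<rho> + 1) (hmom (Suc N))"
proof (rule regvar0_step[OF assms])
  fix c :: real assume c: "0 < c"
  have 1: "\<forall>\<^sub>F s in at_right 0. s \<in> {0<..<r}"
    using r_pos by (rule eventually_at_right_real)
  then have "\<forall>\<^sub>F s in at_right 0. c * s \<in> {0<..<r}"
    using filterlim_mult_at_right_0[OF c] by (rule eventually_compose_filterlim)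
  with 1 show "\<forall>\<^sub>F s in at_right 0. hmom N s - hmom N (c * s) \<le> (c - 1) * s * hmom (Suc N) s"
  proof eventually_elim
    case (elim s)
    then show ?case using hmom_convex[of s "c * s" N] by (simp add: algebra_simps)
  qed
qed

lemma hmom_regvar_add:
  assumes "regvar0 \<rho> (hmom N)" "0 < \<rho>"
  shows "regvar0 (\<rho> + real k) (hmom (N + k))"
proof (induction k)
  case (Suc k)
  then show ?case using hmom_regvar_Suc[OF Suc] assms(2) by (simp add: add_ac)
qed (use assms in auto)

text \<open>For x \<le> 0 and s \<le> r / 2 the exponential is at most exp (r x / 2), so the
  discarded part is bounded independently of s.\<close>

lemma mom_bounded_diff:
  obtains C where "\<And>s. 0 < s \<Longrightarrow> s \<le> r / 2 \<Longrightarrow> \<bar>mom UNIV N (r - s) - hmom N s\<bar> \<le> C"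
proof
  fix s assume s: "0 < s" "s \<le> r / 2"
  have v: "0 < r - s" "r - s < r" using s r_pos by auto
  have int2: "integrable \<mu> (\<lambda>x. \<bar>x\<bar> ^ N * exp ((r/2) * x + 0 * \<bar>x\<bar>))"
    using r_pos by (intro integrable_weight) auto
  note ints = integrable_moment[OF v, of _ N]
  have eq: "mom UNIV N (r - s) - hmom N s = (\<integral>x. indicator UNIV x * (x ^ N * exp ((r - s) * x)) -
     indicator {0<..} x * (x ^ N * exp ((r - s) * x)) \<partial>\<mu>)"
    unfolding hmom_def mom_def using ints[of UNIV] ints[of "{0<..}"]
    by (subst Bochner_Integration.integral_diff) auto
  show "\<bar>mom UNIV N (r - s) - hmom N s\<bar> \<le> (\<integral>x. \<bar>x\<bar> ^ N * exp ((r/2) * x + 0 * \<bar>x\<bar>) \<partial>\<mu>)"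
    unfolding eq
  proof (rule order_trans[OF integral_abs_bound], rule integral_mono)
    show "integrable \<mu> (\<lambda>x. \<bar>indicator UNIV x * (x ^ N * exp ((r - s) * x)) - indicator {0<..} x * (x ^ N * exp ((r - s) * x))\<bar>)"
      using ints[of UNIV] ints[of "{0<..}"]
      by (intro integrable_abs Bochner_Integration.integrable_diff) auto
    fix x
    have "(r - s) * x \<le> r / 2 * x" if "x \<le> 0"
      using s that by (intro mult_right_mono_neg) auto
    then show "\<bar>indicator UNIV x * (x ^ N * exp ((r - s) * x)) - indicator {0<..} x * (x ^ N * exp ((r - s) * x))\<bar>
        \<le> \<bar>x\<bar> ^ N * exp ((r/2) * x + 0 * \<bar>x\<bar>)"
      by (auto simp: indicator_def abs_mult power_abs intro!: mult_left_mono)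
  qed (rule int2)
qed

end

section \<open>Mass of windows\<close>

text \<open>The rate has 2 \<delta> instead of \<delta>: the upper end of the window costs exp (r (1
  + \<delta>) y), and the additional r \<delta> y pays for polynomial factors.\<close>

definition window_tail :: "real measure \<Rightarrow> real \<Rightarrow> bool" where
  "window_tail \<mu> r \<longleftrightarrow> (\<forall>\<delta>. 0 < \<delta> \<and> \<delta> < 1 \<longrightarrow>
     (\<forall>\<^sub>F y in at_top. exp (- (r * (1 + 2 * \<delta>) * y)) \<le> measure \<mu> {(1 - \<delta>) * y..(1 + \<delta>) * y}))"

section \<open>From the criteria to regular variation of the positive moments\<close>

context exp_moments
begin

lemma hmom_at_top:
  assumes S: "\<And>k. 0 < S k" "S \<longlonglongrightarrow> 0" and lim: "filterlim (\<lambda>k::nat. mom UNIV n (r - S k)) at_top sequentially"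
  shows "filterlim (hmom n) at_top (at_right 0)"
proof -
  obtain C where C: "\<And>s. 0 < s \<Longrightarrow> s \<le> r / 2 \<Longrightarrow> \<bar>mom UNIV n (r - s) - hmom n s\<bar> \<le> C"
    using mom_bounded_diff[of n] by blast
  have Sev: "\<forall>\<^sub>F k in sequentially. S k < r / 2"
    using order_tendstoD(2)[OF S(2), of "r/2"] r_pos by simp
  show ?thesis
  proof (rule antimono_filterlim_at_top[OF r_pos hmom_antimono])
    fix D
    have "\<forall>\<^sub>F k in sequentially. D + C \<le> mom UNIV n (r - S k)"
      using lim by (simp add: filterlim_at_top)
    then have "\<forall>\<^sub>F k in sequentially. D + C \<le> mom UNIV n (r - S k) \<and> S k < r / 2"
      using Sev by eventually_elim auto
    then obtain k where k: "D + C \<le> mom UNIV n (r - S k)" "S k < r / 2"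
      using eventually_happens'[OF sequentially_bot] by blast
    then have "D \<le> hmom n (S k)"
      using C[of "S k"] S(1)[of k] by auto
    then show "\<exists>s>0. s < r \<and> D \<le> hmom n s"
      using S(1)[of k] k r_pos by (intro exI[of _ "S k"]) auto
  qed auto
qed

text \<open>The full derivative need not be monotone in s. Its divergence along a sequence is
  therefore first passed to \<open>hmom n\<close>; once that diverges, a bounded difference becomes
  asymptotic equivalence.\<close>

lemma criterion_I_regvar:
  assumes l: "slowly_varying l" and \<rho>: "0 < \<rho>"
    and G: "(\<lambda>s. (deriv ^^ n) (\<lambda>v. enn2real (mgf \<mu> v)) (r - s)) \<sim>[at_right 0] (\<lambda>s. s powr (- \<rho>) * l (1 / s))"
  shows "regvar0 \<rho> (hmom n)"
proof -
  define f where "f s = (deriv ^^ n) (\<lambda>v. enn2real (mgf \<mu> v)) (r - s)" for s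
  have f: "f \<sim>[at_right 0] (\<lambda>s. s powr (- \<rho>) * l (1 / s))"
    using G unfolding f_def .
  have fmom: "f s = mom UNIV n (r - s)" if "0 < s" "s < r" for s
    using that unfolding f_def by (intro deriv_mgf) auto
  note rat = slowly_varying_ratio[OF l f]
  obtain S where S: "\<And>k. 0 < S k" "S \<longlonglongrightarrow> (0::real)" "filterlim (\<lambda>k::nat. f (S k)) at_top sequentially"
    by (rule ratio_blowup[OF \<rho> rat(1)[OF zero_less_one] rat(2)[OF half_gt_zero[OF zero_less_one]]]) (rule that)
  have ev: "\<forall>\<^sub>F k in sequentially. f (S k) = mom UNIV n (r - S k)"
    using order_tendstoD(2)[OF S(2) r_pos] by eventually_elim (use fmom S(1) in auto)
  have "filterlim (\<lambda>k::nat. mom UNIV n (r - S k)) at_top sequentially"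
    using S(3) filterlim_cong[OF refl refl ev] by simp
  note hlim = hmom_at_top[OF S(1,2) this]
  obtain C where C: "\<And>s. 0 < s \<Longrightarrow> s \<le> r / 2 \<Longrightarrow> \<bar>mom UNIV n (r - s) - hmom n s\<bar> \<le> C"
    using mom_bounded_diff[of n] by blast
  have "\<forall>\<^sub>F s in at_right 0. s \<in> {0<..<r/2}"
    using r_pos by (intro eventually_at_right_real) auto
  then have "\<forall>\<^sub>F s in at_right 0. \<bar>f s - hmom n s\<bar> \<le> C"
    by eventually_elim (use C fmom r_pos in auto)
  then have fh: "f \<sim>[at_right 0] hmom n"
    by (rule asymp_equiv_bounded_diff[OF hlim])
  have "filterlim f at_top (at_right 0)"
    using asymp_equiv_at_top_transfer[OF asymp_equiv_symI[OF fh] hlim] .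
  then have "regvar0 \<rho> f"
    using rat(2) by (intro regvar0_of_ratio) auto
  then show ?thesis
    using regvar0_asymp_equiv[of \<rho> f 1 "hmom n"] fh by simp
qed

lemma mom_UNIV_0_pos:
  assumes "0 < v" "v < r"
  shows "0 < mom UNIV 0 v"
proof -
  have int: "integrable \<mu> (\<lambda>x. exp (v * x))"
    using assms by (intro integrable_exp) auto
  have "0 \<noteq> (\<integral>x. exp (v * x) \<partial>\<mu>)"
  proof
    assume "0 = (\<integral>x. exp (v * x) \<partial>\<mu>)"
    then have "AE x in \<mu>. exp (v * x) = 0"
      using integral_nonneg_eq_0_iff_AE[OF int] by simp
    then show False
      by simp
  qed
  moreover have "0 \<le> (\<integral>x. exp (v * x) \<partial>\<mu>)"
    by (rule integral_nonneg_AE) simp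
  ultimately have "0 < (\<integral>x. exp (v * x) \<partial>\<mu>)"
    by linarith
  then show ?thesis by (simp add: mom_def)
qed

text \<open>The logarithm is 1-Lipschitz on [1, \<infinity>), so discarding the negative axis
  changes the logarithm of the generating function by a bounded amount as well, once
  \<open>hmom 0\<close> exceeds 1.\<close>

lemma criterion_II_regvar:
  assumes l: "slowly_varying l" and \<rho>: "0 < \<rho>"
    and G: "(\<lambda>s. ln (enn2real (mgf \<mu> (r - s)))) \<sim>[at_right 0] (\<lambda>s. s powr (- \<rho>) * l (1 / s))"
  shows "regvar0 \<rho> (\<lambda>s. ln (hmom 0 s))" and "filterlim (hmom 0) at_top (at_right 0)"
proof -
  define f where "f s = ln (enn2real (mgf \<mu> (r - s)))" for s
  have f: "f \<sim>[at_right 0] (\<lambda>s. s powr (- \<rho>) * l (1 / s))"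
    using G unfolding f_def .
  have fmom: "f s = ln (mom UNIV 0 (r - s))" if "0 < s" "s < r" for s
    using that unfolding f_def by (subst mgf_eq_mom) auto
  note rat = slowly_varying_ratio[OF l f]
  obtain S where S: "\<And>k. 0 < S k" "S \<longlonglongrightarrow> (0::real)" "filterlim (\<lambda>k::nat. f (S k)) at_top sequentially"
    by (rule ratio_blowup[OF \<rho> rat(1)[OF zero_less_one] rat(2)[OF half_gt_zero[OF zero_less_one]]]) (rule that)
  have ev: "\<forall>\<^sub>F k in sequentially. exp (f (S k)) = mom UNIV 0 (r - S k)"
    using order_tendstoD(2)[OF S(2) r_pos]
    by eventually_elim (use fmom S(1) mom_UNIV_0_pos in auto)
  have "filterlim (\<lambda>k::nat. mom UNIV 0 (r - S k)) at_top sequentially"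
    using filterlim_compose[OF exp_at_top S(3)] filterlim_cong[OF refl refl ev] by simp
  then show hlim: "filterlim (hmom 0) at_top (at_right 0)"
    using hmom_at_top[OF S(1,2)] by blast
  have klim: "filterlim (\<lambda>s. ln (hmom 0 s)) at_top (at_right 0)"
    by (rule filterlim_compose[OF ln_at_top hlim])
  obtain C where C: "\<And>s. 0 < s \<Longrightarrow> s \<le> r / 2 \<Longrightarrow> \<bar>mom UNIV 0 (r - s) - hmom 0 s\<bar> \<le> C"
    using mom_bounded_diff[of 0] by blast
  have "\<forall>\<^sub>F s in at_right 0. s \<in> {0<..<r/2}"
    using r_pos by (intro eventually_at_right_real) auto
  moreover have "\<forall>\<^sub>F s in at_right 0. 1 \<le> hmom 0 s"
    using hlim by (simp add: filterlim_at_top)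
  ultimately have "\<forall>\<^sub>F s in at_right 0. \<bar>f s - ln (hmom 0 s)\<bar> \<le> C"
  proof eventually_elim
    case (elim s)
    have v: "0 < r - s" "r - s < r" using elim by auto
    have le: "hmom 0 s \<le> mom UNIV 0 (r - s)"
      unfolding hmom_def mom_def
      by (intro integral_mono integrable_moment) (use v in \<open>auto simp: indicator_def\<close>)
    have "f s - ln (hmom 0 s) = ln (mom UNIV 0 (r - s) / hmom 0 s)"
      using fmom[of s] elim v le by (simp add: ln_div)
    also have "\<dots> \<le> mom UNIV 0 (r - s) / hmom 0 s - 1"
      using elim le by (intro ln_le_minus_one) auto
    also have "\<dots> = (mom UNIV 0 (r - s) - hmom 0 s) / hmom 0 s"
      using elim by (simp add: field_simps)
    also have "\<dots> \<le> (mom UNIV 0 (r - s) - hmom 0 s) / 1"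
      using elim le by (intro divide_left_mono) auto
    also have "\<dots> \<le> C" using C[of s] elim le by auto
    finally have "f s - ln (hmom 0 s) \<le> C" .
    moreover have "ln (hmom 0 s) \<le> f s"
      using fmom[of s] elim v le by simp
    ultimately show ?case by simp
  qed
  then have fh: "f \<sim>[at_right 0] (\<lambda>s. ln (hmom 0 s))"
    by (rule asymp_equiv_bounded_diff[OF klim])
  have "filterlim f at_top (at_right 0)"
    using asymp_equiv_at_top_transfer[OF asymp_equiv_symI[OF fh] klim] .
  then have "regvar0 \<rho> f"
    using rat(2) by (intro regvar0_of_ratio) auto
  then show "regvar0 \<rho> (\<lambda>s. ln (hmom 0 s))"
    using regvar0_asymp_equiv[of \<rho> f 1 "\<lambda>s. ln (hmom 0 s)"] fh by simp
qed

section \<open>Concentration of tilted laws in windows\<close>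

text \<open>Under the tilted measure with density proportional to \<open>x ^ N * exp ((r - s) * x)\<close> on the positive axis,
  at least half of the mass lies in the window around \<open>y\<close>, by two exponential Chebyshev bounds.\<close>

lemma window_chernoff:
  assumes \<theta>: "0 < \<theta>" "\<theta> < 1" and s: "0 < s" "(1 + \<theta>) * s < r" and \<delta>: "0 < \<delta>" "\<delta> < 1" and y: "0 < y"
    and up: "exp (- (\<theta> * s * ((1 + \<delta>) * y))) * hmom N ((1 - \<theta>) * s) \<le> hmom N s / 4"
    and low: "exp (\<theta> * s * ((1 - \<delta>) * y)) * hmom N ((1 + \<theta>) * s) \<le> hmom N s / 4"
  shows "hmom N s \<le> 2 * ((1 + \<delta>) * y) ^ N * exp (r * ((1 + \<delta>) * y)) * measure \<mu> {(1 - \<delta>) * y..(1 + \<delta>) * y}"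
proof -
  let ?W = "{(1 - \<delta>) * y..(1 + \<delta>) * y}"
  let ?A = "((1 + \<delta>) * y) ^ N * exp (r * ((1 + \<delta>) * y))"
  let ?f = "\<lambda>s x. indicator {0<..} x * (x ^ N * exp ((r - s) * x)) :: real"
  let ?u = "exp (- (\<theta> * s * ((1 + \<delta>) * y)))" and ?l = "exp (\<theta> * s * ((1 - \<delta>) * y))"
  have \<theta>s: "\<theta> * s > 0" "\<theta> * s < s" using \<theta> s by auto
  then have v: "0 < r - s" "r - s < r" "0 < r - (1 - \<theta>) * s" "r - (1 - \<theta>) * s < r"
    "0 < r - (1 + \<theta>) * s" "r - (1 + \<theta>) * s < r"
    using s \<theta>s unfolding distrib_right left_diff_distrib by auto
  have i1: "integrable \<mu> (?f s)" and i2: "integrable \<mu> (?f ((1 - \<theta>) * s))" and i3: "integrable \<mu> (?f ((1 + \<theta>) * s))"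
    using v by (auto intro!: integrable_moment)
  have i4: "integrable \<mu> (\<lambda>x. indicator ?W x :: real)"
    by (intro integrable_real_indicator) (auto simp: emeasure_eq_measure)
  have "hmom N s = (\<integral>x. ?f s x \<partial>\<mu>)"
    by (simp add: hmom_def mom_def)
  also have "\<dots> \<le> (\<integral>x. ?A * indicator ?W x + ?u * ?f ((1 - \<theta>) * s) x + ?l * ?f ((1 + \<theta>) * s) x \<partial>\<mu>)"
  proof (rule integral_mono[OF i1])
    show "integrable \<mu> (\<lambda>x. ?A * indicator ?W x + ?u * ?f ((1 - \<theta>) * s) x + ?l * ?f ((1 + \<theta>) * s) x)"
      by (intro Bochner_Integration.integrable_add integrable_mult_right i2 i3 i4)
    fix x
    have nn: "0 \<le> ?A * indicator ?W x" "0 \<le> ?u * ?f ((1 - \<theta>) * s) x" "0 \<le> ?l * ?f ((1 + \<theta>) * s) x"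
      using y \<delta> by (auto simp: indicator_def)
    consider "x \<le> 0" | "0 < x" "x < (1 - \<delta>) * y" | "(1 + \<delta>) * y < x" "0 < x" | "x \<in> ?W" "0 < x"
      by fastforce
    then show "?f s x \<le> ?A * indicator ?W x + ?u * ?f ((1 - \<theta>) * s) x + ?l * ?f ((1 + \<theta>) * s) x"
    proof cases
      case 1 then show ?thesis using nn by simp
    next
      case 2
      have "\<theta> * s * x \<le> \<theta> * s * ((1 - \<delta>) * y)" using 2 \<theta> s by (intro mult_left_mono) auto
      then have "exp ((r - s) * x) \<le> ?l * exp ((r - (1 + \<theta>) * s) * x)"
        by (simp add: algebra_simps flip: exp_add)
      then have "x ^ N * exp ((r - s) * x) \<le> x ^ N * (?l * exp ((r - (1 + \<theta>) * s) * x))"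
        using 2 by (intro mult_left_mono) auto
      then have "?f s x \<le> ?l * ?f ((1 + \<theta>) * s) x"
        using 2 by (simp add: mult_ac)
      then show ?thesis using nn by linarith
    next
      case 3
      have "\<theta> * s * ((1 + \<delta>) * y) \<le> \<theta> * s * x" using 3 \<theta> s by (intro mult_left_mono) auto
      then have "exp ((r - s) * x) \<le> ?u * exp ((r - (1 - \<theta>) * s) * x)"
        by (simp add: algebra_simps flip: exp_add)
      then have "x ^ N * exp ((r - s) * x) \<le> x ^ N * (?u * exp ((r - (1 - \<theta>) * s) * x))"
        using 3 by (intro mult_left_mono) auto
      then have "?f s x \<le> ?u * ?f ((1 - \<theta>) * s) x"
        using 3 by (simp add: mult_ac)
      then show ?thesis using nn by linarith
    next
      case 4
      have "(r - s) * x \<le> r * x" using 4 s by (intro mult_right_mono) auto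
      also have "\<dots> \<le> r * ((1 + \<delta>) * y)" using 4 r_pos by (intro mult_left_mono) auto
      finally have "x ^ N * exp ((r - s) * x) \<le> ?A"
        using 4 by (intro mult_mono power_mono) auto
      then have "?f s x \<le> ?A * indicator ?W x" using 4 by simp
      then show ?thesis using nn by linarith
    qed
  qed
  also have "\<dots> = ?A * measure \<mu> ?W + ?u * hmom N ((1 - \<theta>) * s) + ?l * hmom N ((1 + \<theta>) * s)"
  proof (rule has_bochner_integral_integral_eq)
    have "has_bochner_integral \<mu> (\<lambda>x. indicator ?W x) (measure \<mu> ?W)"
      by (intro has_bochner_integral_real_indicator) (auto simp: emeasure_eq_measure)
    then show "has_bochner_integral \<mu> (\<lambda>x. ?A * indicator ?W x + ?u * ?f ((1 - \<theta>) * s) x + ?l * ?f ((1 + \<theta>) * s) x)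
        (?A * measure \<mu> ?W + ?u * hmom N ((1 - \<theta>) * s) + ?l * hmom N ((1 + \<theta>) * s))"
      unfolding hmom_def mom_def
      by (intro has_bochner_integral_add has_bochner_integral_mult_right has_bochner_integral_integrable i2 i3)
  qed
  \<comment> \<open>Both tails together take at most half of \<open>hmom N s\<close>, which is moved
    to the other side; hence the factor 2.\<close>
  finally show ?thesis using up low by (simp add: algebra_simps)
qed

lemma window_tailI:
  assumes "\<And>\<delta>. 0 < \<delta> \<Longrightarrow> \<delta> < 1 \<Longrightarrow> \<exists>N. \<forall>\<^sub>F y in at_top. 1 \<le> 2 * ((1 + \<delta>) * y) ^ N *
    exp (r * ((1 + \<delta>) * y)) * measure \<mu> {(1 - \<delta>) * y..(1 + \<delta>) * y}"
  shows "window_tail \<mu> r"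
  unfolding window_tail_def
proof (intro allI impI, elim conjE)
  fix \<delta> :: real assume \<delta>: "0 < \<delta>" "\<delta> < 1"
  obtain N where N: "\<forall>\<^sub>F y in at_top. 1 \<le> 2 * ((1 + \<delta>) * y) ^ N *
      exp (r * ((1 + \<delta>) * y)) * measure \<mu> {(1 - \<delta>) * y..(1 + \<delta>) * y}"
    using assms[OF \<delta>] by blast
  \<comment> \<open>Chosen so that \<kappa> (1 + \<delta>) y = r \<delta> y, the surplus of the rate
    in \<open>window_tail\<close> over the cost at the upper end.\<close>
  define \<kappa> where "\<kappa> = r * \<delta> / (1 + \<delta>)"
  have \<kappa>: "0 < \<kappa>" using r_pos \<delta> by (simp add: \<kappa>_def)
  \<comment> \<open>One power more than needed: from z ^ (N + 1) \<le> D exp (\<kappa> z) and z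
    \<ge> 2 D the factor 2 z ^ N is absorbed by exp (\<kappa> z).\<close>
  define D where "D = fact (Suc N) / \<kappa> ^ Suc N"
  have "\<forall>\<^sub>F y in at_top. max 1 (2 * D) \<le> y" by (rule eventually_ge_at_top)
  with N show "\<forall>\<^sub>F y in at_top. exp (- (r * (1 + 2 * \<delta>) * y)) \<le> measure \<mu> {(1 - \<delta>) * y..(1 + \<delta>) * y}"
  proof eventually_elim
    case (elim y)
    define z where "z = (1 + \<delta>) * y"
    have z: "1 \<le> z" "2 * D \<le> z"
    proof -
      have "1 * y \<le> (1 + \<delta>) * y" using elim \<delta> by (intro mult_right_mono) auto
      then show "1 \<le> z" "2 * D \<le> z" using elim(2) unfolding z_def by linarith+
    qed
    have "z * z ^ N \<le> D * exp (\<kappa> * z)"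
      using power_abs_le_exp[OF \<kappa>, of z "Suc N"] z unfolding D_def by simp
    then have "2 * (z * z ^ N) \<le> 2 * D * exp (\<kappa> * z)" by simp
    also have "\<dots> \<le> z * exp (\<kappa> * z)"
      using z by (intro mult_right_mono) auto
    finally have "z * (2 * z ^ N) \<le> z * exp (\<kappa> * z)" by (simp add: mult_ac)
    then have zN: "2 * z ^ N \<le> exp (\<kappa> * z)" using z by simp
    let ?m = "measure \<mu> {(1 - \<delta>) * y..(1 + \<delta>) * y}"
    have "1 \<le> 2 * z ^ N * (exp (r * z) * ?m)" using elim by (simp add: z_def mult_ac)
    also have "\<dots> \<le> exp (\<kappa> * z) * (exp (r * z) * ?m)"
      using zN by (intro mult_right_mono) auto
    also have "\<dots> = exp (\<kappa> * z + r * z) * ?m"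
      by (simp add: exp_add)
    also have "\<kappa> * z + r * z = r * (1 + 2 * \<delta>) * y"
      using \<delta> by (simp add: z_def \<kappa>_def) (simp add: algebra_simps)
    finally have "1 \<le> exp (r * (1 + 2 * \<delta>) * y) * ?m" .
    then have "exp (- (r * (1 + 2 * \<delta>) * y)) * 1 \<le> exp (- (r * (1 + 2 * \<delta>) * y)) * (exp (r * (1 + 2 * \<delta>) * y) * ?m)"
      by (intro mult_left_mono) auto
    also have "\<dots> = ?m"
      by (simp add: exp_minus)
    finally show ?case by simp
  qed
qed

text \<open>For order n + k and s = \<sigma> / y the two Chebyshev ratios tend to exp (a \<sigma>)
  and exp (b \<sigma>), where a, b < 0 depend on \<delta> alone. Since \<sigma> = \<rho> + k, a
  large k brings both below 1 / 4.\<close>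

lemma regvar_window_tail:
  assumes h: "regvar0 \<rho> (hmom n)" and \<rho>: "0 < \<rho>"
  shows "window_tail \<mu> r"
proof (rule window_tailI)
  fix \<delta> :: real assume \<delta>: "0 < \<delta>" "\<delta> < 1"
  \<comment> \<open>Small enough for 2 \<theta>^2 < \<theta> \<delta>, so that the quadratic error
    in ln (1 \<plusminus> \<theta>) leaves a and b negative.\<close>
  define \<theta> where "\<theta> = \<delta> / 4"
  have \<theta>: "0 < \<theta>" "\<theta> < 1/4" using \<delta> by (auto simp: \<theta>_def)
  define a b where "a = - (\<theta> * (1 + \<delta>)) - ln (1 - \<theta>)" and "b = \<theta> * (1 - \<delta>) - ln (1 + \<theta>)"
  have "2 * \<theta>\<^sup>2 = \<theta> * \<delta> / 2"
    by (simp add: \<theta>_def power2_eq_square)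
  moreover have "0 < \<theta> * \<delta>" using \<theta> \<delta> by simp
  ultimately have \<theta>\<delta>: "2 * \<theta>\<^sup>2 < \<theta> * \<delta>" "\<theta>\<^sup>2 < \<theta> * \<delta>"
    by auto
  have a: "a < 0"
    using ln_one_minus_pos_lower_bound[of \<theta>] \<theta> \<theta>\<delta> by (auto simp: a_def algebra_simps)
  have b: "b < 0"
    using ln_one_plus_pos_lower_bound[of \<theta>] \<theta> \<theta>\<delta> by (auto simp: b_def algebra_simps)
  obtain k :: nat where k: "ln 4 / (- a) < real k" "ln 4 / (- b) < real k"
    using reals_Archimedean2[of "max (ln 4 / (- a)) (ln 4 / (- b))"] by auto
  define \<sigma> where "\<sigma> = \<rho> + real k"
  have \<sigma>: "0 < \<sigma>" using \<rho> by (simp add: \<sigma>_def)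
  have small: "exp (c * \<sigma>) < 1 / 4" if "c < 0" "ln 4 / (- c) < real k" for c
  proof -
    have "ln 4 / (- c) < \<sigma>" using that(2) \<rho> by (simp add: \<sigma>_def)
    then have "c * \<sigma> < - ln 4" using that(1) by (simp add: field_simps)
    then have "exp (c * \<sigma>) < exp (- ln 4)" by (simp only: exp_less_cancel_iff)
    also have "exp (- ln 4) = 1 / (4::real)" by (simp add: exp_minus)
    finally show ?thesis .
  qed
  let ?N = "n + k"
  have reg: "regvar0 \<sigma> (hmom ?N)"
    unfolding \<sigma>_def by (rule hmom_regvar_add[OF h \<rho>])
  have lims: "((\<lambda>s. exp (- (\<theta> * (1 + \<delta>) * \<sigma>)) * (hmom ?N ((1 - \<theta>) * s) / hmom ?N s)) \<longlongrightarrow>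
      exp (- (\<theta> * (1 + \<delta>) * \<sigma>)) * (1 - \<theta>) powr (- \<sigma>)) (at_right 0)"
    "((\<lambda>s. exp (\<theta> * (1 - \<delta>) * \<sigma>) * (hmom ?N ((1 + \<theta>) * s) / hmom ?N s)) \<longlongrightarrow>
      exp (\<theta> * (1 - \<delta>) * \<sigma>) * (1 + \<theta>) powr (- \<sigma>)) (at_right 0)"
    by (intro tendsto_mult tendsto_const; use reg \<theta> in \<open>simp add: regvar0_def\<close>)+
  have eqs: "exp (- (\<theta> * (1 + \<delta>) * \<sigma>)) * (1 - \<theta>) powr (- \<sigma>) = exp (a * \<sigma>)"
    "exp (\<theta> * (1 - \<delta>) * \<sigma>) * (1 + \<theta>) powr (- \<sigma>) = exp (b * \<sigma>)"
  proof -
    have "(1 - \<theta>) powr (- \<sigma>) = exp (- \<sigma> * ln (1 - \<theta>))" "(1 + \<theta>) powr (- \<sigma>) = exp (- \<sigma> * ln (1 + \<theta>))"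
      using \<theta> by (auto simp: powr_def)
    moreover have "- (\<theta> * (1 + \<delta>) * \<sigma>) + (- \<sigma> * ln (1 - \<theta>)) = a * \<sigma>"
      "\<theta> * (1 - \<delta>) * \<sigma> + (- \<sigma> * ln (1 + \<theta>)) = b * \<sigma>"
      by (auto simp: a_def b_def algebra_simps)
    ultimately show "exp (- (\<theta> * (1 + \<delta>) * \<sigma>)) * (1 - \<theta>) powr (- \<sigma>) = exp (a * \<sigma>)"
      "exp (\<theta> * (1 - \<delta>) * \<sigma>) * (1 + \<theta>) powr (- \<sigma>) = exp (b * \<sigma>)"
      by (metis exp_add)+
  qed
  note lims' = order_tendstoD(2)[OF lims(1)[unfolded eqs] small[OF a k(1)]]
    order_tendstoD(2)[OF lims(2)[unfolded eqs] small[OF b k(2)]]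
  have hlim: "filterlim (hmom ?N) at_top (at_right 0)"
    using reg by (simp add: regvar0_def)
  then have h1: "\<forall>\<^sub>F s in at_right 0. 1 \<le> hmom ?N s" by (simp add: filterlim_at_top)
  have sr: "\<forall>\<^sub>F s in at_right 0. s \<in> {0<..<r/2}"
    using r_pos by (intro eventually_at_right_real) auto
  \<comment> \<open>The centre \<sigma> / s is the mean of the Gamma law of shape \<sigma> and rate
    s.\<close>
  have ev: "\<forall>\<^sub>F s in at_right 0. 1 \<le> 2 * ((1 + \<delta>) * (\<sigma> / s)) ^ ?N *
      exp (r * ((1 + \<delta>) * (\<sigma> / s))) * measure \<mu> {(1 - \<delta>) * (\<sigma> / s)..(1 + \<delta>) * (\<sigma> / s)}"
    using lims' h1 sr
  proof eventually_elim
    case (elim s)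
    have s: "0 < s" "(1 + \<theta>) * s < r"
    proof -
      have "0 < s" "s < r / 2" using elim(4) by auto
      moreover from this have "(1 + \<theta>) * s \<le> 2 * s" using \<theta> by (intro mult_right_mono) auto
      ultimately show "0 < s" "(1 + \<theta>) * s < r" by linarith+
    qed
    have "hmom ?N s \<le> 2 * ((1 + \<delta>) * (\<sigma> / s)) ^ ?N *
      exp (r * ((1 + \<delta>) * (\<sigma> / s))) * measure \<mu> {(1 - \<delta>) * (\<sigma> / s)..(1 + \<delta>) * (\<sigma> / s)}"
    proof (rule window_chernoff[OF \<theta>(1) _ s \<delta>])
      have "\<theta> * s * ((1 + \<delta>) * (\<sigma> / s)) = \<theta> * (1 + \<delta>) * \<sigma>" using s by simp
      then show "exp (- (\<theta> * s * ((1 + \<delta>) * (\<sigma> / s)))) * hmom ?N ((1 - \<theta>) * s) \<le> hmom ?N s / 4"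
        using elim(1,3) by (simp only:) (simp add: divide_less_eq)
      have "\<theta> * s * ((1 - \<delta>) * (\<sigma> / s)) = \<theta> * (1 - \<delta>) * \<sigma>" using s by simp
      then show "exp (\<theta> * s * ((1 - \<delta>) * (\<sigma> / s))) * hmom ?N ((1 + \<theta>) * s) \<le> hmom ?N s / 4"
        using elim(2,3) by (simp only:) (simp add: divide_less_eq)
    qed (use \<theta> \<sigma> s in auto)
    then show ?case using elim by linarith
  qed
  have "filterlim (\<lambda>y. \<sigma> * inverse y) (at_right 0) at_top"
    by (rule filterlim_compose[OF filterlim_mult_at_right_0[OF \<sigma>] filterlim_inverse_at_right_top])
  then have "\<forall>\<^sub>F y in at_top. 1 \<le> 2 * ((1 + \<delta>) * (\<sigma> / (\<sigma> * inverse y))) ^ ?N *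
      exp (r * ((1 + \<delta>) * (\<sigma> / (\<sigma> * inverse y)))) *
      measure \<mu> {(1 - \<delta>) * (\<sigma> / (\<sigma> * inverse y))..(1 + \<delta>) * (\<sigma> / (\<sigma> * inverse y))}"
    by (rule eventually_compose_filterlim[OF ev])
  moreover have "\<sigma> / (\<sigma> * inverse y) = y" for y
    using \<sigma> by (simp add: field_simps)
  ultimately show "\<exists>N. \<forall>\<^sub>F y in at_top. 1 \<le> 2 * ((1 + \<delta>) * y) ^ N *
    exp (r * ((1 + \<delta>) * y)) * measure \<mu> {(1 - \<delta>) * y..(1 + \<delta>) * y}"
    by (intro exI[of _ ?N]) simp
qed

lemma log_regvar_window_tail:
  assumes reg: "regvar0 \<rho> (\<lambda>s. ln (hmom 0 s))" and \<rho>: "0 < \<rho>"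
    and hlim: "filterlim (hmom 0) at_top (at_right 0)"
  shows "window_tail \<mu> r"
proof (rule window_tailI)
  fix \<delta> :: real assume \<delta>: "0 < \<delta>" "\<delta> < 1"
  define k where "k s = ln (hmom 0 s)" for s
  have klim: "filterlim k at_top (at_right 0)"
    and krat: "\<And>c. 0 < c \<Longrightarrow> ((\<lambda>s. k (c * s) / k s) \<longlongrightarrow> c powr (- \<rho>)) (at_right 0)"
    using reg by (auto simp: regvar0_def k_def[abs_def])
  have f1: "filterlim (\<lambda>\<theta>::real. 1 - \<theta>) (at 1) (at_right 0)" "filterlim (\<lambda>\<theta>::real. 1 + \<theta>) (at 1) (at_right 0)"
    by (auto intro!: filterlim_atI tendsto_eq_intros simp: eventually_at_filter)
  \<comment> \<open>To first order (1 \<minusplus> \<theta>) powr (- \<rho>) is 1 \<plusminus>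
    \<theta> \<rho>; the slack \<theta> \<rho> \<delta> beats the higher-order error for small
    \<theta>.\<close>
  have "\<forall>\<^sub>F \<theta> in at_right 0. (1 - (1 - \<theta>) powr (-\<rho>)) / ((1 - \<theta>) - 1) < \<rho> * (1 + \<delta>)"
    using \<rho> \<delta> by (intro order_tendstoD(2)[OF filterlim_compose[OF powr_difference_quotient f1(1)]]) (simp add: algebra_simps)
  moreover have "\<forall>\<^sub>F \<theta> in at_right 0. \<rho> * (1 - \<delta>) < (1 - (1 + \<theta>) powr (-\<rho>)) / ((1 + \<theta>) - 1)"
    using \<rho> \<delta> by (intro order_tendstoD(1)[OF filterlim_compose[OF powr_difference_quotient f1(2)]]) (simp add: algebra_simps)
  moreover have "\<forall>\<^sub>F \<theta> in at_right 0. \<theta> \<in> {0<..<1::real}"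
    by (rule eventually_at_right_real) simp
  ultimately have "\<forall>\<^sub>F \<theta> in at_right 0. 0 < \<theta> \<and> \<theta> < 1 \<and>
      (1 - \<theta>) powr (-\<rho>) - \<theta> * \<rho> * (1 + \<delta>) < 1 \<and> (1 + \<theta>) powr (-\<rho>) + \<theta> * \<rho> * (1 - \<delta>) < 1"
  proof eventually_elim
    case (elim \<theta>)
    then have "0 < \<theta>" "\<theta> < 1" by auto
    moreover have "((1 - \<theta>) powr (-\<rho>) - 1) / \<theta> < \<rho> * (1 + \<delta>)"
      using elim(1) by (simp add: minus_divide_left)
    moreover have "\<rho> * (1 - \<delta>) < (1 - (1 + \<theta>) powr (-\<rho>)) / \<theta>"
      using elim(2) by simp
    ultimately show ?case by (simp add: divide_less_eq less_divide_eq mult_ac)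
  qed
  then obtain \<theta> where \<theta>: "0 < \<theta>" "\<theta> < 1"
    and up: "(1 - \<theta>) powr (-\<rho>) - \<theta> * \<rho> * (1 + \<delta>) < 1"
    and low: "(1 + \<theta>) powr (-\<rho>) + \<theta> * \<rho> * (1 - \<delta>) < 1"
    using eventually_happens'[OF trivial_limit_at_right_real] by blast
  \<comment> \<open>The exponent k(c s) + q k(s) is eventually at most a k(s) with a < 1, and (1 -
    a) k(s) \<ge> ln 4 then supplies the factor 1 / 4.\<close>
  have key: "\<forall>\<^sub>F s in at_right 0. exp (q * k s) * hmom 0 (c * s) \<le> hmom 0 s / 4"
    if c: "0 < c" and q: "c powr (- \<rho>) + q < 1" for c q
  proof -
    obtain a where a: "c powr (- \<rho>) + q < a" "a < 1" using dense[OF q] by blast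
    have "((\<lambda>s. k (c * s) / k s + q) \<longlongrightarrow> c powr (- \<rho>) + q) (at_right 0)"
      by (intro tendsto_intros krat c)
    then have "\<forall>\<^sub>F s in at_right 0. k (c * s) / k s + q < a"
      using a(1) by (rule order_tendstoD)
    moreover have "\<forall>\<^sub>F s in at_right 0. max 1 (ln 4 / (1 - a)) \<le> k s"
      using klim unfolding filterlim_at_top by blast
    moreover have h1: "\<forall>\<^sub>F s in at_right 0. 1 \<le> hmom 0 s"
      using hlim by (simp add: filterlim_at_top)
    moreover have "\<forall>\<^sub>F s in at_right 0. 1 \<le> hmom 0 (c * s)"
      by (rule eventually_compose_filterlim[OF h1 filterlim_mult_at_right_0[OF c]])
    ultimately show ?thesis
    proof eventually_elim
      case (elim s)
      have "k (c * s) + q * k s = (k (c * s) / k s + q) * k s"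
        using elim by (simp add: field_simps)
      also have "\<dots> \<le> a * k s"
        using elim by (intro mult_right_mono) auto
      also have "\<dots> \<le> k s - ln 4"
        using elim a by (simp add: field_simps)
      finally have "exp (k (c * s) + q * k s) \<le> exp (k s - ln 4)" by simp
      then show ?case
        using elim by (simp add: exp_add exp_diff k_def mult_ac)
    qed
  qed
  define P where "P y \<longleftrightarrow> 1 \<le> 2 * ((1 + \<delta>) * y) ^ 0 *
    exp (r * ((1 + \<delta>) * y)) * measure \<mu> {(1 - \<delta>) * y..(1 + \<delta>) * y}" for y
  have ku: "\<forall>\<^sub>F s in at_right 0. exp (- (\<theta> * \<rho> * (1 + \<delta>)) * k s) * hmom 0 ((1 - \<theta>) * s) \<le> hmom 0 s / 4"
    using \<theta> up by (intro key) auto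
  have kl: "\<forall>\<^sub>F s in at_right 0. exp (\<theta> * \<rho> * (1 - \<delta>) * k s) * hmom 0 ((1 + \<theta>) * s) \<le> hmom 0 s / 4"
    using \<theta> low by (intro key) auto
  have sr: "\<forall>\<^sub>F s in at_right 0. s \<in> {0<..<r/2}"
    using r_pos by (intro eventually_at_right_real) auto
  have h1: "\<forall>\<^sub>F s in at_right 0. 2 \<le> hmom 0 s"
    using hlim by (simp add: filterlim_at_top)
  have "\<forall>\<^sub>F s in at_right 0. P (\<rho> * k s / s) \<and> 2 \<le> hmom 0 s \<and> s < r"
    using ku kl sr h1
  proof eventually_elim
    case (elim s)
    have s: "0 < s" "(1 + \<theta>) * s < r"
    proof -
      have "0 < s" "s < r / 2" using elim(3) by auto
      moreover from this have "(1 + \<theta>) * s \<le> 2 * s" using \<theta> by (intro mult_right_mono) auto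
      ultimately show "0 < s" "(1 + \<theta>) * s < r" by linarith+
    qed
    have k: "0 < k s" using elim(4) by (simp add: k_def)
    have "hmom 0 s \<le> 2 * ((1 + \<delta>) * (\<rho> * k s / s)) ^ 0 * exp (r * ((1 + \<delta>) * (\<rho> * k s / s))) *
      measure \<mu> {(1 - \<delta>) * (\<rho> * k s / s)..(1 + \<delta>) * (\<rho> * k s / s)}"
    proof (rule window_chernoff[OF \<theta> s \<delta>])
      have "- (\<theta> * s * ((1 + \<delta>) * (\<rho> * k s / s))) = - (\<theta> * \<rho> * (1 + \<delta>)) * k s" using s by simp
      then show "exp (- (\<theta> * s * ((1 + \<delta>) * (\<rho> * k s / s)))) * hmom 0 ((1 - \<theta>) * s) \<le> hmom 0 s / 4"
        using elim(1) by (simp only:)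
      have "\<theta> * s * ((1 - \<delta>) * (\<rho> * k s / s)) = \<theta> * \<rho> * (1 - \<delta>) * k s" using s by simp
      then show "exp (\<theta> * s * ((1 - \<delta>) * (\<rho> * k s / s))) * hmom 0 ((1 + \<theta>) * s) \<le> hmom 0 s / 4"
        using elim(2) by (simp only:)
    qed (use \<rho> k s in auto)
    moreover have "s < r" using elim(3) r_pos by auto
    ultimately show ?case using elim(4) unfolding P_def by linarith
  qed
  then obtain s1 where s1: "0 < s1" and *: "\<And>s. 0 < s \<Longrightarrow> s < s1 \<Longrightarrow> P (\<rho> * k s / s) \<and> 2 \<le> hmom 0 s \<and> s < r"
    by (auto simp: eventually_at_right_field)
  define \<phi> where "\<phi> s = \<rho> * k s / s" for s
  have "filterlim (\<lambda>s. (\<rho> * k s) * inverse s) at_top (at_right 0)"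
    by (intro filterlim_at_top_mult_at_top filterlim_tendsto_pos_mult_at_top[OF tendsto_const \<rho>] klim
        filterlim_inverse_at_top_right)
  then have \<phi>lim: "filterlim \<phi> at_top (at_right 0)"
    by (simp add: \<phi>_def[abs_def] field_simps)
  \<comment> \<open>The centre \<phi>(s) has no explicit inverse; continuity together with
    divergence at 0 lets the intermediate value theorem reach every large y.\<close>
  have cont: "continuous_on {0<..<s1} \<phi>"
  proof (rule continuous_at_imp_continuous_on, intro ballI)
    fix s assume s: "s \<in> {0<..<s1}"
    have "isCont (mom {0<..} 0) (r - s)"
      using * s by (intro DERIV_isCont[OF mom_has_derivative]) auto
    then have "isCont (\<lambda>s. mom {0<..} 0 (r - s)) s"
      by (rule isCont_o2[where f = "\<lambda>s. r - s", rotated]) (auto intro!: continuous_intros)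
    then have "isCont (hmom 0) s" by (simp add: hmom_def[abs_def])
    moreover have "0 < hmom 0 s" using *[of s] s by auto
    ultimately show "isCont \<phi> s"
      unfolding \<phi>_def k_def using s by (intro continuous_intros) auto
  qed
  have "P y" if y: "\<phi> (s1 / 2) \<le> y" for y
  proof -
    have "\<forall>\<^sub>F s in at_right 0. y \<le> \<phi> s"
      using \<phi>lim by (simp add: filterlim_at_top)
    moreover have "\<forall>\<^sub>F s in at_right 0. s \<in> {0<..<s1/2}"
      using s1 by (intro eventually_at_right_real) auto
    ultimately have "\<forall>\<^sub>F s in at_right 0. y \<le> \<phi> s \<and> s \<in> {0<..<s1/2}"
      by eventually_elim auto
    then have "\<exists>s. y \<le> \<phi> s \<and> s \<in> {0<..<s1/2}"
      by (rule eventually_happens'[OF trivial_limit_at_right_real])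
    then obtain s2 where s2: "y \<le> \<phi> s2" "0 < s2" "s2 < s1 / 2"
      by auto
    have "continuous_on {s2..s1/2} \<phi>"
      using s2 s1 by (intro continuous_on_subset[OF cont]) auto
    then obtain s where "s2 \<le> s" "s \<le> s1 / 2" "\<phi> s = y"
      using IVT2'[of \<phi> "s1/2" y s2] y s2 by auto
    then show "P y"
      using *[of s] s2 s1 by (auto simp: \<phi>_def)
  qed
  then have "\<forall>\<^sub>F y in at_top. P y"
    by (auto intro: eventually_at_top_linorderI)
  then show "\<exists>N. \<forall>\<^sub>F y in at_top. 1 \<le> 2 * ((1 + \<delta>) * y) ^ N *
    exp (r * ((1 + \<delta>) * y)) * measure \<mu> {(1 - \<delta>) * y..(1 + \<delta>) * y}"
    unfolding P_def by blast
qed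

end

section \<open>Passing to a convolution square root\<close>

lemma integrable_product:
  fixes f g :: "real \<Rightarrow> real"
  assumes "pair_sigma_finite M N" and f: "integrable M f" and g: "integrable N g"
  shows "integrable (M \<Otimes>\<^sub>M N) (\<lambda>(x, y). f x * g y)"
    and "(\<integral>(x, y). f x * g y \<partial>(M \<Otimes>\<^sub>M N)) = (\<integral>x. f x \<partial>M) * (\<integral>y. g y \<partial>N)"
proof -
  interpret pair_sigma_finite M N by fact
  note [measurable] = borel_measurable_integrable[OF f] borel_measurable_integrable[OF g]
  show *: "integrable (M \<Otimes>\<^sub>M N) (\<lambda>(x, y). f x * g y)"
  proof (rule Fubini_integrable)
    show "integrable M (\<lambda>x. \<integral>y. norm ((\<lambda>(x, y). f x * g y) (x, y)) \<partial>N)"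
      using f by (simp add: abs_mult)
    show "AE x in M. integrable N (\<lambda>y. (\<lambda>(x, y). f x * g y) (x, y))"
      using g by simp
  qed measurable
  show "(\<integral>(x, y). f x * g y \<partial>(M \<Otimes>\<^sub>M N)) = (\<integral>x. f x \<partial>M) * (\<integral>y. g y \<partial>N)"
    using integral_fst'[OF *] by simp
qed

lemma filterlim_root_at_top:
  assumes "0 < N"
  shows "filterlim (root N) at_top at_top"
  unfolding filterlim_at_top
proof
  fix Z :: real
  have "Z \<le> root N y" if "max Z 0 ^ N \<le> y" for y
  proof -
    have "max Z 0 = root N (max Z 0 ^ N)" using assms by (simp add: real_root_power_cancel)
    also have "\<dots> \<le> root N y" using that assms by simp
    finally show ?thesis by simp
  qed
  then show "\<forall>\<^sub>F y in at_top. Z \<le> root N y"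
    by (rule eventually_at_top_linorderI)
qed

context exp_moments
begin

text \<open>Leibniz' rule for the square of the generating function, obtained from the binomial
  theorem and Fubini.\<close>

lemma mom_convolution:
  assumes v: "0 < v" "v < r" and S: "exp_moments (\<mu> \<star> \<mu>) r"
  shows "exp_moments.mom (\<mu> \<star> \<mu>) UNIV N v = (\<Sum>i\<le>N. real (N choose i) * (mom UNIV i v * mom UNIV (N - i) v))"
proof -
  interpret S: exp_moments "\<mu> \<star> \<mu>" r by (rule S)
  interpret P: pair_sigma_finite \<mu> \<mu> ..
  let ?f = "\<lambda>i x. x ^ i * exp (v * x) :: real"
  have int: "integrable \<mu> (?f i)" for i
    using integrable_moment[OF v, of UNIV i] by simp
  have "S.mom UNIV N v = (\<integral>z. ?f N z \<partial>(\<mu> \<star> \<mu>))"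
    by (simp add: S.mom_def)
  also have "\<dots> = (\<integral>(x, y). ?f N (x + y) \<partial>(\<mu> \<Otimes>\<^sub>M \<mu>))"
    unfolding convolution_def by (subst integral_distr) (auto simp: case_prod_unfold)
  also have "(\<lambda>(x, y). ?f N (x + y)) = (\<lambda>z. \<Sum>i\<le>N. real (N choose i) * (\<lambda>(x, y). ?f i x * ?f (N - i) y) z)"
  proof (intro ext)
    fix z :: "real \<times> real"
    obtain x y where z: "z = (x, y)" by (cases z)
    show "(case z of (x, y) \<Rightarrow> ?f N (x + y)) = (\<Sum>i\<le>N. real (N choose i) * (\<lambda>(x, y). ?f i x * ?f (N - i) y) z)"
      by (simp add: z binomial_ring sum_distrib_left sum_distrib_right distrib_left exp_add mult_ac)
  qed
  also have "(\<integral>z. (\<Sum>i\<le>N. real (N choose i) * (\<lambda>(x, y). ?f i x * ?f (N - i) y) z) \<partial>(\<mu> \<Otimes>\<^sub>M \<mu>)) =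
      (\<Sum>i\<le>N. real (N choose i) * (\<integral>z. (\<lambda>(x, y). ?f i x * ?f (N - i) y) z \<partial>(\<mu> \<Otimes>\<^sub>M \<mu>)))"
    using integrable_product(1)[OF P.pair_sigma_finite_axioms int int]
    by (subst Bochner_Integration.integral_sum) auto
  also have "\<dots> = (\<Sum>i\<le>N. real (N choose i) * (mom UNIV i v * mom UNIV (N - i) v))"
    using integrable_product(2)[OF P.pair_sigma_finite_axioms int int]
    by (simp add: mom_def)
  finally show ?thesis .
qed

lemma mom_0_tendsto:
  assumes int: "integrable \<mu> (\<lambda>x. exp (r * x))"
  shows "((\<lambda>s. mom UNIV 0 (r - s)) \<longlongrightarrow> (\<integral>x. exp (r * x) \<partial>\<mu>)) (at_right 0)"
proof (rule tendsto_at_right_sequentially[OF r_pos])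
  fix S assume S: "\<And>n::nat. 0 < S n" "\<And>n. S n < r" "S \<longlonglongrightarrow> 0"
  have "(\<lambda>n. \<integral>x. exp ((r - S n) * x) \<partial>\<mu>) \<longlonglongrightarrow> (\<integral>x. exp (r * x) \<partial>\<mu>)"
  proof (rule integral_dominated_convergence[where w = "\<lambda>x. 1 + exp (r * x)"])
    show "integrable \<mu> (\<lambda>x. 1 + exp (r * x))" using int by simp
    show "AE x in \<mu>. (\<lambda>n. exp ((r - S n) * x)) \<longlonglongrightarrow> exp (r * x)"
    proof (rule AE_I2)
      fix x
      have "(\<lambda>n. exp ((r - S n) * x)) \<longlonglongrightarrow> exp ((r - 0) * x)"
        by (intro tendsto_intros S)
      then show "(\<lambda>n. exp ((r - S n) * x)) \<longlonglongrightarrow> exp (r * x)" by simp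
    qed
    fix n
    show "AE x in \<mu>. norm (exp ((r - S n) * x)) \<le> 1 + exp (r * x)"
    proof (rule AE_I2)
      fix x
      show "norm (exp ((r - S n) * x)) \<le> 1 + exp (r * x)"
      proof (cases "0 \<le> x")
        case True
        then have "(r - S n) * x \<le> r * x" using S(1)[of n] by (intro mult_right_mono) auto
        then have "exp ((r - S n) * x) \<le> exp (r * x)" by simp
        moreover have "norm (exp ((r - S n) * x)) = exp ((r - S n) * x)" by simp
        ultimately show ?thesis by linarith
      next
        case False
        then have "exp ((r - S n) * x) \<le> 1"
          using S(2)[of n] by (simp add: mult_nonneg_nonpos)
        then show ?thesis by (simp add: add_increasing2)
      qed
    qed
  qed measurable
  then show "(\<lambda>n. mom UNIV 0 (r - S n)) \<longlonglongrightarrow> (\<integral>x. exp (r * x) \<partial>\<mu>)"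
    by (simp add: mom_def)
qed

section \<open>Moments of different orders when exp (r x) is integrable\<close>

text \<open>Three ranges of x: up to A the power is at most A ^ i; between A and Q it is at most Q ^
  i, against a small tail of exp (r x); beyond Q, x ^ i is at most x ^ N / Q ^ (N - i).\<close>

lemma hmom_mixed_bound:
  assumes int: "integrable \<mu> (\<lambda>x. exp (r * x))" and s: "0 < s" "s < r" and A: "0 \<le> A" and Q: "0 < Q" and i: "i \<le> N"
  shows "hmom i s \<le> A ^ i * (\<integral>x. exp (r * x) \<partial>\<mu>) + Q ^ i * (\<integral>x. indicator {A<..} x * exp (r * x) \<partial>\<mu>)
    + hmom N s / Q ^ (N - i)"
proof -
  have v: "0 < r - s" "r - s < r" using s by auto
  let ?f = "\<lambda>i x. indicator {0<..} x * (x ^ i * exp ((r - s) * x)) :: real"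
  have if': "integrable \<mu> (?f j)" for j by (intro integrable_moment v) auto
  have it: "integrable \<mu> (\<lambda>x. indicator {A<..} x * exp (r * x))"
    by (rule Bochner_Integration.integrable_bound[OF int]) (auto simp: indicator_def)
  have "hmom i s = (\<integral>x. ?f i x \<partial>\<mu>)" by (simp add: hmom_def mom_def)
  also have "\<dots> \<le> (\<integral>x. A ^ i * exp (r * x) + Q ^ i * (indicator {A<..} x * exp (r * x)) + inverse (Q ^ (N - i)) * ?f N x \<partial>\<mu>)"
  proof (rule integral_mono[OF if'])
    show "integrable \<mu> (\<lambda>x. A ^ i * exp (r * x) + Q ^ i * (indicator {A<..} x * exp (r * x)) + inverse (Q ^ (N - i)) * ?f N x)"
      by (intro Bochner_Integration.integrable_add integrable_mult_right int it if')
    fix x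
    have nn: "0 \<le> A ^ i * exp (r * x)" "0 \<le> Q ^ i * (indicator {A<..} x * exp (r * x))" "0 \<le> inverse (Q ^ (N - i)) * ?f N x"
      using A Q by (auto simp: indicator_def)
    show "?f i x \<le> A ^ i * exp (r * x) + Q ^ i * (indicator {A<..} x * exp (r * x)) + inverse (Q ^ (N - i)) * ?f N x"
    proof (cases "0 < x")
      case True
      have e: "exp ((r - s) * x) \<le> exp (r * x)" using True s by simp
      consider "x \<le> A" | "A < x" "x \<le> Q" | "Q < x" by linarith
      then show ?thesis
      proof cases
        case 1
        then have "x ^ i * exp ((r - s) * x) \<le> A ^ i * exp (r * x)"
          using True e A by (intro mult_mono power_mono) auto
        then have "?f i x \<le> A ^ i * exp (r * x)" using True by simp
        then show ?thesis using nn by linarith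
      next
        case 2
        then have "x ^ i * exp ((r - s) * x) \<le> Q ^ i * exp (r * x)"
          using True e Q by (intro mult_mono power_mono) auto
        then have "?f i x \<le> Q ^ i * (indicator {A<..} x * exp (r * x))" using True 2 by simp
        then show ?thesis using nn by linarith
      next
        case 3
        have "x ^ i * Q ^ (N - i) \<le> x ^ i * x ^ (N - i)"
          using True 3 Q by (intro mult_left_mono power_mono) auto
        also have "\<dots> = x ^ N" using i by (simp flip: power_add)
        finally have "x ^ i \<le> inverse (Q ^ (N - i)) * x ^ N"
          using Q by (simp add: field_simps)
        then have "x ^ i * exp ((r - s) * x) \<le> (inverse (Q ^ (N - i)) * x ^ N) * exp ((r - s) * x)"
          by (intro mult_right_mono) auto
        then have "?f i x \<le> inverse (Q ^ (N - i)) * ?f N x" using True by simp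
        then show ?thesis using nn by linarith
      qed
    next
      case False
      then have "?f i x = 0" by simp
      then show ?thesis using nn by linarith
    qed
  qed
  also have "\<dots> = A ^ i * (\<integral>x. exp (r * x) \<partial>\<mu>) + Q ^ i * (\<integral>x. indicator {A<..} x * exp (r * x) \<partial>\<mu>)
    + inverse (Q ^ (N - i)) * hmom N s"
    unfolding hmom_def mom_def
    by (intro has_bochner_integral_integral_eq has_bochner_integral_add has_bochner_integral_mult_right
        has_bochner_integral_integrable int it if')
  finally show ?thesis by (simp add: divide_inverse mult.commute)
qed

lemma tail_tendsto_0:
  assumes int: "integrable \<mu> (\<lambda>x. exp (r * x))"
  shows "(\<lambda>k. \<integral>x. indicator {real k<..} x * exp (r * x) \<partial>\<mu>) \<longlonglongrightarrow> 0"
proof -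
  have "(\<lambda>k. \<integral>x. indicator {real k<..} x * exp (r * x) \<partial>\<mu>) \<longlonglongrightarrow> (\<integral>x. 0 \<partial>\<mu>)"
  proof (rule integral_dominated_convergence[OF _ _ int])
    show "AE x in \<mu>. (\<lambda>k. indicator {real k<..} x * exp (r * x)) \<longlonglongrightarrow> 0"
    proof (rule AE_I2)
      fix x :: real
      obtain m :: nat where "x < real m" using reals_Archimedean2 by blast
      then have "\<forall>\<^sub>F k in sequentially. indicator {real k<..} x * exp (r * x) = 0"
        by (intro eventually_sequentiallyI[of m]) (auto simp: indicator_def)
      then show "(\<lambda>k. indicator {real k<..} x * exp (r * x)) \<longlonglongrightarrow> 0"
        by (rule tendsto_eventually)
    qed
    show "AE x in \<mu>. norm (indicator {real k<..} x * exp (r * x)) \<le> exp (r * x)" for k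
      by (auto simp: indicator_def)
  qed measurable
  then show ?thesis by simp
qed

text \<open>Lyapunov's inequality alone gives boundedness of this ratio; it vanishes in the limit because
  \<open>exp (r * x)\<close> is integrable.\<close>

lemma hmom_lower_order:
  assumes int: "integrable \<mu> (\<lambda>x. exp (r * x))" and hlim: "filterlim (hmom N) at_top (at_right 0)"
    and i: "0 < i" "i < N"
  shows "((\<lambda>s. hmom i s / root N (hmom N s) ^ i) \<longlongrightarrow> 0) (at_right 0)"
proof (rule tendstoI)
  fix e :: real assume e: "0 < e"
  define R where "R s = root N (hmom N s)" for s
  have N: "0 < N" using i by simp
  have Rlim: "filterlim R at_top (at_right 0)"
    unfolding R_def
    by (rule filterlim_compose[OF filterlim_root_at_top[OF N] hlim])
  \<comment> \<open>The threshold Q is B R(s), where R(s) is the N-th root of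
    \<open>hmom N s\<close>. After division by R(s) ^ i, B controls the part beyond Q, then the
    lower threshold k controls the middle part for this B, and finally small s removes the
    rest.\<close>
  define B where "B = max 1 (6 / e)"
  have B: "1 \<le> B" "6 / e \<le> B" by (auto simp: B_def)
  have "(\<lambda>k. B ^ i * (\<integral>x. indicator {real k<..} x * exp (r * x) \<partial>\<mu>)) \<longlonglongrightarrow> B ^ i * 0"
    by (intro tendsto_intros tail_tendsto_0 int)
  then have "\<forall>\<^sub>F k in sequentially. B ^ i * (\<integral>x. indicator {real k<..} x * exp (r * x) \<partial>\<mu>) < e / 3"
    using e by (intro order_tendstoD(2)) auto
  then obtain k :: nat where k: "B ^ i * (\<integral>x. indicator {real k<..} x * exp (r * x) \<partial>\<mu>) < e / 3"
    using eventually_happens'[OF sequentially_bot] by blast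
  define H where "H = real k ^ i * (\<integral>x. exp (r * x) \<partial>\<mu>)"
  have "((\<lambda>s. H / R s ^ i) \<longlongrightarrow> 0) (at_right 0)"
    by (intro real_tendsto_divide_at_top[OF tendsto_const] filterlim_pow_at_top i Rlim)
  then have "\<forall>\<^sub>F s in at_right 0. H / R s ^ i < e / 3"
    using e by (intro order_tendstoD(2)) auto
  moreover have "\<forall>\<^sub>F s in at_right 0. 1 \<le> R s"
    using Rlim by (simp add: filterlim_at_top)
  moreover have "\<forall>\<^sub>F s in at_right 0. s \<in> {0<..<r}"
    using r_pos by (rule eventually_at_right_real)
  ultimately have "\<forall>\<^sub>F s in at_right 0. dist (hmom i s / R s ^ i) 0 < e"
  proof eventually_elim
    case (elim s)
    have R: "0 < R s" "0 < R s ^ i" using elim by auto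
    have RN: "hmom N s = R s ^ (N - i) * R s ^ i"
      unfolding R_def using N i hmom_nonneg by (simp flip: power_add)
    have "hmom i s \<le> H + (R s * B) ^ i * (\<integral>x. indicator {real k<..} x * exp (r * x) \<partial>\<mu>) + hmom N s / (R s * B) ^ (N - i)"
      unfolding H_def using elim R B i by (intro hmom_mixed_bound int) auto
    also have "hmom N s / (R s * B) ^ (N - i) = R s ^ i / B ^ (N - i)"
      using R by (simp add: RN power_mult_distrib)
    finally have "hmom i s / R s ^ i \<le> (H + (R s * B) ^ i * (\<integral>x. indicator {real k<..} x * exp (r * x) \<partial>\<mu>) + R s ^ i / B ^ (N - i)) / R s ^ i"
      using R by (intro divide_right_mono) auto
    also have "\<dots> = H / R s ^ i + B ^ i * (\<integral>x. indicator {real k<..} x * exp (r * x) \<partial>\<mu>) + 1 / B ^ (N - i)"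
      using R by (simp add: add_divide_distrib power_mult_distrib)
    also have "1 / B ^ (N - i) \<le> 1 / B"
      using B i self_le_power[of B "N - i"] by (intro divide_left_mono) auto
    also have "1 / B \<le> 1 / (6 / e)"
      using B e by (intro divide_left_mono) auto
    also have "1 / (6 / e) < e / 3" using e by simp
    finally have "hmom i s / R s ^ i < e" using elim(1) k by linarith
    then show ?case using hmom_nonneg[of i s] R by (simp add: abs_of_nonneg)
  qed
  then show "\<forall>\<^sub>F s in at_right 0. dist (hmom i s / root N (hmom N s) ^ i) 0 < e"
    by (simp add: R_def)
qed

lemma mom_lower_order:
  assumes int: "integrable \<mu> (\<lambda>x. exp (r * x))" and hlim: "filterlim (hmom N) at_top (at_right 0)"
    and i: "0 < i" "i < N"
  shows "((\<lambda>s. mom UNIV i (r - s) / root N (hmom N s) ^ i) \<longlongrightarrow> 0) (at_right 0)"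
proof -
  obtain C where C: "\<And>s. 0 < s \<Longrightarrow> s \<le> r / 2 \<Longrightarrow> \<bar>mom UNIV i (r - s) - hmom i s\<bar> \<le> C"
    using mom_bounded_diff[of i] by blast
  have N: "0 < N" using i by simp
  have Rlim: "filterlim (\<lambda>s. root N (hmom N s)) at_top (at_right 0)"
    by (rule filterlim_compose[OF filterlim_root_at_top[OF N] hlim])
  have "((\<lambda>s. hmom i s / root N (hmom N s) ^ i + C / root N (hmom N s) ^ i) \<longlongrightarrow> 0 + 0) (at_right 0)"
    by (intro tendsto_add hmom_lower_order assms real_tendsto_divide_at_top[OF tendsto_const] filterlim_pow_at_top Rlim)
  then have lim: "((\<lambda>s. hmom i s / root N (hmom N s) ^ i + C / root N (hmom N s) ^ i) \<longlongrightarrow> 0) (at_right 0)"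
    by simp
  have "\<forall>\<^sub>F s in at_right 0. s \<in> {0<..<r/2}"
    using r_pos by (intro eventually_at_right_real) auto
  moreover have "\<forall>\<^sub>F s in at_right 0. 0 < root N (hmom N s)"
    using Rlim by (simp add: filterlim_at_top_dense)
  ultimately have "\<forall>\<^sub>F s in at_right 0. norm (mom UNIV i (r - s) / root N (hmom N s) ^ i)
      \<le> hmom i s / root N (hmom N s) ^ i + C / root N (hmom N s) ^ i"
  proof eventually_elim
    case (elim s)
    have "\<bar>mom UNIV i (r - s)\<bar> \<le> hmom i s + C"
      using C[of s] elim hmom_nonneg[of i s] by auto
    then have "\<bar>mom UNIV i (r - s)\<bar> / root N (hmom N s) ^ i \<le> (hmom i s + C) / root N (hmom N s) ^ i"
      using elim by (intro divide_right_mono) auto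
    then show ?case using elim by (simp add: add_divide_distrib abs_of_pos)
  qed
  then show ?thesis
    using lim by (rule Lim_null_comparison)
qed

text \<open>In the binomial expansion the end terms i = 0 and i = N, distinct because 0 < N, each
  contribute about L \<open>hmom N s\<close> with L the integral of exp (r x). The mixed terms are
  of smaller order by \<open>mom_lower_order\<close>. Hence the moment of the square is asymptotic
  to 2 L \<open>hmom N s\<close>, and the index is inherited.\<close>

lemma convolution_square_regvar:
  assumes S: "exp_moments (\<mu> \<star> \<mu>) r" and int: "integrable \<mu> (\<lambda>x. exp (r * x))"
    and N: "0 < N" and reg: "regvar0 \<rho> (exp_moments.hmom (\<mu> \<star> \<mu>) r N)"
  shows "regvar0 \<rho> (hmom N)"
proof -
  interpret S: exp_moments "\<mu> \<star> \<mu>" r by (rule S)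
  have Slim: "filterlim (S.hmom N) at_top (at_right 0)"
    using reg by (simp add: regvar0_def)
  obtain CS where CS: "\<And>s. 0 < s \<Longrightarrow> s \<le> r / 2 \<Longrightarrow> \<bar>S.mom UNIV N (r - s) - S.hmom N s\<bar> \<le> CS"
    using S.mom_bounded_diff[of N] by blast
  have sr: "\<forall>\<^sub>F s in at_right 0. s \<in> {0<..<r/2}"
    using r_pos by (intro eventually_at_right_real) auto
  have "\<forall>\<^sub>F s in at_right 0. \<bar>S.mom UNIV N (r - s) - S.hmom N s\<bar> \<le> CS"
    using sr by eventually_elim (use CS in auto)
  then have Sequiv: "(\<lambda>s. S.mom UNIV N (r - s)) \<sim>[at_right 0] S.hmom N"
    by (rule asymp_equiv_bounded_diff[OF Slim])
  have Smlim: "filterlim (\<lambda>s. S.mom UNIV N (r - s)) at_top (at_right 0)"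
    using asymp_equiv_at_top_transfer[OF asymp_equiv_symI[OF Sequiv] Slim] .
  have Smom: "S.mom UNIV N (r - s) = (\<Sum>i\<le>N. real (N choose i) * (mom UNIV i (r - s) * mom UNIV (N - i) (r - s)))"
    if "0 < s" "s < r" for s
    using that by (intro mom_convolution S) auto
  have "\<exists>C. \<forall>i. \<forall>s. 0 < s \<longrightarrow> s \<le> r / 2 \<longrightarrow> \<bar>mom UNIV i (r - s) - hmom i s\<bar> \<le> C i"
  proof (rule choice, rule allI)
    fix i
    obtain C where "\<And>s. 0 < s \<Longrightarrow> s \<le> r / 2 \<Longrightarrow> \<bar>mom UNIV i (r - s) - hmom i s\<bar> \<le> C"
      using mom_bounded_diff[of i] by blast
    then show "\<exists>C. \<forall>s. 0 < s \<longrightarrow> s \<le> r / 2 \<longrightarrow> \<bar>mom UNIV i (r - s) - hmom i s\<bar> \<le> C"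
      by (intro exI[of _ C]) simp
  qed
  then obtain C where C: "\<And>i s. 0 < s \<Longrightarrow> s \<le> r / 2 \<Longrightarrow> \<bar>mom UNIV i (r - s) - hmom i s\<bar> \<le> C i"
    by blast
  define L where "L = (\<integral>x. exp (r * x) \<partial>\<mu>)"
  have "L \<noteq> 0"
  proof
    assume "L = 0"
    then have "AE x in \<mu>. exp (r * x) = 0"
      unfolding L_def using integral_nonneg_eq_0_iff_AE[OF int] by simp
    then show False by simp
  qed
  moreover have "0 \<le> L" unfolding L_def by (rule integral_nonneg_AE) simp
  ultimately have L: "0 < L" by linarith
  \<comment> \<open>If the N-th moment of the factor stayed bounded, so would all lower ones, and
    then every term of the expansion, against the divergence for the square.\<close>
  have hlim: "filterlim (hmom N) at_top (at_right 0)"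
  proof (rule antimono_filterlim_at_top[OF r_pos hmom_antimono])
    fix D
    show "\<exists>s>0. s < r \<and> D \<le> hmom N s"
    proof (rule ccontr)
      assume no: "\<not> (\<exists>s>0. s < r \<and> D \<le> hmom N s)"
      \<comment> \<open>A sum over i of nonnegative terms, so that one constant bounds the moments
        of all orders up to N.\<close>
      define K where "K = (\<Sum>i\<le>N. L + \<bar>D\<bar> + C i)"
      have bd: "\<bar>mom UNIV i (r - s)\<bar> \<le> K" if "s \<in> {0<..<r/2}" "i \<le> N" for i s
      proof -
        have s: "0 < s" "s < r" "s \<le> r / 2" using that r_pos by auto
        have Cnn: "0 \<le> C j" for j using C[OF s(1,3), of j] by simp
        have "hmom i s \<le> 1 ^ i * L + 1 ^ i * 0 + hmom N s / 1 ^ (N - i)"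
        proof -
          have v: "0 < r - s" "r - s < r" using s by auto
          have "hmom i s \<le> (\<integral>x. exp (r * x) + indicator {0<..} x * (x ^ N * exp ((r - s) * x)) \<partial>\<mu>)"
            unfolding hmom_def mom_def
          proof (rule integral_mono)
            fix x :: real
            show "indicator {0<..} x * (x ^ i * exp ((r - s) * x)) \<le> exp (r * x) + indicator {0<..} x * (x ^ N * exp ((r - s) * x))"
            proof (cases "0 < x")
              case True
              then have e: "exp ((r - s) * x) \<le> exp (r * x)" using s by simp
              show ?thesis
              proof (cases "x \<le> 1")
                case True
                then have "x ^ i * exp ((r - s) * x) \<le> 1 * exp (r * x)"
                  using \<open>0 < x\<close> e by (intro mult_mono) (auto simp: power_le_one)
                then show ?thesis using \<open>0 < x\<close> by (simp add: add_increasing2)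
              next
                case False
                then have "x ^ i * exp ((r - s) * x) \<le> x ^ N * exp ((r - s) * x)"
                  using that by (intro mult_right_mono power_increasing) auto
                then show ?thesis using \<open>0 < x\<close> by (simp add: add_increasing)
              qed
            qed simp
          qed (intro integrable_moment Bochner_Integration.integrable_add int v; simp)+
          also have "\<dots> = L + hmom N s"
            unfolding L_def hmom_def mom_def
            by (intro has_bochner_integral_integral_eq has_bochner_integral_add
                has_bochner_integral_integrable int integrable_moment v) simp
          finally show ?thesis by simp
        qed
        moreover have "hmom N s < D" using no s by force
        ultimately have "\<bar>mom UNIV i (r - s)\<bar> \<le> L + \<bar>D\<bar> + C i"
          using C[OF s(1,3), of i] hmom_nonneg[of i s] by auto
        also have "\<dots> \<le> K"
          unfolding K_def using that L Cnn by (intro member_le_sum) auto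
        finally show ?thesis .
      qed
      have "\<forall>\<^sub>F s in at_right 0. (\<Sum>i\<le>N. real (N choose i) * (K * K)) < S.mom UNIV N (r - s)"
        using Smlim unfolding filterlim_at_top_dense by blast
      with sr have "\<forall>\<^sub>F s in at_right 0. s \<in> {0<..<r/2} \<and> (\<Sum>i\<le>N. real (N choose i) * (K * K)) < S.mom UNIV N (r - s)"
        by (rule eventually_conj)
      then have "\<exists>s. s \<in> {0<..<r/2} \<and> (\<Sum>i\<le>N. real (N choose i) * (K * K)) < S.mom UNIV N (r - s)"
        by (rule eventually_happens'[OF trivial_limit_at_right_real])
      then obtain s where elim: "s \<in> {0<..<r/2}" "(\<Sum>i\<le>N. real (N choose i) * (K * K)) < S.mom UNIV N (r - s)"
        by blast
        have "S.mom UNIV N (r - s) = (\<Sum>i\<le>N. real (N choose i) * (mom UNIV i (r - s) * mom UNIV (N - i) (r - s)))"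
          using elim r_pos by (intro Smom) auto
        also have "\<dots> \<le> (\<Sum>i\<le>N. real (N choose i) * (K * K))"
        proof (intro sum_mono mult_left_mono)
          fix i assume i: "i \<in> {..N}"
          have "mom UNIV i (r - s) * mom UNIV (N - i) (r - s) \<le> \<bar>mom UNIV i (r - s)\<bar> * \<bar>mom UNIV (N - i) (r - s)\<bar>"
            by (simp flip: abs_mult)
          also have "\<dots> \<le> K * K"
            using bd[OF elim(1), of i] bd[OF elim(1), of "N - i"] i by (intro mult_mono) auto
          finally show "mom UNIV i (r - s) * mom UNIV (N - i) (r - s) \<le> K * K" .
        qed auto
      finally show False using elim(2) by linarith
    qed
  qed auto
  have hpos: "\<forall>\<^sub>F s in at_right 0. 0 < hmom N s"
    using hlim by (simp add: filterlim_at_top_dense)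
  have lim0: "((\<lambda>s. mom UNIV 0 (r - s)) \<longlongrightarrow> L) (at_right 0)"
    unfolding L_def by (rule mom_0_tendsto[OF int])
  have "\<forall>\<^sub>F s in at_right 0. \<bar>mom UNIV N (r - s) - hmom N s\<bar> \<le> C N"
    using sr by eventually_elim (use C in auto)
  then have "(\<lambda>s. mom UNIV N (r - s)) \<sim>[at_right 0] hmom N"
    by (rule asymp_equiv_bounded_diff[OF hlim])
  then have limN: "((\<lambda>s. mom UNIV N (r - s) / hmom N s) \<longlongrightarrow> 1) (at_right 0)"
    using hpos by (intro asymp_equivD_strong) (auto elim: eventually_mono)
  define lim where "lim i = (if i = 0 \<or> i = N then L else 0)" for i
  have terms: "((\<lambda>s. real (N choose i) * (mom UNIV i (r - s) * mom UNIV (N - i) (r - s)) / hmom N s) \<longlongrightarrow> lim i) (at_right 0)"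
    if i: "i \<le> N" for i
  proof -
    consider "i = 0" | "i = N" | "0 < i" "i < N" using i by linarith
    then show ?thesis
    proof cases
      case 1
      have "((\<lambda>s. mom UNIV 0 (r - s) * (mom UNIV N (r - s) / hmom N s)) \<longlongrightarrow> L * 1) (at_right 0)"
        by (intro tendsto_mult lim0 limN)
      then show ?thesis using 1 by (simp add: lim_def)
    next
      case 2
      have "((\<lambda>s. (mom UNIV N (r - s) / hmom N s) * mom UNIV 0 (r - s)) \<longlongrightarrow> 1 * L) (at_right 0)"
        by (intro tendsto_mult lim0 limN)
      then show ?thesis using 2 by (simp add: lim_def)
    next
      case 3
      have "((\<lambda>s. real (N choose i) * ((mom UNIV i (r - s) / root N (hmom N s) ^ i) *
          (mom UNIV (N - i) (r - s) / root N (hmom N s) ^ (N - i)))) \<longlongrightarrow> real (N choose i) * (0 * 0)) (at_right 0)"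
        using 3 by (intro tendsto_mult tendsto_const mom_lower_order int hlim) auto
      moreover have "root N (hmom N s) ^ i * root N (hmom N s) ^ (N - i) = hmom N s" for s
        using 3 hmom_nonneg by (simp flip: power_add)
      ultimately show ?thesis using 3 by (simp add: lim_def)
    qed
  qed
  have "((\<lambda>s. \<Sum>i\<le>N. real (N choose i) * (mom UNIV i (r - s) * mom UNIV (N - i) (r - s)) / hmom N s) \<longlongrightarrow> (\<Sum>i\<le>N. lim i)) (at_right 0)"
    by (intro tendsto_sum terms) auto
  moreover have "(\<Sum>i\<le>N. lim i) = 2 * L"
  proof -
    have "(\<Sum>i\<le>N. lim i) = (\<Sum>i\<in>{0, N}. lim i)"
      by (rule sum.mono_neutral_right) (auto simp: lim_def)
    then show ?thesis using N by (simp add: lim_def)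
  qed
  moreover have "\<forall>\<^sub>F s in at_right 0. (\<Sum>i\<le>N. real (N choose i) * (mom UNIV i (r - s) * mom UNIV (N - i) (r - s)) / hmom N s)
      = S.mom UNIV N (r - s) / hmom N s"
    using sr by eventually_elim (use Smom r_pos in \<open>simp add: sum_divide_distrib\<close>)
  ultimately have "((\<lambda>s. S.mom UNIV N (r - s) / hmom N s) \<longlongrightarrow> 2 * L) (at_right 0)"
    using tendsto_cong by force
  then have "((\<lambda>s. S.mom UNIV N (r - s) / hmom N s / (2 * L)) \<longlongrightarrow> 2 * L / (2 * L)) (at_right 0)"
    using L by (intro tendsto_divide tendsto_const) auto
  then have "((\<lambda>s. S.mom UNIV N (r - s) / (2 * L * hmom N s)) \<longlongrightarrow> 1) (at_right 0)"
    using L by (simp add: mult.commute)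
  then have "(\<lambda>s. S.mom UNIV N (r - s)) \<sim>[at_right 0] (\<lambda>s. 2 * L * hmom N s)"
    by (rule asymp_equivI')
  then have "S.hmom N \<sim>[at_right 0] (\<lambda>s. 2 * L * hmom N s)"
    using asymp_equiv_trans[OF asymp_equiv_symI[OF Sequiv]] by blast
  then show ?thesis
    using regvar0_asymp_equiv[OF reg, of "2 * L"] L by simp
qed

end

section \<open>Marginal laws of a Levy process\<close>

locale levy = prob_space M for M :: "'a measure" +
  fixes L :: "real \<Rightarrow> 'a \<Rightarrow> real"
  assumes levy: "levy_process M L"
begin

lemma measurable_L[measurable]: "0 \<le> t \<Longrightarrow> L t \<in> borel_measurable M"
  using levy by (simp add: levy_process_def)

definition law :: "real \<Rightarrow> real measure" where
  "law t = distr M borel (L t)"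

lemma sets_law[simp, measurable_cong]: "sets (law t) = sets borel"
  by (simp add: law_def)

lemma space_law[simp]: "space (law t) = UNIV"
  by (simp add: law_def)

lemma prob_space_law: "0 \<le> t \<Longrightarrow> prob_space (law t)"
  unfolding law_def by (intro prob_space_distr) simp

lemma law_add:
  assumes u: "0 < u" and w: "0 < w"
  shows "law (u + w) = (law u \<star> law w)"
proof -
  have L0: "AE \<omega> in M. L 0 \<omega> = 0"
    using levy by (simp add: levy_process_def)
  \<comment> \<open>Increments are independent along strictly increasing times, which is why u and w
    are positive. Only the values at 0, 1 and 2 enter.\<close>
  define t :: "nat \<Rightarrow> real" where "t i = (if i = 0 then 0 else if i = 1 then u else u + w)" for i
  define X where "X i \<omega> = L (t (Suc i)) \<omega> - L (t i) \<omega>" for i \<omega>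
  have "0 \<le> t 0 \<and> (\<forall>i<2. t i < t (Suc i))"
    using u w by (auto simp: t_def)
  then have "indep_vars (\<lambda>_. borel) X {..<2}"
    using levy unfolding levy_process_def X_def by blast
  moreover have "{..<2::nat} = insert 0 {1}" by auto
  ultimately have "indep_var borel (X 0) borel (\<lambda>\<omega>. \<Sum>i\<in>{1}. X i \<omega>)"
    by (intro indep_vars_sum) auto
  then have ind: "indep_var borel (X 0) borel (X 1)" by simp
  have X: "X 0 = (\<lambda>\<omega>. L u \<omega> - L 0 \<omega>)" "X 1 = (\<lambda>\<omega>. L (u + w) \<omega> - L u \<omega>)"
    by (auto simp: X_def t_def)
  have [measurable]: "X 0 \<in> borel_measurable M" "X 1 \<in> borel_measurable M"
    unfolding X using u w by auto
  have "distr M borel (\<lambda>\<omega>. X 0 \<omega> + X 1 \<omega>) = (distr M borel (X 0) \<star> distr M borel (X 1))"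
    by (rule sum_indep_random_variable[OF ind]) fact+
  moreover have "distr M borel (\<lambda>\<omega>. X 0 \<omega> + X 1 \<omega>) = law (u + w)"
    unfolding law_def using L0 u w by (intro distr_cong_AE) (auto simp: X simp del: One_nat_def)
  moreover have "distr M borel (X 0) = law u"
    unfolding law_def using L0 u w by (intro distr_cong_AE) (auto simp: X simp del: One_nat_def)
  moreover have "distr M borel (X 1) = law w"
    unfolding law_def X using levy u w unfolding levy_process_def by simp
  ultimately show ?thesis by simp
qed

lemma mgf_eq: "0 \<le> t \<Longrightarrow> mgf (law t) v = (\<integral>\<^sup>+\<omega>. ennreal (exp (v * L t \<omega>)) \<partial>M)"
  unfolding mgf_def law_def by (subst nn_integral_distr) auto

lemma mgf_add:
  assumes u: "0 < u" and w: "0 < w"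
  shows "mgf (law (u + w)) v = mgf (law u) v * mgf (law w) v"
proof -
  interpret U: prob_space "law u" using u by (intro prob_space_law) simp
  interpret W: prob_space "law w" using w by (intro prob_space_law) simp
  have "mgf (law (u + w)) v = (\<integral>\<^sup>+x. \<integral>\<^sup>+y. ennreal (exp (v * (x + y))) \<partial>law w \<partial>law u)"
    unfolding law_add[OF u w] mgf_def
    by (rule nn_integral_convolution[OF U.finite_measure_axioms W.finite_measure_axioms]) auto
  also have "\<dots> = (\<integral>\<^sup>+x. ennreal (exp (v * x)) * mgf (law w) v \<partial>law u)"
    unfolding mgf_def
    by (intro nn_integral_cong, subst nn_integral_cmult[symmetric])
       (auto simp: exp_add distrib_left ennreal_mult)
  also have "\<dots> = mgf (law u) v * mgf (law w) v"
    unfolding mgf_def by (rule nn_integral_multc) simp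
  finally show ?thesis .
qed

lemma mgf_mult_nat:
  assumes u: "0 < u"
  shows "mgf (law (real (Suc n) * u)) v = mgf (law u) v ^ Suc n"
proof (induction n)
  case (Suc n)
  have "real (Suc (Suc n)) * u = real (Suc n) * u + u" by (simp add: algebra_simps)
  then have "mgf (law (real (Suc (Suc n)) * u)) v = mgf (law (real (Suc n) * u)) v * mgf (law u) v"
    using u by (simp only:) (intro mgf_add; simp)
  then show ?case using Suc by (simp add: mult.commute)
qed simp

lemma mgf_pos: "0 \<le> t \<Longrightarrow> 0 < mgf (law t) v"
proof -
  assume t: "0 \<le> t"
  interpret T: prob_space "law t" by (rule prob_space_law[OF t])
  have "mgf (law t) v \<noteq> 0"
  proof
    assume "mgf (law t) v = 0"
    then have "AE x in law t. ennreal (exp (v * x)) = 0"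
      unfolding mgf_def by (subst (asm) nn_integral_0_iff_AE) auto
    then show False by simp
  qed
  then show ?thesis by (simp add: zero_less_iff_neq_zero)
qed

section \<open>The exponential formula for the generating function at all times\<close>

text \<open>The real form of \<open>cgf\<close>; it carries information only where the generating
  function is finite, hence the finiteness hypotheses that accompany it.\<close>

definition K :: "real \<Rightarrow> real" where
  "K v = ln (enn2real (mgf (law 1) v))"

lemma mgf_law_1:
  assumes "mgf (law 1) v < \<infinity>"
  shows "mgf (law 1) v = ennreal (exp (K v))"
  using assms mgf_pos[of 1 v] unfolding K_def by (simp add: enn2real_positive_iff)

text \<open>The generating function at time 1 / n is a nonnegative n-th root of the one at time 1,
  finite because its power is finite, and such a root is unique.\<close>

lemma mgf_rational:
  assumes fin: "mgf (law 1) v < \<infinity>"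
  shows "mgf (law (real (Suc j) / real (Suc n))) v = ennreal (exp (real (Suc j) / real (Suc n) * K v))"
proof -
  define f where "f = mgf (law (1 / real (Suc n))) v"
  have p: "f ^ Suc n = mgf (law 1) v"
    using mgf_mult_nat[of "1 / real (Suc n)" n v] by (simp add: f_def)
  have "f \<noteq> \<infinity>"
    using p fin by (auto simp: power_eq_top_ennreal)
  then obtain g where g: "0 \<le> g" "f = ennreal g" by (cases f) auto
  have "ennreal (g ^ Suc n) = ennreal (exp (K v))"
    using p mgf_law_1[OF fin] g by (simp add: ennreal_power del: power_Suc)
  then have "g ^ Suc n = exp (K v)" using g by (subst (asm) ennreal_inj) auto
  also have "\<dots> = exp (K v / real (Suc n)) ^ Suc n"
    by (simp del: power_Suc of_nat_Suc flip: exp_of_nat_mult)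
  finally have "g = exp (K v / real (Suc n))"
    by (rule power_eq_imp_eq_base) (use g in auto)
  then have f: "f = ennreal (exp (K v / real (Suc n)))" using g by simp
  have "mgf (law (real (Suc j) / real (Suc n))) v = f ^ Suc j"
    using mgf_mult_nat[of "1 / real (Suc n)" j v] by (simp add: f_def del: of_nat_Suc power_Suc)
  also have "\<dots> = ennreal (exp (K v / real (Suc n)) ^ Suc j)"
    unfolding f by (rule ennreal_power) simp
  also have "exp (K v / real (Suc n)) ^ Suc j = exp (real (Suc j) / real (Suc n) * K v)"
    by (simp del: power_Suc of_nat_Suc flip: exp_of_nat_mult)
  finally show ?thesis .
qed

text \<open>The grid point lies strictly above \<open>t\<close>, so that only right-continuity of the paths is needed.\<close>

definition grid :: "nat \<Rightarrow> real \<Rightarrow> real" where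
  "grid n t = real (Suc (nat \<lfloor>t * real (Suc n)\<rfloor>)) / real (Suc n)"

lemma grid_bounds:
  assumes "0 \<le> t"
  shows "t < grid n t" "grid n t \<le> t + 1 / real (Suc n)" "grid n t \<le> t + 1"
proof -
  define z where "z = t * real (Suc n)"
  have z: "0 \<le> z" using assms by (simp add: z_def)
  have e: "grid n t = (real_of_int \<lfloor>z\<rfloor> + 1) / real (Suc n)"
    using z unfolding grid_def z_def[symmetric] by (simp add: add.commute)
  have t: "t = z / real (Suc n)" by (simp add: z_def)
  show "t < grid n t"
    unfolding e by (subst t, rule divide_strict_right_mono) linarith+
  have "grid n t \<le> (z + 1) / real (Suc n)"
    unfolding e by (intro divide_right_mono) linarith+
  then show *: "grid n t \<le> t + 1 / real (Suc n)"
    by (simp add: t add_divide_distrib)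
  have "1 / real (Suc n) \<le> 1" by simp
  with * show "grid n t \<le> t + 1" by linarith
qed

lemma grid_tendsto:
  assumes "0 \<le> t"
  shows "filterlim (\<lambda>n. grid n t) (at_right t) sequentially"
proof -
  have "(\<lambda>n. grid n t) \<longlonglongrightarrow> t"
  proof (rule tendsto_sandwich[where f = "\<lambda>_. t" and h = "\<lambda>n. t + 1 / real (Suc n)"])
    show "(\<lambda>n. t + 1 / real (Suc n)) \<longlonglongrightarrow> t"
      using tendsto_add[OF tendsto_const LIMSEQ_Suc[OF lim_inverse_n']] by simp
    show "\<forall>\<^sub>F n in sequentially. t \<le> grid n t"
      using grid_bounds(1)[OF assms] by (simp add: less_imp_le)
    show "\<forall>\<^sub>F n in sequentially. grid n t \<le> t + 1 / real (Suc n)"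
      using grid_bounds(2)[OF assms] by (intro always_eventually allI)
  qed simp
  then show ?thesis
    using grid_bounds(1)[OF assms] by (auto simp: filterlim_at intro!: always_eventually less_imp_neq[symmetric])
qed

lemma mgf_law_grid:
  assumes fin: "mgf (law 1) v < \<infinity>"
  shows "mgf (law (grid n t)) v = ennreal (exp (grid n t * K v))"
  unfolding grid_def by (rule mgf_rational[OF fin])

lemma right_continuous: "AE \<omega> in M. \<forall>t\<ge>0. ((\<lambda>u. L u \<omega>) \<longlongrightarrow> L t \<omega>) (at_right t)"
  using levy unfolding levy_process_def by (auto elim: eventually_mono)

text \<open>Right-continuity and Fatou give the inequality \<le> at every time. For the converse, t
  is completed to a rational time q = t + w: the formula is exact at q, and the inequality already
  known at w bounds the factor for w.\<close>

lemma mgf_law: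
  assumes fin: "mgf (law 1) v < \<infinity>" and t: "0 \<le> t"
  shows "mgf (law t) v = ennreal (exp (t * K v))"
proof -
  have le: "mgf (law u) v \<le> ennreal (exp (u * K v))" if u: "0 \<le> u" for u
  proof -
    have g: "0 \<le> grid n u" for n using grid_bounds(1)[OF u, of n] u by linarith
    note [measurable] = measurable_L[OF g] measurable_L[OF u]
    have "mgf (law u) v = (\<integral>\<^sup>+\<omega>. ennreal (exp (v * L u \<omega>)) \<partial>M)"
      by (rule mgf_eq[OF u])
    also have "\<dots> \<le> (\<integral>\<^sup>+\<omega>. liminf (\<lambda>n. ennreal (exp (v * L (grid n u) \<omega>))) \<partial>M)"
    proof (rule nn_integral_mono_AE)
      show "AE \<omega> in M. ennreal (exp (v * L u \<omega>)) \<le> liminf (\<lambda>n. ennreal (exp (v * L (grid n u) \<omega>)))"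
        using right_continuous
      proof eventually_elim
        case (elim \<omega>)
        then have "(\<lambda>n. L (grid n u) \<omega>) \<longlonglongrightarrow> L u \<omega>"
          using filterlim_compose[OF _ grid_tendsto[OF u]] u by blast
        then have "(\<lambda>n. ennreal (exp (v * L (grid n u) \<omega>))) \<longlonglongrightarrow> ennreal (exp (v * L u \<omega>))"
          by (intro tendsto_intros)
        then have "liminf (\<lambda>n. ennreal (exp (v * L (grid n u) \<omega>))) = ennreal (exp (v * L u \<omega>))"
          by (rule lim_imp_Liminf[OF sequentially_bot])
        then show ?case by simp
      qed
    qed
    also have "\<dots> \<le> liminf (\<lambda>n. (\<integral>\<^sup>+\<omega>. ennreal (exp (v * L (grid n u) \<omega>)) \<partial>M))"
      by (rule nn_integral_liminf) measurable
    also have "\<dots> = liminf (\<lambda>n. ennreal (exp (grid n u * K v)))"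
      by (simp only: mgf_eq[OF g, symmetric] mgf_law_grid[OF fin])
    also have "\<dots> = ennreal (exp (u * K v))"
    proof (rule lim_imp_Liminf)
      have "(\<lambda>n. grid n u) \<longlonglongrightarrow> u"
        using grid_tendsto[OF u] by (simp add: filterlim_at)
      then show "(\<lambda>n. ennreal (exp (grid n u * K v))) \<longlonglongrightarrow> ennreal (exp (u * K v))"
        by (intro tendsto_intros)
    qed simp
    finally show ?thesis .
  qed
  show ?thesis
  proof (cases "t = 0")
    case True
    have "AE \<omega> in M. L 0 \<omega> = 0"
      using levy by (simp add: levy_process_def)
    then have "(\<integral>\<^sup>+\<omega>. ennreal (exp (v * L 0 \<omega>)) \<partial>M) = (\<integral>\<^sup>+\<omega>. 1 \<partial>M)"
      by (intro nn_integral_cong_AE) (auto elim: eventually_mono)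
    then show ?thesis
      using True mgf_eq[of 0 v] by (simp add: emeasure_space_1)
  next
    case False
    then have t: "0 < t" using t by simp
    \<comment> \<open>\<open>grid 0 t\<close> is the first integer strictly above t.\<close>
    define q where "q = grid 0 t"
    have q: "t < q" using grid_bounds(1)[of t 0] t by (simp add: q_def)
    define w where "w = q - t"
    have w: "0 < w" using q by (simp add: w_def)
    have "ennreal (exp (q * K v)) = mgf (law (t + w)) v"
      using mgf_law_grid[OF fin, of 0 t] by (simp add: q_def w_def)
    also have "\<dots> = mgf (law t) v * mgf (law w) v"
      by (rule mgf_add[OF t w])
    also have "\<dots> \<le> mgf (law t) v * ennreal (exp (w * K v))"
      using le[of w] w by (intro mult_left_mono) auto
    finally have "ennreal (exp (q * K v)) * ennreal (exp (- (w * K v)))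
        \<le> mgf (law t) v * ennreal (exp (w * K v)) * ennreal (exp (- (w * K v)))"
      by (rule mult_right_mono) simp
    also have "\<dots> = mgf (law t) v"
      by (simp add: mult.assoc flip: ennreal_mult exp_add)
    also have "ennreal (exp (q * K v)) * ennreal (exp (- (w * K v))) = ennreal (exp (t * K v))"
      by (simp add: w_def algebra_simps flip: ennreal_mult exp_add)
    finally show ?thesis using le[of t] t by (intro antisym) auto
  qed
qed

lemma exp_moments_law:
  assumes fin: "\<And>v. 0 \<le> v \<Longrightarrow> v < r \<Longrightarrow> mgf (law 1) v < \<infinity>" and r: "0 < r" and t: "0 \<le> t"
  shows "exp_moments (law t) r"
proof -
  interpret T: prob_space "law t" by (rule prob_space_law[OF t])
  show ?thesis
  proof
    fix v assume v: "0 \<le> v" "v < r"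
    have "mgf (law t) v < \<infinity>"
      using mgf_law[OF fin[OF v] t] by simp
    then show "integrable (law t) (\<lambda>x. exp (v * x))"
      unfolding mgf_def by (intro integrableI_nonneg) auto
  qed (use r in auto)
qed

text \<open>The second-moment (Paley--Zygmund) argument, made uniform over a bounded time interval.\<close>

lemma law_lower_uniform:
  assumes v: "0 < v" and fin: "mgf (law 1) v < \<infinity>" "mgf (law 1) (2 * v) < \<infinity>" and b: "0 \<le> b"
  obtains c \<eta> where "0 \<le> c" "0 < \<eta>" "\<And>w. 0 \<le> w \<Longrightarrow> w \<le> b \<Longrightarrow> \<eta> \<le> measure (law w) {- c..}"
proof -
  define k1 k2 where "k1 = exp (b * \<bar>K v\<bar>)" and "k2 = exp (b * \<bar>K (2 * v)\<bar>)"
  have k: "1 \<le> k1" "1 \<le> k2" using b by (auto simp: k1_def k2_def)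
  \<comment> \<open>On the interval of times, E exp (v X) is at least 1 / k1 and E exp (2 v X) at
    most k2. The constant c limits the part below - c to 1 / (2 k1), and \<gamma> limits the
    quadratic part to 1 / (4 k1); the remaining 1 / (4 k1) must come from the event.\<close>
  define c where "c = ln (2 * k1) / v"
  define \<gamma> where "\<gamma> = 1 / (4 * k1 * k2)"
  have \<gamma>: "0 < \<gamma>" using k by (simp add: \<gamma>_def)
  define \<eta> where "\<eta> = \<gamma> / k1"
  show ?thesis
  proof (rule that[of c \<eta>])
    show "0 \<le> c" unfolding c_def using k v by simp
    show "0 < \<eta>" using k \<gamma> by (simp add: \<eta>_def)
    fix w assume w: "0 \<le> w" "w \<le> b"
    interpret W: prob_space "law w" by (rule prob_space_law[OF w(1)])
    have bd: "\<bar>w * K z\<bar> \<le> b * \<bar>K z\<bar>" for z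
      using w by (simp add: abs_mult mult_right_mono)
    have m: "has_bochner_integral (law w) (\<lambda>x. exp (z * x)) (exp (w * K z))" if "mgf (law 1) z < \<infinity>" for z
      using mgf_law[OF that w(1)] unfolding mgf_def by (intro has_bochner_integral_nn_integral) auto
    have i: "has_bochner_integral (law w) (\<lambda>x. indicator {- c..} x) (measure (law w) {- c..})"
      by (intro has_bochner_integral_real_indicator) (auto simp: W.emeasure_eq_measure)
    have int: "has_bochner_integral (law w)
        (\<lambda>x. exp (- (v * c)) + (\<gamma> * exp ((2 * v) * x) + (1 / (4 * \<gamma>)) * indicator {- c..} x))
        (measure (law w) (space (law w)) * exp (- (v * c)) + (\<gamma> * exp (w * K (2 * v)) + (1 / (4 * \<gamma>)) * measure (law w) {- c..}))"
      using has_bochner_integral_integrable[OF W.integrable_const[of "exp (- (v * c))"]]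
      by (intro has_bochner_integral_add has_bochner_integral_mult_right i m fin) (simp add: W.prob_space)
    have "exp (w * K v) \<le> measure (law w) (space (law w)) * exp (- (v * c)) +
        (\<gamma> * exp (w * K (2 * v)) + (1 / (4 * \<gamma>)) * measure (law w) {- c..})"
      using m[OF fin(1)] int unfolding has_bochner_integral_iff
    proof (elim conjE, elim subst, intro integral_mono)
      fix x
      show "exp (v * x) \<le> exp (- (v * c)) + (\<gamma> * exp ((2 * v) * x) + (1 / (4 * \<gamma>)) * indicator {- c..} x)"
      proof (cases "- c \<le> x")
        case True
        define z where "z = exp (v * x)"
        have zz: "exp ((2 * v) * x) = z\<^sup>2" by (simp add: z_def power2_eq_square flip: exp_add)
        \<comment> \<open>The arithmetic-geometric mean inequality, in place of Cauchy-Schwarz; it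
          keeps the bound linear in the probability.\<close>
        have "0 \<le> (2 * \<gamma> * z - 1)\<^sup>2 / (4 * \<gamma>)" using \<gamma> by simp
        also have "\<dots> = \<gamma> * z\<^sup>2 + 1 / (4 * \<gamma>) - z"
          using \<gamma> by (simp add: power2_eq_square field_simps)
        finally have "z \<le> \<gamma> * z\<^sup>2 + 1 / (4 * \<gamma>)" by simp
        then show ?thesis using True unfolding zz z_def[symmetric] by (simp add: add_increasing)
      next
        case False
        then have "v * x \<le> v * - c" using v by (intro mult_left_mono) auto
        then have "exp (v * x) \<le> exp (- (v * c))" by simp
        then show ?thesis using \<gamma> False by (simp add: add_increasing2)
      qed
    qed
    moreover have "exp (- (v * c)) = 1 / (2 * k1)"
      using v k by (simp add: c_def exp_minus inverse_eq_divide)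
    moreover have "1 / k1 \<le> exp (w * K v)"
      using bd[of v] unfolding k1_def by (simp flip: exp_minus add: divide_inverse)
    moreover have "\<gamma> * exp (w * K (2 * v)) \<le> \<gamma> * k2"
      using bd[of "2 * v"] \<gamma> unfolding k2_def by (intro mult_left_mono) auto
    moreover have "\<gamma> * k2 = 1 / (4 * k1)" using k by (simp add: \<gamma>_def)
    ultimately have "1 / (4 * k1) \<le> (1 / (4 * \<gamma>)) * measure (law w) {- c..}"
      using W.prob_space by (simp add: field_simps)
    then have "(4 * \<gamma>) * (1 / (4 * k1)) \<le> (4 * \<gamma>) * ((1 / (4 * \<gamma>)) * measure (law w) {- c..})"
      using \<gamma> by (intro mult_left_mono) auto
    then show "\<eta> \<le> measure (law w) {- c..}" using \<gamma> by (simp add: \<eta>_def)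
  qed
qed

lemma law_tail_add:
  assumes a: "0 < a" and w: "0 < w"
  shows "measure (law a) {y + c<..} * measure (law w) {- c..} \<le> measure (law (a + w)) {y<..}"
proof -
  interpret A: prob_space "law a" using a by (intro prob_space_law) simp
  interpret W: prob_space "law w" using w by (intro prob_space_law) simp
  interpret S: prob_space "law (a + w)" using a w by (intro prob_space_law) simp
  have meas: "(\<lambda>(x, y). x + y) \<in> borel_measurable (law a \<Otimes>\<^sub>M law w)"
    by measurable
  have "emeasure (law a) {y + c<..} * emeasure (law w) {- c..} =
      emeasure (law a \<Otimes>\<^sub>M law w) ({y + c<..} \<times> {- c..})"
    by (rule W.emeasure_pair_measure_Times[symmetric]) auto
  also have "\<dots> \<le> emeasure (law a \<Otimes>\<^sub>M law w) ((\<lambda>(x, y). x + y) -` {y<..} \<inter> space (law a \<Otimes>\<^sub>M law w))"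
  proof (rule emeasure_mono)
    show "(\<lambda>(x, y). x + y) -` {y<..} \<inter> space (law a \<Otimes>\<^sub>M law w) \<in> sets (law a \<Otimes>\<^sub>M law w)"
      by (rule measurable_sets[OF meas]) simp
  qed (auto simp: space_pair_measure)
  also have "\<dots> = emeasure (law (a + w)) {y<..}"
    unfolding law_add[OF a w] convolution_def by (rule emeasure_distr[OF meas, symmetric]) simp
  finally show ?thesis
    by (simp add: A.emeasure_eq_measure W.emeasure_eq_measure S.emeasure_eq_measure ennreal_mult[symmetric])
qed

end

section \<open>Evaluation at an independent random time\<close>

locale levy_time = levy M L for M :: "'a measure" and L :: "real \<Rightarrow> 'a \<Rightarrow> real" +
  fixes T :: "'a \<Rightarrow> real"
  assumes T_measurable[measurable]: "T \<in> borel_measurable M"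
    and T_nonneg: "AE \<omega> in M. 0 \<le> T \<omega>"
    and indep: "indep_of_process M T L"
begin

text \<open>T may be negative on a null set, while L is constrained only at nonnegative times;
  clipping makes every grid time admissible.\<close>

definition pos_T :: "'a \<Rightarrow> real" where
  "pos_T \<omega> = max 0 (T \<omega>)"

lemma pos_T_nonneg[simp]: "0 \<le> pos_T \<omega>"
  by (simp add: pos_T_def)

lemma pos_T_measurable[measurable]: "pos_T \<in> borel_measurable M"
  unfolding pos_T_def by measurable

definition index :: "nat \<Rightarrow> 'a \<Rightarrow> nat" where
  "index n \<omega> = nat \<lfloor>pos_T \<omega> * real (Suc n)\<rfloor>"

definition node :: "nat \<Rightarrow> nat \<Rightarrow> real" where
  "node n j = real (Suc j) / real (Suc n)"

lemma node_nonneg[simp]: "0 \<le> node n j"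
  by (simp add: node_def)

lemma grid_pos_T: "grid n (pos_T \<omega>) = node n (index n \<omega>)"
  by (simp add: grid_def node_def index_def)

lemma index_measurable[measurable]: "index n \<in> measurable M (count_space UNIV)"
  unfolding index_def by measurable

text \<open>Only countably many times occur, so this is Borel measurable with respect to M, which
  \<open>L (T \<omega>) \<omega>\<close> itself may fail to be.\<close>

definition approx :: "nat \<Rightarrow> 'a \<Rightarrow> real" where
  "approx n \<omega> = L (node n (index n \<omega>)) \<omega>"

lemma approx_measurable[measurable]: "approx n \<in> borel_measurable M"
  unfolding approx_def by (rule measurable_compose_countable[OF _ index_measurable]) simp

lemma emeasure_index_L:
  assumes A: "A \<in> sets borel" and t: "0 \<le> t"
  shows "emeasure M ((index n -` {j} \<inter> space M) \<inter> (L t -` A \<inter> space M)) =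
    emeasure M (index n -` {j} \<inter> space M) * emeasure (law t) A"
proof -
  have 1: "index n -` {j} \<inter> space M \<in> sets (vimage_algebra (space M) T borel)"
  proof -
    have "{x::real. nat \<lfloor>max 0 x * real (Suc n)\<rfloor> = j} \<in> sets borel" by measurable
    then have "T -` {x. nat \<lfloor>max 0 x * real (Suc n)\<rfloor> = j} \<inter> space M \<in> sets (vimage_algebra (space M) T borel)"
      by (rule in_vimage_algebra)
    then show ?thesis by (simp add: index_def pos_T_def vimage_def)
  qed
  have 2: "L t -` A \<inter> space M \<in>
      sets (vimage_algebra (space M) (\<lambda>\<omega>. \<lambda>t\<in>{0..}. L t \<omega>) (\<Pi>\<^sub>M t\<in>{0..}. borel))"
  proof -
    have "(\<lambda>f. f t) \<in> measurable (\<Pi>\<^sub>M t\<in>{0::real..}. (borel :: real measure)) borel"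
      using t by (intro measurable_component_singleton) simp
    from measurable_sets[OF this A]
    have "(\<lambda>\<omega>. \<lambda>t\<in>{0..}. L t \<omega>) -` ((\<lambda>f. f t) -` A \<inter> space (\<Pi>\<^sub>M t\<in>{0::real..}. (borel :: real measure))) \<inter> space M \<in>
        sets (vimage_algebra (space M) (\<lambda>\<omega>. \<lambda>t\<in>{0..}. L t \<omega>) (\<Pi>\<^sub>M t\<in>{0..}. borel))"
      by (rule in_vimage_algebra)
    also have "(\<lambda>\<omega>. \<lambda>t\<in>{0..}. L t \<omega>) -` ((\<lambda>f. f t) -` A \<inter> space (\<Pi>\<^sub>M t\<in>{0::real..}. (borel :: real measure))) \<inter> space M
        = L t -` A \<inter> space M"
      using t by (auto simp: space_PiM)
    finally show ?thesis .
  qed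
  have "prob ((index n -` {j} \<inter> space M) \<inter> (L t -` A \<inter> space M)) =
      prob (index n -` {j} \<inter> space M) * prob (L t -` A \<inter> space M)"
    using indep 1 2 unfolding indep_of_process_def by (rule indep_setD)
  moreover have "emeasure (law t) A = emeasure M (L t -` A \<inter> space M)"
    unfolding law_def using t A by (intro emeasure_distr) auto
  ultimately show ?thesis
    by (simp add: emeasure_eq_measure ennreal_mult)
qed

text \<open>Independence passes from sets to functions by recognising the law of \<open>L t\<close>
  under M restricted to the event as a multiple of \<open>law t\<close>.\<close>

lemma nn_integral_index_L:
  assumes t: "0 \<le> t" and [measurable]: "\<phi> \<in> borel_measurable borel"
  shows "(\<integral>\<^sup>+\<omega>. indicator {j} (index n \<omega>) * \<phi> (L t \<omega>) \<partial>M) =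
    (\<integral>\<^sup>+\<omega>. indicator {j} (index n \<omega>) \<partial>M) * (\<integral>\<^sup>+x. \<phi> x \<partial>law t)"
proof -
  note [measurable] = measurable_L[OF t]
  define E where "E = index n -` {j} \<inter> space M"
  have E[measurable]: "E \<in> sets M" unfolding E_def by measurable
  have ind: "indicator {j} (index n \<omega>) = (indicator E \<omega> :: ennreal)" if "\<omega> \<in> space M" for \<omega>
    using that by (simp add: E_def indicator_def)
  have eq: "distr (density M (indicator E)) borel (L t) = scale_measure (emeasure M E) (law t)"
  proof (rule measure_eqI)
    fix A assume "A \<in> sets (distr (density M (indicator E)) borel (L t))"
    then have A[measurable]: "A \<in> sets borel" by simp
    have "emeasure (distr (density M (indicator E)) borel (L t)) A =
        emeasure (density M (indicator E)) (L t -` A \<inter> space M)"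
      by (subst emeasure_distr) auto
    also have "\<dots> = (\<integral>\<^sup>+\<omega>. indicator E \<omega> * indicator (L t -` A \<inter> space M) \<omega> \<partial>M)"
      by (subst emeasure_density) auto
    also have "\<dots> = (\<integral>\<^sup>+\<omega>. indicator (E \<inter> (L t -` A \<inter> space M)) \<omega> \<partial>M)"
      by (intro nn_integral_cong) (auto simp: indicator_def)
    also have "\<dots> = emeasure M (E \<inter> (L t -` A \<inter> space M))"
      by simp
    also have "\<dots> = emeasure M E * emeasure (law t) A"
      unfolding E_def by (rule emeasure_index_L[OF A t])
    finally show "emeasure (distr (density M (indicator E)) borel (L t)) A =
        emeasure (scale_measure (emeasure M E) (law t)) A"
      by simp
  qed simp
  have "(\<integral>\<^sup>+\<omega>. indicator {j} (index n \<omega>) * \<phi> (L t \<omega>) \<partial>M) = (\<integral>\<^sup>+\<omega>. indicator E \<omega> * \<phi> (L t \<omega>) \<partial>M)"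
    by (intro nn_integral_cong) (simp add: ind)
  also have "\<dots> = (\<integral>\<^sup>+\<omega>. \<phi> (L t \<omega>) \<partial>density M (indicator E))"
    by (subst nn_integral_density) auto
  also have "\<dots> = (\<integral>\<^sup>+x. \<phi> x \<partial>distr (density M (indicator E)) borel (L t))"
    by (subst nn_integral_distr) auto
  also have "\<dots> = emeasure M E * (\<integral>\<^sup>+x. \<phi> x \<partial>law t)"
    unfolding eq by (rule nn_integral_scale_measure) simp
  also have "emeasure M E = (\<integral>\<^sup>+\<omega>. indicator E \<omega> \<partial>M)"
    by simp
  also have "\<dots> = (\<integral>\<^sup>+\<omega>. indicator {j} (index n \<omega>) \<partial>M)"
    by (intro nn_integral_cong) (simp add: ind)
  finally show ?thesis .
qed

text \<open>Conditioning on T carried out by hand: the integral is split over the countably many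
  values of the index, each term factors by independence, and the sum is put together again.\<close>

lemma nn_integral_approx:
  assumes [measurable]: "\<phi> \<in> borel_measurable borel"
  shows "(\<integral>\<^sup>+\<omega>. \<phi> (approx n \<omega>) \<partial>M) = (\<integral>\<^sup>+\<omega>. (\<integral>\<^sup>+x. \<phi> x \<partial>law (grid n (pos_T \<omega>))) \<partial>M)"
proof -
  have split: "F (index n \<omega>) = (\<Sum>j. indicator {j} (index n \<omega>) * F j)" for F :: "nat \<Rightarrow> ennreal" and \<omega>
    by (subst suminf_finite[of "{index n \<omega>}"]) auto
  have [measurable]: "(\<lambda>\<omega>. indicator {j} (index n \<omega>) :: ennreal) \<in> borel_measurable M" for j
    by (rule measurable_compose[OF index_measurable]) simp
  have [measurable]: "(\<lambda>\<omega>. \<phi> (L (node n j) \<omega>)) \<in> borel_measurable M" for j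
    by (rule measurable_compose[OF measurable_L[OF node_nonneg]]) fact
  have "(\<integral>\<^sup>+\<omega>. \<phi> (approx n \<omega>) \<partial>M) = (\<integral>\<^sup>+\<omega>. (\<Sum>j. indicator {j} (index n \<omega>) * \<phi> (L (node n j) \<omega>)) \<partial>M)"
    unfolding approx_def by (intro nn_integral_cong split)
  also have "\<dots> = (\<Sum>j. \<integral>\<^sup>+\<omega>. indicator {j} (index n \<omega>) * \<phi> (L (node n j) \<omega>) \<partial>M)"
    by (intro nn_integral_suminf borel_measurable_times_ennreal) fact+
  also have "\<dots> = (\<Sum>j. (\<integral>\<^sup>+\<omega>. indicator {j} (index n \<omega>) \<partial>M) * (\<integral>\<^sup>+x. \<phi> x \<partial>law (node n j)))"
    by (intro suminf_cong nn_integral_index_L) auto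
  also have "\<dots> = (\<Sum>j. \<integral>\<^sup>+\<omega>. indicator {j} (index n \<omega>) * (\<integral>\<^sup>+x. \<phi> x \<partial>law (node n j)) \<partial>M)"
    by (intro suminf_cong nn_integral_multc[symmetric]) measurable
  also have "\<dots> = (\<integral>\<^sup>+\<omega>. (\<Sum>j. indicator {j} (index n \<omega>) * (\<integral>\<^sup>+x. \<phi> x \<partial>law (node n j))) \<partial>M)"
    by (rule nn_integral_suminf[symmetric]) measurable
  also have "\<dots> = (\<integral>\<^sup>+\<omega>. (\<integral>\<^sup>+x. \<phi> x \<partial>law (node n (index n \<omega>))) \<partial>M)"
    by (intro nn_integral_cong split[symmetric])
  finally show ?thesis by (simp add: grid_pos_T)
qed

text \<open>A version of L(T) that is measurable with respect to M itself; the value of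
  \<open>lim\<close> where the sequence diverges affects only a null set.\<close>

definition limit :: "'a \<Rightarrow> real" where
  "limit \<omega> = lim (\<lambda>n. approx n \<omega>)"

lemma limit_measurable[measurable]: "limit \<in> borel_measurable M"
  unfolding limit_def by measurable

lemma approx_tendsto: "AE \<omega> in M. (\<lambda>n. approx n \<omega>) \<longlonglongrightarrow> L (T \<omega>) \<omega>"
  using right_continuous T_nonneg
proof eventually_elim
  case (elim \<omega>)
  then have "((\<lambda>u. L u \<omega>) \<longlongrightarrow> L (pos_T \<omega>) \<omega>) (at_right (pos_T \<omega>))" by simp
  then have "(\<lambda>n. L (grid n (pos_T \<omega>)) \<omega>) \<longlonglongrightarrow> L (pos_T \<omega>) \<omega>"
    by (rule filterlim_compose[OF _ grid_tendsto[OF pos_T_nonneg]])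
  then show ?case
    using elim by (simp add: approx_def grid_pos_T[symmetric]) (simp add: pos_T_def)
qed

lemma limit_eq: "AE \<omega> in M. L (T \<omega>) \<omega> = limit \<omega>"
  using approx_tendsto by eventually_elim (simp add: limit_def limI)

lemma approx_tendsto_limit: "AE \<omega> in M. (\<lambda>n. approx n \<omega>) \<longlonglongrightarrow> limit \<omega>"
  using approx_tendsto limit_eq by eventually_elim simp

lemma law_at_random_time_eq: "law_at_random_time M L T = distr M borel limit"
proof -
  have lc: "limit \<in> borel_measurable (completion M)"
    by (rule measurable_completion[OF limit_measurable])
  have meas: "(\<lambda>\<omega>. L (T \<omega>) \<omega>) \<in> borel_measurable (completion M)"
  proof (rule measurableI)
    fix A :: "real set" assume A: "A \<in> sets borel"
    obtain N where N: "N \<in> null_sets M" "{\<omega> \<in> space M. \<not> L (T \<omega>) \<omega> = limit \<omega>} \<subseteq> N"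
      using limit_eq by (auto simp: eventually_ae_filter)
    let ?B = "(\<lambda>\<omega>. L (T \<omega>) \<omega>) -` A \<inter> space M"
    have B: "?B = (limit -` A \<inter> space M - N) \<union> (?B \<inter> N)"
      using N(2) by auto
    have "limit -` A \<inter> space M - N \<in> sets M"
      using N(1) measurable_sets[OF limit_measurable A] by auto
    moreover have "?B \<inter> N \<in> sets (completion M)"
      by (rule null_sets_completion[OF N(1)]) simp
    ultimately have "?B \<in> sets (completion M)"
      by (subst B) auto
    then show "(\<lambda>\<omega>. L (T \<omega>) \<omega>) -` A \<inter> space (completion M) \<in> sets (completion M)" by simp
  qed simp
  have "law_at_random_time M L T = distr (completion M) borel limit"
    unfolding law_at_random_time_def
    by (rule distr_cong_AE) (auto intro: AE_completion[OF limit_eq] meas lc)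
  then show ?thesis
    by (simp add: distr_completion)
qed

lemma tail_eq:
  "1 - cdf (law_at_random_time M L T) x = measure M {\<omega> \<in> space M. x < limit \<omega>}"
proof -
  have "cdf (law_at_random_time M L T) x = prob {\<omega> \<in> space M. limit \<omega> \<le> x}"
    unfolding cdf_def law_at_random_time_eq
    by (subst measure_distr) (auto intro!: arg_cong[where f = prob])
  also have "\<dots> = prob (space M - {\<omega> \<in> space M. x < limit \<omega>})"
    by (intro arg_cong[where f = prob]) auto
  also have "\<dots> = 1 - prob {\<omega> \<in> space M. x < limit \<omega>}"
    by (rule prob_compl) measurable
  finally show ?thesis by simp
qed

text \<open>Only finiteness is needed for the rate, so the crude factor exp \<kappa> is harmless: it
  pays for grid points that exceed T by up to 1. Replacing K v, which may be negative, by \<kappa>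
  \<ge> 0 makes the bound monotone in time.\<close>

lemma mgf_limit_finite:
  assumes v: "mgf (law 1) v < \<infinity>" and \<kappa>: "K v \<le> \<kappa>" "0 \<le> \<kappa>" and fin: "mgf (distr M borel T) \<kappa> < \<infinity>"
  shows "(\<integral>\<^sup>+\<omega>. ennreal (exp (v * limit \<omega>)) \<partial>M) < \<infinity>"
proof -
  have "(\<integral>\<^sup>+\<omega>. ennreal (exp (v * limit \<omega>)) \<partial>M) \<le> (\<integral>\<^sup>+\<omega>. liminf (\<lambda>n. ennreal (exp (v * approx n \<omega>))) \<partial>M)"
  proof (rule nn_integral_mono_AE)
    show "AE \<omega> in M. ennreal (exp (v * limit \<omega>)) \<le> liminf (\<lambda>n. ennreal (exp (v * approx n \<omega>)))"
      using approx_tendsto_limit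
    proof eventually_elim
      case (elim \<omega>)
      then have "(\<lambda>n. ennreal (exp (v * approx n \<omega>))) \<longlonglongrightarrow> ennreal (exp (v * limit \<omega>))"
        by (intro tendsto_intros)
      then have "liminf (\<lambda>n. ennreal (exp (v * approx n \<omega>))) = ennreal (exp (v * limit \<omega>))"
        by (rule lim_imp_Liminf[OF sequentially_bot])
      then show ?case by simp
    qed
  qed
  also have "\<dots> \<le> liminf (\<lambda>n. \<integral>\<^sup>+\<omega>. ennreal (exp (v * approx n \<omega>)) \<partial>M)"
    by (rule nn_integral_liminf) measurable
  also have "\<dots> \<le> liminf (\<lambda>n. ennreal (exp \<kappa>) * mgf (distr M borel T) \<kappa>)"
  proof (rule Liminf_mono, rule always_eventually, rule allI)
    fix n
    have "(\<integral>\<^sup>+\<omega>. ennreal (exp (v * approx n \<omega>)) \<partial>M) = (\<integral>\<^sup>+\<omega>. mgf (law (grid n (pos_T \<omega>))) v \<partial>M)"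
      unfolding mgf_def by (rule nn_integral_approx) measurable
    also have "\<dots> \<le> (\<integral>\<^sup>+\<omega>. ennreal (exp \<kappa>) * ennreal (exp (\<kappa> * T \<omega>)) \<partial>M)"
    proof (rule nn_integral_mono_AE)
      show "AE \<omega> in M. mgf (law (grid n (pos_T \<omega>))) v \<le> ennreal (exp \<kappa>) * ennreal (exp (\<kappa> * T \<omega>))"
        using T_nonneg
      proof eventually_elim
        case (elim \<omega>)
        have p: "pos_T \<omega> = T \<omega>" using elim by (simp add: pos_T_def)
        have g: "0 \<le> grid n (T \<omega>)" "grid n (T \<omega>) \<le> T \<omega> + 1"
          using grid_bounds[OF elim, of n] elim by auto
        have "grid n (T \<omega>) * K v \<le> grid n (T \<omega>) * \<kappa>"
          using g \<kappa> by (intro mult_left_mono) auto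
        also have "\<dots> \<le> (T \<omega> + 1) * \<kappa>"
          using g \<kappa> by (intro mult_right_mono) auto
        finally have "exp (grid n (T \<omega>) * K v) \<le> exp (\<kappa> + \<kappa> * T \<omega>)"
          by (simp add: algebra_simps)
        then show ?case
          using mgf_law[OF v g(1)] by (simp add: p exp_add ennreal_mult[symmetric] ennreal_leI)
      qed
    qed
    also have "\<dots> = ennreal (exp \<kappa>) * (\<integral>\<^sup>+\<omega>. ennreal (exp (\<kappa> * T \<omega>)) \<partial>M)"
      by (rule nn_integral_cmult) measurable
    also have "(\<integral>\<^sup>+\<omega>. ennreal (exp (\<kappa> * T \<omega>)) \<partial>M) = mgf (distr M borel T) \<kappa>"
      unfolding mgf_def by (subst nn_integral_distr) auto
    finally show "(\<integral>\<^sup>+\<omega>. ennreal (exp (v * approx n \<omega>)) \<partial>M) \<le> ennreal (exp \<kappa>) * mgf (distr M borel T) \<kappa>" .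
  qed
  also have "\<dots> = ennreal (exp \<kappa>) * mgf (distr M borel T) \<kappa>"
    by (simp add: Liminf_const)
  also have "\<dots> < \<infinity>"
    using fin by (simp add: ennreal_mult_less_top)
  finally show ?thesis .
qed

lemma tail_upper:
  assumes v: "0 < v" "mgf (law 1) v < \<infinity>" and \<kappa>: "K v \<le> \<kappa>" "0 \<le> \<kappa>" and fin: "mgf (distr M borel T) \<kappa> < \<infinity>"
  obtains C where "\<And>x. 1 - cdf (law_at_random_time M L T) x \<le> C * exp (- v * x)"
proof -
  have fin': "(\<integral>\<^sup>+\<omega>. ennreal (exp (v * limit \<omega>)) \<partial>M) < \<infinity>"
    by (rule mgf_limit_finite[OF v(2) \<kappa> fin])
  have int: "integrable M (\<lambda>\<omega>. exp (v * limit \<omega>))"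
    using fin' by (intro integrableI_nonneg) auto
  show ?thesis
  proof (rule that)
    fix x
    have "prob {\<omega> \<in> space M. x < limit \<omega>} = (\<integral>\<omega>. indicator {\<omega> \<in> space M. x < limit \<omega>} \<omega> \<partial>M)"
      by simp
    also have "\<dots> \<le> (\<integral>\<omega>. exp (v * limit \<omega>) * exp (- v * x) \<partial>M)"
    proof (rule integral_mono)
      show "integrable M (\<lambda>\<omega>. indicator {\<omega> \<in> space M. x < limit \<omega>} \<omega> :: real)"
        by (intro integrable_real_indicator) (auto simp: emeasure_eq_measure)
      show "integrable M (\<lambda>\<omega>. exp (v * limit \<omega>) * exp (- v * x))"
        using int by simp
      fix \<omega>
      have "0 \<le> v * limit \<omega> + - v * x" if "x < limit \<omega>"
        using v that by simp
      then have "1 \<le> exp (v * limit \<omega> + - v * x)" if "x < limit \<omega>"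
        using that by (simp only: one_le_exp_iff)
      then show "indicator {\<omega> \<in> space M. x < limit \<omega>} \<omega> \<le> exp (v * limit \<omega>) * exp (- v * x)"
        unfolding exp_add by (auto simp: indicator_def)
    qed
    also have "\<dots> = (\<integral>\<omega>. exp (v * limit \<omega>) \<partial>M) * exp (- v * x)"
      by simp
    finally show "1 - cdf (law_at_random_time M L T) x \<le> (\<integral>\<omega>. exp (v * limit \<omega>) \<partial>M) * exp (- v * x)"
      by (simp add: tail_eq)
  qed
qed

text \<open>Times up to b + 1 are included because a grid point may exceed T by 1. Fatou is applied
  to the complementary events: a limit \<le> x < y forces the approximations below y eventually, so
  an upper bound on their probabilities survives the limit.\<close>

lemma tail_lower:
  assumes a: "0 \<le> a" and xy: "x < y" and c: "0 \<le> c"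
    and lower: "\<And>u. a \<le> u \<Longrightarrow> u \<le> b + 1 \<Longrightarrow> c \<le> measure (law u) {y<..}"
  shows "c * measure (distr M borel T) {a..b} \<le> 1 - cdf (law_at_random_time M L T) x"
proof -
  define A where "A = {\<omega> \<in> space M. a \<le> T \<omega> \<and> T \<omega> \<le> b}"
  have [measurable]: "A \<in> sets M" unfolding A_def by measurable
  have up: "prob {\<omega> \<in> space M. approx n \<omega> \<le> y} \<le> 1 - c * prob A" for n
  proof -
    have [measurable]: "(\<lambda>\<omega>. emeasure (law (grid n (pos_T \<omega>))) {y<..}) \<in> borel_measurable M"
      unfolding grid_pos_T
      by (rule measurable_compose[OF index_measurable, where g = "\<lambda>j. emeasure (law (node n j)) {y<..}"]) simp
    have "ennreal (c * prob A) = (\<integral>\<^sup>+\<omega>. ennreal c * indicator A \<omega> \<partial>M)"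
      using c by (subst nn_integral_cmult) (auto simp: emeasure_eq_measure ennreal_mult)
    also have "\<dots> \<le> (\<integral>\<^sup>+\<omega>. emeasure (law (grid n (pos_T \<omega>))) {y<..} \<partial>M)"
    proof (rule nn_integral_mono)
      fix \<omega> assume "\<omega> \<in> space M"
      show "ennreal c * indicator A \<omega> \<le> emeasure (law (grid n (pos_T \<omega>))) {y<..}"
      proof (cases "\<omega> \<in> A")
        case True
        then have T: "a \<le> T \<omega>" "T \<omega> \<le> b" "0 \<le> T \<omega>" using a by (auto simp: A_def)
        then have p: "pos_T \<omega> = T \<omega>" by (simp add: pos_T_def)
        have g: "a \<le> grid n (T \<omega>)" "grid n (T \<omega>) \<le> b + 1" "0 \<le> grid n (T \<omega>)"
          using grid_bounds[OF T(3), of n] T by auto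
        interpret G: prob_space "law (grid n (T \<omega>))" by (rule prob_space_law[OF g(3)])
        show ?thesis
          using lower[OF g(1,2)] True by (simp add: p G.emeasure_eq_measure ennreal_leI)
      qed simp
    qed
    also have "\<dots> = (\<integral>\<^sup>+\<omega>. (\<integral>\<^sup>+x. indicator {y<..} x \<partial>law (grid n (pos_T \<omega>))) \<partial>M)"
      by simp
    also have "\<dots> = (\<integral>\<^sup>+\<omega>. indicator {y<..} (approx n \<omega>) \<partial>M)"
      by (rule nn_integral_approx[symmetric]) measurable
    also have "\<dots> = (\<integral>\<^sup>+\<omega>. indicator {\<omega> \<in> space M. y < approx n \<omega>} \<omega> \<partial>M)"
      by (intro nn_integral_cong) (auto simp: indicator_def)
    also have "\<dots> = ennreal (prob {\<omega> \<in> space M. y < approx n \<omega>})"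
      by (simp add: emeasure_eq_measure)
    finally have "c * prob A \<le> prob {\<omega> \<in> space M. y < approx n \<omega>}"
      by (simp add: ennreal_le_iff)
    also have "{\<omega> \<in> space M. y < approx n \<omega>} = space M - {\<omega> \<in> space M. approx n \<omega> \<le> y}"
      by auto
    also have "prob \<dots> = 1 - prob {\<omega> \<in> space M. approx n \<omega> \<le> y}"
      by (rule prob_compl) measurable
    finally show ?thesis by simp
  qed
  have "ennreal (prob {\<omega> \<in> space M. limit \<omega> \<le> x}) = (\<integral>\<^sup>+\<omega>. indicator {\<omega> \<in> space M. limit \<omega> \<le> x} \<omega> \<partial>M)"
    by (simp add: emeasure_eq_measure)
  also have "\<dots> \<le> (\<integral>\<^sup>+\<omega>. liminf (\<lambda>n. indicator {\<omega> \<in> space M. approx n \<omega> \<le> y} \<omega>) \<partial>M)"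
  proof (rule nn_integral_mono_AE)
    show "AE \<omega> in M. indicator {\<omega> \<in> space M. limit \<omega> \<le> x} \<omega> \<le> liminf (\<lambda>n. indicator {\<omega> \<in> space M. approx n \<omega> \<le> y} \<omega> :: ennreal)"
      using approx_tendsto_limit
    proof eventually_elim
      case (elim \<omega>)
      show ?case
      proof (cases "\<omega> \<in> space M \<and> limit \<omega> \<le> x")
        case True
        then have "limit \<omega> < y" using xy by simp
        with elim have "\<forall>\<^sub>F n in sequentially. approx n \<omega> < y"
          by (rule order_tendstoD)
        then have "\<forall>\<^sub>F n in sequentially. 1 \<le> (indicator {\<omega> \<in> space M. approx n \<omega> \<le> y} \<omega> :: ennreal)"
          by eventually_elim (use True in auto)
        then have "1 \<le> liminf (\<lambda>n. indicator {\<omega> \<in> space M. approx n \<omega> \<le> y} \<omega> :: ennreal)"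
          by (rule Liminf_bounded)
        then show ?thesis using True by simp
      qed auto
    qed
  qed
  also have "\<dots> \<le> liminf (\<lambda>n. \<integral>\<^sup>+\<omega>. indicator {\<omega> \<in> space M. approx n \<omega> \<le> y} \<omega> \<partial>M)"
    by (rule nn_integral_liminf) measurable
  also have "\<dots> = liminf (\<lambda>n. ennreal (prob {\<omega> \<in> space M. approx n \<omega> \<le> y}))"
    by (simp add: emeasure_eq_measure)
  also have "\<dots> \<le> liminf (\<lambda>n. ennreal (1 - c * prob A))"
    using up by (intro Liminf_mono always_eventually allI ennreal_leI)
  also have "\<dots> = ennreal (1 - c * prob A)"
    by (simp add: Liminf_const)
  finally have "ennreal (prob {\<omega> \<in> space M. limit \<omega> \<le> x}) \<le> ennreal (1 - c * prob A)" .
  moreover have "0 \<le> 1 - c * prob A"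
    using up[of 0] measure_nonneg[of M] by (meson order_trans)
  ultimately have "prob {\<omega> \<in> space M. limit \<omega> \<le> x} \<le> 1 - c * prob A"
    by (simp add: ennreal_le_iff)
  moreover have "prob {\<omega> \<in> space M. limit \<omega> \<le> x} = 1 - prob {\<omega> \<in> space M. x < limit \<omega>}"
  proof -
    have "{\<omega> \<in> space M. limit \<omega> \<le> x} = space M - {\<omega> \<in> space M. x < limit \<omega>}" by auto
    then show ?thesis by (simp add: prob_compl)
  qed
  moreover have "measure (distr M borel T) {a..b} = prob A"
    unfolding A_def by (subst measure_distr) (auto intro!: arg_cong[where f = prob])
  ultimately show ?thesis by (simp add: tail_eq)
qed

end

section \<open>Tail bounds\<close>

lemma eventually_exp_absorb:
  fixes q q' C :: real
  assumes "0 < C" "q' < q"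
  shows "\<forall>\<^sub>F x in at_top. exp (- q * x) \<le> C * exp (- q' * x)"
proof -
  have "\<forall>\<^sub>F x in at_top. - ln C / (q - q') \<le> x" by (rule eventually_ge_at_top)
  then show ?thesis
  proof eventually_elim
    case (elim x)
    then have "- ln C \<le> x * (q - q')" using assms by (subst (asm) pos_divide_le_eq) auto
    then have "- q * x \<le> ln C + - q' * x" by (simp add: algebra_simps)
    then have "exp (- q * x) \<le> exp (ln C + - q' * x)" by (simp only: exp_le_cancel_iff)
    also have "\<dots> = C * exp (- q' * x)" unfolding exp_add using assms by simp
    finally show ?case .
  qed
qed

lemma log_tail_asymp_equiv:
  fixes G :: "real \<Rightarrow> real"
  assumes p: "0 < p"
    and upper: "\<And>v. 0 < v \<Longrightarrow> v < p \<Longrightarrow> \<exists>C. \<forall>x. G x \<le> C * exp (- v * x)"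
    and lower: "\<And>q. p < q \<Longrightarrow> \<forall>\<^sub>F x in at_top. exp (- q * x) \<le> G x"
  shows "(\<lambda>x. ln (G x)) \<sim>[at_top] (\<lambda>x. - p * x)"
proof (rule asymp_equivI', rule order_tendstoI)
  have Gpos: "\<forall>\<^sub>F x in at_top. 0 < G x"
    using lower[OF less_add_one] by eventually_elim (auto intro: less_le_trans[OF exp_gt_zero])
  have xpos: "\<forall>\<^sub>F x in at_top. (0::real) < x" by (rule eventually_gt_at_top)
  {
    fix a :: real assume a: "a < 1"
    \<comment> \<open>Two rates v' < v are placed between a p and p: the gap between them absorbs
      the constant C. The maximum keeps both positive when a \<le> 0.\<close>
    have "max 0 (a * p) < p" using a p by simp
    then obtain v' where v': "max 0 (a * p) < v'" "v' < p" using dense by blast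
    then obtain v where v: "v' < v" "v < p" using dense by blast
    have "0 < v" using v v' by simp
    then obtain C where C: "\<And>x. G x \<le> C * exp (- v * x)" using upper[of v] v by blast
    have "G x \<le> \<bar>C\<bar> * exp (- v * x)" for x
      using C[of x] by (smt (verit) exp_gt_zero mult_right_mono)
    then have C': "G x \<le> (\<bar>C\<bar> + 1) * exp (- v * x)" for x
      by (smt (verit) exp_gt_zero mult_right_mono)
    have "\<forall>\<^sub>F x in at_top. exp (- v * x) \<le> (1 / (\<bar>C\<bar> + 1)) * exp (- v' * x)"
      using v by (intro eventually_exp_absorb) auto
    then show "\<forall>\<^sub>F x in at_top. a < ln (G x) / (- p * x)"
      using Gpos xpos
    proof eventually_elim
      case (elim x)
      have "G x \<le> (\<bar>C\<bar> + 1) * ((1 / (\<bar>C\<bar> + 1)) * exp (- v' * x))"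
        using C'[of x] elim(1) by (smt (verit) mult_left_mono)
      then have "G x \<le> exp (- v' * x)" by simp
      then have "ln (G x) \<le> ln (exp (- v' * x))" using elim by (subst ln_le_cancel_iff) auto
      then have "ln (G x) \<le> - v' * x" by simp
      also have "\<dots> < - (a * p) * x" using v' elim by simp
      finally show ?case using p elim by (simp add: field_simps)
    qed
  next
    fix a :: real assume a: "1 < a"
    have "p < a * p" using a p by simp
    then obtain q where q: "p < q" "q < a * p" using dense by blast
    show "\<forall>\<^sub>F x in at_top. ln (G x) / (- p * x) < a"
      using lower[OF q(1)] Gpos xpos
    proof eventually_elim
      case (elim x)
      have "- (a * p) * x < - q * x" using q elim by simp
      also have "\<dots> = ln (exp (- q * x))" by simp
      also have "\<dots> \<le> ln (G x)" using elim by (subst ln_le_cancel_iff) auto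
      finally show ?case using p elim by (simp add: field_simps)
    qed
  }
qed

lemma mgf_finite_below:
  assumes "prob_space \<mu>" and [measurable_cong]: "sets \<mu> = sets borel"
    and v: "0 \<le> v" "ereal v < critical_exponent \<mu>"
  shows "mgf \<mu> v < \<infinity>"
proof -
  interpret prob_space \<mu> by fact
  obtain s where s: "mgf \<mu> s < \<infinity>" "v < s"
    using v(2) unfolding critical_exponent_def less_Sup_iff by auto
  have "mgf \<mu> v \<le> (\<integral>\<^sup>+x. 1 + ennreal (exp (s * x)) \<partial>\<mu>)"
    unfolding mgf_def
  proof (rule nn_integral_mono)
    fix x
    have "exp (v * x) \<le> 1 + exp (s * x)"
    proof (cases "0 \<le> x")
      case True
      then have "v * x \<le> s * x" using s by (intro mult_right_mono) auto
      then have "exp (v * x) \<le> exp (s * x)" by simp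
      then show ?thesis by linarith
    next
      case False
      then have "v * x \<le> 0" using v by (intro mult_nonneg_nonpos) auto
      then have "exp (v * x) \<le> 1" by simp
      then show ?thesis using exp_gt_zero[of "s * x"] by linarith
    qed
    then show "ennreal (exp (v * x)) \<le> 1 + ennreal (exp (s * x))"
      by (metis ennreal_1 ennreal_leI ennreal_plus exp_ge_zero zero_le_one)
  qed
  also have "\<dots> = 1 + mgf \<mu> s"
    unfolding mgf_def by (subst nn_integral_add) (auto simp: emeasure_space_1)
  also have "\<dots> < \<infinity>" using s(1) by (simp add: ennreal_add_less_top)
  finally show ?thesis .
qed

lemma exp_moments_below:
  assumes "prob_space \<mu>" "sets \<mu> = sets borel" and r: "0 < r" "ereal r \<le> critical_exponent \<mu>"
  shows "exp_moments \<mu> r"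
proof -
  interpret prob_space \<mu> by fact
  show ?thesis
  proof
    fix v assume v: "0 \<le> v" "v < r"
    have "ereal v < critical_exponent \<mu>"
      using v(2) r(2) by (metis less_ereal.simps(1) less_le_trans)
    then have "mgf \<mu> v < \<infinity>" by (intro mgf_finite_below assms v)
    then show "integrable \<mu> (\<lambda>x. exp (v * x))"
      unfolding mgf_def using assms(2) by (intro integrableI_nonneg) auto
  qed (use assms in auto)
qed

lemma criterion_window_tail:
  assumes \<mu>: "prob_space \<mu>" "sets \<mu> = sets borel" and crit: "criterion_I \<mu> \<or> criterion_II \<mu>"
  obtains r where "0 < r" "critical_exponent \<mu> = ereal r" "window_tail \<mu> r"
  using crit
proof
  assume "criterion_I \<mu>"
  then obtain r n \<rho> l where r: "0 < r" "critical_exponent \<mu> = ereal r" and \<rho>: "0 < \<rho>" and l: "slowly_varying l"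
    and G: "(\<lambda>s. (deriv ^^ n) (\<lambda>v. enn2real (mgf \<mu> v)) (r - s)) \<sim>[at_right 0] (\<lambda>s. s powr (- \<rho>) * l (1 / s))"
    unfolding criterion_I_def by blast
  interpret exp_moments \<mu> r
    using r by (intro exp_moments_below \<mu>) auto
  show ?thesis
    using that[OF r] regvar_window_tail[OF criterion_I_regvar[OF l \<rho> G] \<rho>] by blast
next
  assume "criterion_II \<mu>"
  then obtain r \<rho> l where r: "0 < r" "critical_exponent \<mu> = ereal r" and \<rho>: "0 < \<rho>" and l: "slowly_varying l"
    and G: "(\<lambda>s. ln (enn2real (mgf \<mu> (r - s)))) \<sim>[at_right 0] (\<lambda>s. s powr (- \<rho>) * l (1 / s))"
    unfolding criterion_II_def by blast
  interpret exp_moments \<mu> r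
    using r by (intro exp_moments_below \<mu>) auto
  show ?thesis
    using that[OF r] log_regvar_window_tail[OF criterion_II_regvar(1)[OF l \<rho> G] \<rho> criterion_II_regvar(2)[OF l \<rho> G]] by blast
qed

lemma window_tail_lower:
  assumes "prob_space \<mu>" "sets \<mu> = sets borel" and tail: "window_tail \<mu> r" and q: "r < q"
  shows "\<forall>\<^sub>F x in at_top. exp (- q * x) \<le> measure \<mu> {x<..}"
proof -
  interpret prob_space \<mu> by fact
  have "((\<lambda>\<delta>. r * (1 + 2 * \<delta>) / (1 - \<delta>)) \<longlongrightarrow> r * (1 + 2 * 0) / (1 - 0)) (at_right 0)"
    by (intro tendsto_intros) auto
  then have "\<forall>\<^sub>F \<delta> in at_right 0. r * (1 + 2 * \<delta>) / (1 - \<delta>) < q"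
    using q by (intro order_tendstoD) auto
  moreover have "\<forall>\<^sub>F \<delta> in at_right 0. \<delta> \<in> {0<..<1::real}"
    by (rule eventually_at_right_real) simp
  ultimately have "\<forall>\<^sub>F \<delta> in at_right 0. r * (1 + 2 * \<delta>) / (1 - \<delta>) < q \<and> \<delta> \<in> {0<..<1::real}"
    by (rule eventually_conj)
  then have "\<exists>\<delta>. r * (1 + 2 * \<delta>) / (1 - \<delta>) < q \<and> \<delta> \<in> {0<..<1::real}"
    by (rule eventually_happens'[OF trivial_limit_at_right_real])
  then obtain \<delta> where \<delta>: "r * (1 + 2 * \<delta>) / (1 - \<delta>) < q" "0 < \<delta>" "\<delta> < 1"
    by auto
  define q' where "q' = r * (1 + 2 * \<delta>) / (1 - \<delta>)"
  \<comment> \<open>With y = (1 + x) / (1 - \<delta>) the window starts at x + 1, strictly beyond x,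
    and its cost has rate q' in x.\<close>
  have lim: "filterlim (\<lambda>x. (1 / (1 - \<delta>)) * (1 + x)) at_top at_top"
    using \<delta> by (intro filterlim_tendsto_pos_mult_at_top[OF tendsto_const]
        filterlim_tendsto_add_at_top[OF tendsto_const filterlim_ident]) auto
  have "\<forall>\<^sub>F y in at_top. exp (- (r * (1 + 2 * \<delta>) * y)) \<le> measure \<mu> {(1 - \<delta>) * y..(1 + \<delta>) * y}"
    using tail \<delta> unfolding window_tail_def by blast
  note ev = eventually_compose_filterlim[OF this lim]
  have "\<forall>\<^sub>F x in at_top. exp (- q * x) \<le> exp (- q') * exp (- q' * x)"
    using \<delta> by (intro eventually_exp_absorb) (auto simp: q'_def)
  with ev show ?thesis
  proof eventually_elim
    case (elim x)
    define y where "y = (1 / (1 - \<delta>)) * (1 + x)"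
    have y: "(1 - \<delta>) * y = 1 + x" using \<delta> by (simp add: y_def)
    have "- (r * (1 + 2 * \<delta>) * y) = - q' + - q' * x"
      using \<delta> by (simp add: y_def q'_def divide_inverse algebra_simps)
    then have "exp (- q * x) \<le> exp (- (r * (1 + 2 * \<delta>) * y))"
      using elim(2) by (simp only: exp_add)
    also have "\<dots> \<le> measure \<mu> {(1 - \<delta>) * y..(1 + \<delta>) * y}"
      using elim(1) unfolding y_def .
    also have "\<dots> \<le> measure \<mu> {x<..}"
      using assms(2) unfolding y by (intro finite_measure_mono) auto
    finally show ?case .
  qed
qed

section \<open>Convexity, dyadic descent and tilting for the Levy process\<close>

context levy
begin

lemma mgf_0: "mgf (law 1) 0 = 1"
proof -
  interpret P: prob_space "law 1" by (rule prob_space_law) simp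
  show ?thesis using P.emeasure_space_1 by (simp add: mgf_def)
qed

text \<open>Convexity of K on [0, p] together with K 0 = 0. It follows by integrating the convexity
  of exp between 0 and p x - K p, where subtracting K p normalises the integral at rate p to
  1.\<close>

lemma K_le:
  assumes v: "0 < v" "v < p" and fin: "mgf (law 1) p < \<infinity>" "mgf (law 1) v < \<infinity>"
  shows "K v \<le> v / p * K p"
proof -
  interpret P: prob_space "law 1" by (rule prob_space_law) simp
  define \<alpha> where "\<alpha> = v / p"
  have \<alpha>: "0 < \<alpha>" "\<alpha> < 1" using v by (auto simp: \<alpha>_def)
  have m: "has_bochner_integral (law 1) (\<lambda>x. exp (z * x)) (exp (K z))" if "mgf (law 1) z < \<infinity>" for z
    using mgf_law_1[OF that] unfolding mgf_def by (intro has_bochner_integral_nn_integral) auto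
  have mv: "has_bochner_integral (law 1) (\<lambda>x. exp (- (\<alpha> * K p)) * exp (v * x)) (exp (- (\<alpha> * K p)) * exp (K v))"
    by (intro has_bochner_integral_mult_right m fin)
  have mp: "has_bochner_integral (law 1) (\<lambda>x. (1 - \<alpha>) + (\<alpha> * exp (- K p)) * exp (p * x))
      (measure (law 1) (space (law 1)) * (1 - \<alpha>) + (\<alpha> * exp (- K p)) * exp (K p))"
    using has_bochner_integral_integrable[OF P.integrable_const[of "1 - \<alpha>"]]
    by (intro has_bochner_integral_add has_bochner_integral_mult_right m fin) (simp add: P.prob_space)
  have "exp (- (\<alpha> * K p)) * exp (K v) \<le> measure (law 1) (space (law 1)) * (1 - \<alpha>) + (\<alpha> * exp (- K p)) * exp (K p)"
    using mv mp unfolding has_bochner_integral_iff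
  proof (elim conjE, elim subst, intro integral_mono)
    fix x
    have "exp ((1 - \<alpha>) *\<^sub>R 0 + \<alpha> *\<^sub>R (p * x - K p)) \<le> (1 - \<alpha>) * exp 0 + \<alpha> * exp (p * x - K p)"
      using \<alpha> by (intro convex_onD[OF exp_convex]) auto
    moreover have "\<alpha> * (p * x - K p) = - (\<alpha> * K p) + v * x"
      using v by (simp add: \<alpha>_def algebra_simps)
    ultimately show "exp (- (\<alpha> * K p)) * exp (v * x) \<le> (1 - \<alpha>) + (\<alpha> * exp (- K p)) * exp (p * x)"
      by (simp add: exp_diff exp_minus divide_inverse mult_ac flip: exp_add)
  qed
  also have "\<dots> = 1" by (simp add: P.prob_space[simplified] exp_minus)
  finally have "exp (- (\<alpha> * K p) + K v) \<le> 1" by (simp only: exp_add)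
  then show ?thesis unfolding exp_le_one_iff by (simp add: \<alpha>_def)
qed

text \<open>Finiteness at r bounds \<open>hmom 0\<close>, which contradicts the divergence under
  Criterion II; this leaves Criterion I, whose regular variation descends by repeated halving of the
  time.\<close>

lemma criterion_dyadic_window_tail:
  assumes crit: "criterion_I (law 1) \<or> criterion_II (law 1)" and r: "critical_exponent (law 1) = ereal r"
    and fin: "mgf (law 1) r < \<infinity>"
  shows "0 < r" and "window_tail (law (1 / 2 ^ j)) r"
proof -
  have P1: "prob_space (law 1)" by (rule prob_space_law) simp
  show r0: "0 < r"
    using criterion_window_tail[OF P1 sets_law crit] r by (metis ereal.inject)
  have below: "mgf (law 1) v < \<infinity>" if "0 \<le> v" "v < r" for v
    using that r by (intro mgf_finite_below P1) auto
  have em: "exp_moments (law t) r" if "0 \<le> t" for t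
    by (rule exp_moments_law[OF below r0 that])
  have intr: "integrable (law t) (\<lambda>x. exp (r * x))" if t: "0 \<le> t" for t
    using mgf_law[OF fin t] unfolding mgf_def by (intro integrableI_nonneg) auto
  interpret E1: exp_moments "law 1" r by (rule em) simp
  have "\<not> filterlim (E1.hmom 0) at_top (at_right 0)"
  proof
    assume lim: "filterlim (E1.hmom 0) at_top (at_right 0)"
    define C where "C = (\<integral>x. exp (r * x) \<partial>law 1)"
    have "\<forall>\<^sub>F s in at_right 0. C < E1.hmom 0 s"
      using lim unfolding filterlim_at_top_dense by blast
    moreover have "\<forall>\<^sub>F s in at_right 0. s \<in> {0<..<r}"
      using r0 by (rule eventually_at_right_real)
    ultimately have "\<forall>\<^sub>F s in at_right 0. C < E1.hmom 0 s \<and> s \<in> {0<..<r}"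
      by (rule eventually_conj)
    then have "\<exists>s. C < E1.hmom 0 s \<and> s \<in> {0<..<r}"
      by (rule eventually_happens'[OF trivial_limit_at_right_real])
    then obtain s where s: "C < E1.hmom 0 s" "0 < s" "s < r" by auto
    have "E1.hmom 0 s \<le> C"
      unfolding E1.hmom_def E1.mom_def C_def
    proof (rule integral_mono)
      show "integrable (law 1) (\<lambda>x. indicator {0<..} x * (x ^ 0 * exp ((r - s) * x)))"
        using s by (intro E1.integrable_moment) auto
      fix x
      show "indicator {0<..} x * (x ^ 0 * exp ((r - s) * x)) \<le> exp (r * x)"
        using s by (auto simp: indicator_def)
    qed (use intr[of 1] in simp)
    then show False using s by simp
  qed
  then have "\<not> criterion_II (law 1)"
    using E1.criterion_II_regvar(2) r unfolding criterion_II_def by fastforce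
  with crit obtain n \<rho> l where \<rho>: "0 < \<rho>" and l: "slowly_varying l"
    and G: "(\<lambda>s. (deriv ^^ n) (\<lambda>v. enn2real (mgf (law 1) v)) (r - s)) \<sim>[at_right 0] (\<lambda>s. s powr (- \<rho>) * l (1 / s))"
    unfolding criterion_I_def using r by auto
  \<comment> \<open>Order \<open>Suc n\<close> instead of n guarantees the positive order that
    \<open>convolution_square_regvar\<close> demands. Order and index are the same at every dyadic
    level.\<close>
  have reg: "regvar0 (\<rho> + 1) (exp_moments.hmom (law (1 / 2 ^ j)) r (Suc n))" for j
  proof (induction j)
    case 0
    show ?case
      using E1.hmom_regvar_Suc[OF E1.criterion_I_regvar[OF l \<rho> G] \<rho>] by simp
  next
    case (Suc j)
    define h :: real where "h = 1 / 2 ^ Suc j"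
    have h: "0 < h" "h + h = 1 / 2 ^ j" by (auto simp: h_def)
    have eq: "law (1 / 2 ^ j) = (law h \<star> law h)"
      using law_add[OF h(1) h(1)] h(2) by simp
    interpret H: exp_moments "law h" r using h by (intro em) simp
    have "regvar0 (\<rho> + 1) (H.hmom (Suc n))"
    proof (rule H.convolution_square_regvar)
      show "exp_moments (law h \<star> law h) r"
        unfolding eq[symmetric] by (intro em) simp
      show "regvar0 (\<rho> + 1) (exp_moments.hmom (law h \<star> law h) r (Suc n))"
        unfolding eq[symmetric] by (rule Suc)
    qed (use intr h in auto)
    then show ?case by (simp add: h_def)
  qed
  interpret J: exp_moments "law (1 / 2 ^ j)" r by (intro em) simp
  show "window_tail (law (1 / 2 ^ j)) r"
    using J.regvar_window_tail[OF reg] \<rho> by simp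
qed

text \<open>The lower bound in Cramer's theorem at the slope \<open>D = K' p\<close>: tilting by \<open>p\<close> moves the mean of
  \<open>L u\<close> to \<open>u * D\<close>.\<close>

lemma cramer_lower:
  assumes p: "0 < p" "p < R" and fin: "\<And>v. 0 < v \<Longrightarrow> v < R \<Longrightarrow> mgf (law 1) v < \<infinity>"
    and D: "(K has_real_derivative D) (at p)" and \<gamma>: "0 < \<gamma>"
  obtains u0 where "0 \<le> u0" "\<And>u. u0 \<le> u \<Longrightarrow> exp (u * (K p - p * (D + \<gamma>))) / 2 \<le> measure (law u) {u * (D - \<gamma>)..}"
proof -
  have slope: "((\<lambda>z. (K z - K p) / (z - p)) \<longlongrightarrow> D) (at p)"
    using D by (simp add: has_field_derivative_iff)
  have f1: "filterlim (\<lambda>\<theta>::real. p + \<theta>) (at p) (at_right 0)" "filterlim (\<lambda>\<theta>::real. p - \<theta>) (at p) (at_right 0)"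
    by (auto intro!: filterlim_atI tendsto_eq_intros simp: eventually_at_filter)
  \<comment> \<open>Half of \<gamma> is spent on the error of the linearisation; the other half
    leaves the decay exp (- u \<theta> \<gamma> / 2) for both tails of the tilted law.\<close>
  have "\<forall>\<^sub>F \<theta> in at_right 0. (K (p + \<theta>) - K p) / (p + \<theta> - p) < D + \<gamma> / 2"
    using \<gamma> by (intro order_tendstoD(2)[OF filterlim_compose[OF slope f1(1)]]) simp
  moreover have "\<forall>\<^sub>F \<theta> in at_right 0. D - \<gamma> / 2 < (K (p - \<theta>) - K p) / (p - \<theta> - p)"
    using \<gamma> by (intro order_tendstoD(1)[OF filterlim_compose[OF slope f1(2)]]) simp
  moreover have "\<forall>\<^sub>F \<theta> in at_right 0. \<theta> \<in> {0<..<min p (R - p)}"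
    using p by (intro eventually_at_right_real) auto
  ultimately have "\<forall>\<^sub>F \<theta> in at_right 0. 0 < \<theta> \<and> \<theta> < p \<and> p + \<theta> < R \<and>
      K (p + \<theta>) \<le> K p + \<theta> * (D + \<gamma> / 2) \<and> K (p - \<theta>) \<le> K p - \<theta> * (D - \<gamma> / 2)"
  proof eventually_elim
    case (elim \<theta>)
    then have \<theta>: "0 < \<theta>" "\<theta> < p" "p + \<theta> < R" by auto
    moreover have "K (p + \<theta>) - K p < (D + \<gamma> / 2) * \<theta>"
      using elim(1) \<theta> by (simp add: pos_divide_less_eq)
    moreover have "(D - \<gamma> / 2) * \<theta> < K p - K (p - \<theta>)"
      using elim(2) \<theta> by (simp add: minus_divide_left[symmetric] minus_divide_right[symmetric] field_simps)
    ultimately show ?case by (simp add: algebra_simps)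
  qed
  then have "\<exists>\<theta>. 0 < \<theta> \<and> \<theta> < p \<and> p + \<theta> < R \<and>
      K (p + \<theta>) \<le> K p + \<theta> * (D + \<gamma> / 2) \<and> K (p - \<theta>) \<le> K p - \<theta> * (D - \<gamma> / 2)"
    by (rule eventually_happens'[OF trivial_limit_at_right_real])
  then obtain \<theta> where \<theta>: "0 < \<theta>" "\<theta> < p" "p + \<theta> < R"
    and up: "K (p + \<theta>) \<le> K p + \<theta> * (D + \<gamma> / 2)" and low: "K (p - \<theta>) \<le> K p - \<theta> * (D - \<gamma> / 2)"
    by blast
  \<comment> \<open>From this time on exp (- u \<theta> \<gamma> / 2) \<le> 1 / 4, so that the two
    tails take at most half of the tilted mass.\<close>
  define u0 where "u0 = 2 * ln 4 / (\<theta> * \<gamma>)"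
  show ?thesis
  proof (rule that[of u0])
    show "0 \<le> u0" using \<theta> \<gamma> by (simp add: u0_def)
    fix u assume u: "u0 \<le> u"
    with \<open>0 \<le> u0\<close> have u0: "0 \<le> u" by simp
    interpret U: prob_space "law u" by (rule prob_space_law[OF u0])
    have small: "exp (- (u * (\<theta> * \<gamma> / 2))) \<le> 1 / 4"
    proof -
      have "ln 4 \<le> u * (\<theta> * \<gamma> / 2)"
        using u \<theta> \<gamma> unfolding u0_def by (simp add: field_simps)
      then have "exp (- (u * (\<theta> * \<gamma> / 2))) \<le> exp (- ln 4)" by simp
      also have "exp (- ln 4) = 1 / (4::real)" by (simp add: exp_minus)
      finally show ?thesis .
    qed
    let ?W = "{u * (D - \<gamma>)..}"
    let ?A = "exp (p * (u * (D + \<gamma>)))"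
    let ?B = "exp (- (\<theta> * (u * (D + \<gamma>))))"
    let ?C = "exp (\<theta> * (u * (D - \<gamma>)))"
    have m: "has_bochner_integral (law u) (\<lambda>x. exp (z * x)) (exp (u * K z))" if "0 < z" "z < R" for z
      using mgf_law[OF fin[OF that] u0] unfolding mgf_def by (intro has_bochner_integral_nn_integral) auto
    have i: "has_bochner_integral (law u) (\<lambda>x. indicator ?W x) (measure (law u) ?W)"
      by (intro has_bochner_integral_real_indicator) (auto simp: U.emeasure_eq_measure)
    have mp: "has_bochner_integral (law u) (\<lambda>x. exp (p * x)) (exp (u * K p))"
      using p by (intro m) auto
    have int: "has_bochner_integral (law u)
        (\<lambda>x. ?A * indicator ?W x + (?B * exp ((p + \<theta>) * x) + ?C * exp ((p - \<theta>) * x)))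
        (?A * measure (law u) ?W + (?B * exp (u * K (p + \<theta>)) + ?C * exp (u * K (p - \<theta>))))"
      using \<theta> p by (intro has_bochner_integral_add has_bochner_integral_mult_right i m) auto
    have "exp (u * K p) \<le> ?A * measure (law u) ?W + (?B * exp (u * K (p + \<theta>)) + ?C * exp (u * K (p - \<theta>)))"
      using mp int unfolding has_bochner_integral_iff
    proof (elim conjE, elim subst, intro integral_mono)
      fix x
      have nn: "0 \<le> ?A * indicator ?W x" "0 \<le> ?B * exp ((p + \<theta>) * x)" "0 \<le> ?C * exp ((p - \<theta>) * x)"
        by (auto simp: indicator_def)
      consider "x < u * (D - \<gamma>)" | "u * (D + \<gamma>) < x" | "x \<in> ?W" "x \<le> u * (D + \<gamma>)" by fastforce
      then show "exp (p * x) \<le> ?A * indicator ?W x + (?B * exp ((p + \<theta>) * x) + ?C * exp ((p - \<theta>) * x))"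
      proof cases
        case 1
        then have "\<theta> * x \<le> \<theta> * (u * (D - \<gamma>))" using \<theta> by (intro mult_left_mono) auto
        then have "p * x \<le> \<theta> * (u * (D - \<gamma>)) + (p - \<theta>) * x" by (simp add: left_diff_distrib)
        then have "exp (p * x) \<le> ?C * exp ((p - \<theta>) * x)" by (simp only: exp_le_cancel_iff flip: exp_add)
        then show ?thesis using nn by linarith
      next
        case 2
        then have "\<theta> * (u * (D + \<gamma>)) \<le> \<theta> * x" using \<theta> by (intro mult_left_mono) auto
        then have "p * x \<le> - (\<theta> * (u * (D + \<gamma>))) + (p + \<theta>) * x" by (simp add: distrib_right)
        then have "exp (p * x) \<le> ?B * exp ((p + \<theta>) * x)" by (simp only: exp_le_cancel_iff flip: exp_add)
        then show ?thesis using nn by linarith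
      next
        case 3
        then have "p * x \<le> p * (u * (D + \<gamma>))" using p by (intro mult_left_mono) auto
        then have "exp (p * x) \<le> ?A * indicator ?W x" using 3 by simp
        then show ?thesis using nn by linarith
      qed
    qed
    moreover have "?B * exp (u * K (p + \<theta>)) \<le> exp (u * K p) * (1 / 4)"
    proof -
      have "u * K (p + \<theta>) \<le> u * (K p + \<theta> * (D + \<gamma> / 2))" using up u0 by (rule mult_left_mono)
      then have "- (\<theta> * (u * (D + \<gamma>))) + u * K (p + \<theta>) \<le> u * K p + - (u * (\<theta> * \<gamma> / 2))"
        by (simp add: algebra_simps)
      then have "?B * exp (u * K (p + \<theta>)) \<le> exp (u * K p) * exp (- (u * (\<theta> * \<gamma> / 2)))"
        by (simp only: exp_le_cancel_iff flip: exp_add)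
      also have "\<dots> \<le> exp (u * K p) * (1 / 4)" using small by (intro mult_left_mono) auto
      finally show ?thesis .
    qed
    moreover have "?C * exp (u * K (p - \<theta>)) \<le> exp (u * K p) * (1 / 4)"
    proof -
      have "u * K (p - \<theta>) \<le> u * (K p - \<theta> * (D - \<gamma> / 2))" using low u0 by (rule mult_left_mono)
      then have "\<theta> * (u * (D - \<gamma>)) + u * K (p - \<theta>) \<le> u * K p + - (u * (\<theta> * \<gamma> / 2))"
        by (simp add: algebra_simps)
      then have "?C * exp (u * K (p - \<theta>)) \<le> exp (u * K p) * exp (- (u * (\<theta> * \<gamma> / 2)))"
        by (simp only: exp_le_cancel_iff flip: exp_add)
      also have "\<dots> \<le> exp (u * K p) * (1 / 4)" using small by (intro mult_left_mono) auto
      finally show ?thesis .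
    qed
    ultimately have "exp (u * K p) / 2 \<le> ?A * measure (law u) ?W" by linarith
    then have "exp (- (p * (u * (D + \<gamma>)))) * (exp (u * K p) / 2) \<le> exp (- (p * (u * (D + \<gamma>)))) * (?A * measure (law u) ?W)"
      by (intro mult_left_mono) auto
    also have "\<dots> = measure (law u) ?W"
      by (simp add: mult.assoc[symmetric] flip: exp_add)
    also have "exp (- (p * (u * (D + \<gamma>)))) * (exp (u * K p) / 2) = exp (u * (K p - p * (D + \<gamma>))) / 2"
      by (simp add: algebra_simps flip: exp_add)
    finally show "exp (u * (K p - p * (D + \<gamma>))) / 2 \<le> measure (law u) ?W" .
  qed
qed

end

section \<open>Lower and upper tail bounds for L(T)\<close>

context levy_time
begin

lemma prob_space_T: "prob_space (distr M borel T)"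
  by (rule prob_space_distr) measurable

text \<open>For u \<ge> a, L(u) is large when L(a) is large and the rest of the path up to u does
  not fall below - c. The latter has probability at least \<eta> uniformly over the times
  considered, so L(T) inherits the rate of L(a) up to constants, which any q > r absorbs.\<close>

lemma tail_lower_of_L:
  assumes crit: "criterion_I (law 1) \<or> criterion_II (law 1)" and r: "critical_exponent (law 1) = ereal r"
    and fin: "mgf (law 1) r < \<infinity>" and T0: "\<not> (AE \<omega> in M. T \<omega> = 0)" and q: "r < q"
  shows "\<forall>\<^sub>F x in at_top. exp (- q * x) \<le> 1 - cdf (law_at_random_time M L T) x"
proof -
  interpret PT: prob_space "distr M borel T" by (rule prob_space_T)
  have r0: "0 < r" by (rule criterion_dyadic_window_tail(1)[OF crit r fin])
  have below: "mgf (law 1) v < \<infinity>" if "0 \<le> v" "v < r" for v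
    using that r by (intro mgf_finite_below prob_space_law) auto
  \<comment> \<open>The intervals from 2 ^ (- j) to 2 ^ j exhaust the positive axis, so one of them
    is charged by T. Dyadic left ends are the times reached by the descent.\<close>
  have "\<exists>j. measure (distr M borel T) {1 / 2 ^ j..2 ^ j} \<noteq> 0"
  proof (rule ccontr)
    assume "\<not> (\<exists>j. measure (distr M borel T) {1 / 2 ^ j..2 ^ j} \<noteq> 0)"
    then have "AE \<omega> in M. T \<omega> \<notin> {1 / 2 ^ j..2 ^ j}" for j
      by (subst AE_iff_measurable[OF _ refl])
         (auto simp: measure_distr emeasure_eq_measure vimage_def Int_def conj_commute)
    then have "AE \<omega> in M. \<forall>j. T \<omega> \<notin> {1 / 2 ^ j..2 ^ j}"
      by (simp add: AE_all_countable)
    then have "AE \<omega> in M. T \<omega> = 0"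
      using T_nonneg
    proof eventually_elim
      case (elim \<omega>)
      show ?case
      proof (rule ccontr)
        assume "T \<omega> \<noteq> 0"
        then have pos: "0 < T \<omega>" using elim by simp
        obtain j1 where j1: "T \<omega> < 2 ^ j1" using real_arch_pow[of 2 "T \<omega>"] by auto
        obtain j2 where j2: "1 / T \<omega> < 2 ^ j2" using real_arch_pow[of 2 "1 / T \<omega>"] by auto
        define j where "j = max j1 j2"
        have "(2::real) ^ j1 \<le> 2 ^ j" "(2::real) ^ j2 \<le> 2 ^ j" by (auto simp: j_def power_increasing)
        then have "T \<omega> \<le> 2 ^ j" "1 / T \<omega> \<le> 2 ^ j" using j1 j2 by linarith+
        then have "T \<omega> \<in> {1 / 2 ^ j..2 ^ j}" using pos by (simp add: field_simps)
        then show False using elim by blast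
      qed
    qed
    with T0 show False by blast
  qed
  then obtain j where j: "measure (distr M borel T) {1 / 2 ^ j..2 ^ j} \<noteq> 0" by blast
  define a b :: real where "a = 1 / 2 ^ j" and "b = 2 ^ j"
  define \<pi> where "\<pi> = measure (distr M borel T) {a..b}"
  have a: "0 < a" and b: "0 \<le> b" and \<pi>: "0 < \<pi>"
    using j by (auto simp: a_def b_def \<pi>_def zero_less_measure_iff)
  \<comment> \<open>Rate r / 3 keeps both v and 2 v below r; the bound b + 1 allows for the
    overshoot of the grid.\<close>
  obtain c \<eta> where c: "0 \<le> c" "0 < \<eta>" "\<And>w. 0 \<le> w \<Longrightarrow> w \<le> b + 1 \<Longrightarrow> \<eta> \<le> measure (law w) {- c..}"
    by (rule law_lower_uniform[of "r / 3" "b + 1"]) (use r0 b below in auto)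
  obtain q' where q': "r < q'" "q' < q" using dense[OF q] by blast
  interpret A: prob_space "law a" using a by (intro prob_space_law) simp
  have "\<forall>\<^sub>F x in at_top. exp (- q' * x) \<le> measure (law a) {x<..}"
    using criterion_dyadic_window_tail(2)[OF crit r fin, of j] q'
    by (intro window_tail_lower[OF A.prob_space_axioms]) (auto simp: a_def)
  moreover have "filterlim (\<lambda>x. (c + 1) + x) at_top at_top"
    by (rule filterlim_tendsto_add_at_top[OF tendsto_const filterlim_ident])
  ultimately have "\<forall>\<^sub>F x in at_top. exp (- q' * ((c + 1) + x)) \<le> measure (law a) {(c + 1) + x<..}"
    by (rule eventually_compose_filterlim)
  moreover have "\<forall>\<^sub>F x in at_top. exp (- q * x) \<le> (\<eta> * \<pi> * exp (- q' * (c + 1))) * exp (- q' * x)"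
    using c \<pi> q' by (intro eventually_exp_absorb) auto
  ultimately show ?thesis
  proof eventually_elim
    case (elim x)
    define m where "m = measure (law a) {x + 1 + c<..}"
    have m: "exp (- q' * (c + 1)) * exp (- q' * x) \<le> m"
    proof -
      have "exp (- q' * (c + 1)) * exp (- q' * x) = exp (- q' * ((c + 1) + x))"
        by (simp only: distrib_left flip: exp_add)
      moreover have "(c + 1) + x = x + 1 + c" by simp
      ultimately show ?thesis using elim(1) unfolding m_def by (simp only:)
    qed
    have \<eta>1: "\<eta> \<le> 1"
    proof -
      interpret L0: prob_space "law 0" by (rule prob_space_law) simp
      show ?thesis by (rule order_trans[OF c(3)[of 0] L0.prob_le_1]) (use b in auto)
    qed
    have "m * \<eta> * measure (distr M borel T) {a..b} \<le> 1 - cdf (law_at_random_time M L T) x"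
    proof (rule tail_lower[where y = "x + 1"])
      show "0 \<le> m * \<eta>" using c by (simp add: m_def)
      fix u assume u: "a \<le> u" "u \<le> b + 1"
      show "m * \<eta> \<le> measure (law u) {x + 1<..}"
      \<comment> \<open>\<open>law_tail_add\<close> needs an increment of positive length.\<close>
      proof (cases "u = a")
        case True
        have "m * \<eta> \<le> m * 1" using \<eta>1 by (intro mult_left_mono) (auto simp: m_def)
        also have "\<dots> \<le> measure (law a) {x + 1<..}"
          using c unfolding m_def by (simp, intro A.finite_measure_mono) auto
        finally show ?thesis using True by simp
      next
        case False
        define w where "w = u - a"
        have w: "0 < w" "w \<le> b + 1" "u = a + w" using u False a by (auto simp: w_def)
        have "m * \<eta> \<le> m * measure (law w) {- c..}"
          using c(3)[of w] w by (intro mult_left_mono) (auto simp: m_def)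
        also have "\<dots> \<le> measure (law u) {x + 1<..}"
          unfolding m_def w(3) by (rule law_tail_add[OF a w(1)])
        finally show ?thesis .
      qed
    qed (use a in auto)
    then have lower: "m * (\<eta> * \<pi>) \<le> 1 - cdf (law_at_random_time M L T) x"
      by (simp add: \<pi>_def mult_ac)
    have "exp (- q * x) \<le> (exp (- q' * (c + 1)) * exp (- q' * x)) * (\<eta> * \<pi>)"
      using elim(2) by (simp add: mult_ac)
    also have "\<dots> \<le> m * (\<eta> * \<pi>)"
      using c \<pi> by (intro mult_right_mono m) auto
    finally show ?case using lower by linarith
  qed
qed

text \<open>T is placed in a window whose smallest time a already gives a tilted mean just beyond x;
  each time in the window then reaches x + 1 at the Cramer cost.\<close>

lemma tail_lower_of_T:
  assumes p: "0 < p" "ereal p < critical_exponent (law 1)" and \<tau>: "0 < \<tau>" "K p = \<tau>"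
    and tail: "window_tail (distr M borel T) \<tau>" and q: "p < q"
  shows "\<forall>\<^sub>F x in at_top. exp (- q * x) \<le> 1 - cdf (law_at_random_time M L T) x"
proof -
  have P1: "prob_space (law 1)" by (rule prob_space_law) simp
  \<comment> \<open>Room to the right of p, so that K is differentiable at p and the tilt can move
    in both directions.\<close>
  obtain R where R: "p < R" "ereal R < critical_exponent (law 1)"
    using ereal_dense2[OF p(2)] by auto
  have fin: "mgf (law 1) v < \<infinity>" if "0 < v" "v < R" for v
    using that R by (intro mgf_finite_below[OF P1]) (auto intro: less_trans[of "ereal v" "ereal R"])
  interpret E: exp_moments "law 1" R
    using R p by (intro exp_moments_below[OF P1]) auto
  have Kmom: "K v = ln (E.mom UNIV 0 v)" if "0 < v" "v < R" for v
    unfolding K_def using E.mgf_eq_mom[OF that] by simp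
  have mpos: "0 < E.mom UNIV 0 p" using p R by (intro E.mom_UNIV_0_pos) auto
  define D where "D = E.mom UNIV (Suc 0) p / E.mom UNIV 0 p"
  have "((\<lambda>v. ln (E.mom UNIV 0 v)) has_real_derivative D) (at p)"
    unfolding D_def using p R mpos
    by (auto intro!: derivative_eq_intros E.mom_has_derivative)
  moreover have "\<forall>\<^sub>F v in nhds p. v \<in> {0<..<R}"
    using p R by (intro eventually_nhds_in_open) auto
  then have "\<forall>\<^sub>F v in nhds p. K v = ln (E.mom UNIV 0 v)"
    by eventually_elim (use Kmom in auto)
  ultimately have D: "(K has_real_derivative D) (at p)"
    using DERIV_cong_ev[of p p K "\<lambda>v. ln (E.mom UNIV 0 v)" D D] by simp
  have "((\<lambda>z. (K z - K p) / (z - p)) \<longlongrightarrow> D) (at_left p)"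
    using D by (auto simp: has_field_derivative_iff filterlim_at_split)
  moreover have "\<forall>\<^sub>F z in at_left p. \<tau> / p \<le> (K z - K p) / (z - p)"
  proof -
    have "\<forall>\<^sub>F z in at_left p. z \<in> {0<..<p}"
      using p by (intro eventually_at_left_real) auto
    then show ?thesis
    proof eventually_elim
      case (elim z)
      then have z: "0 < z" "z < p" by auto
      have "K z \<le> z / p * K p" using z p R by (intro K_le fin) auto
      then have "\<tau> / p * (p - z) \<le> K p - K z" using \<tau> p by (simp add: field_simps)
      then have "\<tau> / p \<le> (K p - K z) / (p - z)" using z by (simp add: pos_le_divide_eq)
      also have "\<dots> = (K z - K p) / (z - p)"
        by (metis minus_diff_eq minus_divide_divide)
      finally show ?case .
    qed
  qed
  \<comment> \<open>By convexity and K 0 = 0 the slope at p is at least that of the chord from the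
    origin; this makes D positive and the Cramer cost p D - \<tau> nonnegative.\<close>
  ultimately have D\<tau>: "\<tau> / p \<le> D"
    by (intro tendsto_lowerbound) auto
  then have D0: "0 < D" and pD: "\<tau> \<le> p * D"
    using \<tau> p by (auto simp: field_simps intro: less_le_trans[OF divide_pos_pos])
  \<comment> \<open>The total rate in x when the window of T and the error in the slope both have
    relative size \<delta>. As \<delta> \<rightarrow> 0, \<tau> cancels and p D / D = p
    remains.\<close>
  define Q where "Q \<delta> = ((1 + \<delta>) * (p * (D + \<delta> * D)) + \<tau> * \<delta>) / ((1 - \<delta>) * (D - \<delta> * D))" for \<delta>
  have "(Q \<longlongrightarrow> ((1 + 0) * (p * (D + 0 * D)) + \<tau> * 0) / ((1 - 0) * (D - 0 * D))) (at_right 0)"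
    unfolding Q_def using D0 by (intro tendsto_intros) auto
  then have "(Q \<longlongrightarrow> p) (at_right 0)" using D0 by simp
  then have "\<forall>\<^sub>F \<delta> in at_right 0. Q \<delta> < q" using q by (rule order_tendstoD)
  moreover have "\<forall>\<^sub>F \<delta> in at_right 0. \<delta> \<in> {0<..<1::real}"
    by (rule eventually_at_right_real) simp
  ultimately have "\<forall>\<^sub>F \<delta> in at_right 0. Q \<delta> < q \<and> \<delta> \<in> {0<..<1::real}"
    by (rule eventually_conj)
  then have "\<exists>\<delta>. Q \<delta> < q \<and> \<delta> \<in> {0<..<1::real}"
    by (rule eventually_happens'[OF trivial_limit_at_right_real])
  then obtain \<delta> where \<delta>: "Q \<delta> < q" "0 < \<delta>" "\<delta> < 1" by auto
  define \<gamma> where "\<gamma> = \<delta> * D"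
  have \<gamma>: "0 < \<gamma>" "\<gamma> < D" using \<delta> D0 by (auto simp: \<gamma>_def)
  obtain u0 where u0: "0 \<le> u0"
    and cr: "\<And>u. u0 \<le> u \<Longrightarrow> exp (u * (K p - p * (D + \<gamma>))) / 2 \<le> measure (law u) {u * (D - \<gamma>)..}"
    using cramer_lower[OF p(1) R(1) fin D \<gamma>(1)] by blast
  \<comment> \<open>Cost per unit of time under the tilt; as it is nonnegative, the longest time b +
    1 gives the worst bound.\<close>
  define e where "e = p * (D + \<gamma>) - \<tau>"
  have e: "0 \<le> e"
    using pD p \<gamma> by (simp add: e_def distrib_left add_increasing2)
  \<comment> \<open>With t = s (2 + x) the smallest time a = (1 - \<delta>) t satisfies a (D -
    \<gamma>) = x + 2, clear of the threshold x + 1.\<close>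
  define s where "s = 1 / ((1 - \<delta>) * (D - \<gamma>))"
  have s: "0 < s" using \<delta> \<gamma> by (simp add: s_def)
  have Q: "Q \<delta> = ((1 + \<delta>) * (p * (D + \<gamma>)) + \<tau> * \<delta>) * s"
    by (simp add: Q_def s_def \<gamma>_def)
  have lim: "filterlim (\<lambda>x. s * (2 + x)) at_top at_top"
    using s by (intro filterlim_tendsto_pos_mult_at_top[OF tendsto_const]
        filterlim_tendsto_add_at_top[OF tendsto_const filterlim_ident])
  have "\<forall>\<^sub>F t in at_top. exp (- (\<tau> * (1 + 2 * \<delta>) * t)) \<le> measure (distr M borel T) {(1 - \<delta>) * t..(1 + \<delta>) * t}"
    using tail \<delta> unfolding window_tail_def by blast
  moreover have "\<forall>\<^sub>F t in at_top. u0 / (1 - \<delta>) \<le> t" by (rule eventually_ge_at_top)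
  ultimately have "\<forall>\<^sub>F t in at_top. exp (- (\<tau> * (1 + 2 * \<delta>) * t)) \<le> measure (distr M borel T) {(1 - \<delta>) * t..(1 + \<delta>) * t}
      \<and> u0 / (1 - \<delta>) \<le> t"
    by (rule eventually_conj)
  note ev = eventually_compose_filterlim[OF this lim]
  have "\<forall>\<^sub>F x in at_top. exp (- q * x) \<le> (exp (- e - 2 * Q \<delta>) / 2) * exp (- Q \<delta> * x)"
    using \<delta> by (intro eventually_exp_absorb) auto
  with ev eventually_ge_at_top[of 0] show ?thesis
  proof eventually_elim
    case (elim x)
    define t where "t = s * (2 + x)"
    define a b where "a = (1 - \<delta>) * t" and "b = (1 + \<delta>) * t"
    have t0: "0 \<le> t" using s elim by (simp add: t_def)
    have T: "exp (- (\<tau> * (1 + 2 * \<delta>) * t)) \<le> measure (distr M borel T) {a..b}"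
      using elim(1) unfolding t_def a_def b_def by blast
    have "u0 / (1 - \<delta>) \<le> t" using elim(1) unfolding t_def by blast
    then have ua: "u0 \<le> a" using \<delta> by (simp add: a_def pos_divide_le_eq mult.commute)
    have aD: "a * (D - \<gamma>) = x + 2"
      using \<delta> \<gamma> by (simp add: a_def t_def s_def)
    define c where "c = exp (- ((b + 1) * e)) / 2"
    have "c * measure (distr M borel T) {a..b} \<le> 1 - cdf (law_at_random_time M L T) x"
    proof (rule tail_lower[where y = "x + 1"])
      show "0 \<le> a" using u0 ua by simp
      show "0 \<le> c" by (simp add: c_def)
      fix u assume u: "a \<le> u" "u \<le> b + 1"
      have u0': "0 \<le> u" using u u0 ua by simp
      interpret U: prob_space "law u" by (rule prob_space_law[OF u0'])
      have "u * e \<le> (b + 1) * e" using u e by (intro mult_right_mono) auto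
      then have "c \<le> exp (u * (K p - p * (D + \<gamma>))) / 2"
        unfolding c_def using \<tau> by (simp add: e_def algebra_simps)
      also have "\<dots> \<le> measure (law u) {u * (D - \<gamma>)..}"
        using u ua by (intro cr) auto
      also have "\<dots> \<le> measure (law u) {x + 1<..}"
      proof (rule U.finite_measure_mono)
        have "a * (D - \<gamma>) \<le> u * (D - \<gamma>)" using u \<gamma> by (intro mult_right_mono) auto
        then show "{u * (D - \<gamma>)..} \<subseteq> {x + 1<..}" unfolding aD by auto
      qed simp
      finally show "c \<le> measure (law u) {x + 1<..}" .
    qed simp
    moreover have "c * exp (- (\<tau> * (1 + 2 * \<delta>) * t)) \<le> c * measure (distr M borel T) {a..b}"
      using T by (intro mult_left_mono) (auto simp: c_def)
    moreover have "c * exp (- (\<tau> * (1 + 2 * \<delta>) * t)) = (exp (- e - 2 * Q \<delta>) / 2) * exp (- Q \<delta> * x)"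
    proof -
      have "(b + 1) * e + \<tau> * (1 + 2 * \<delta>) * t = e + ((1 + \<delta>) * (p * (D + \<gamma>)) + \<tau> * \<delta>) * t"
        unfolding b_def e_def by (simp add: algebra_simps)
      also have "\<dots> = e + 2 * Q \<delta> + Q \<delta> * x"
        unfolding Q t_def by (simp add: algebra_simps)
      finally have "- ((b + 1) * e) + - (\<tau> * (1 + 2 * \<delta>) * t) = (- e - 2 * Q \<delta>) + - Q \<delta> * x"
        by (simp add: algebra_simps)
      then have "exp (- ((b + 1) * e)) * exp (- (\<tau> * (1 + 2 * \<delta>) * t)) = exp (- e - 2 * Q \<delta>) * exp (- Q \<delta> * x)"
        by (simp only: flip: exp_add)
      then show ?thesis by (simp add: c_def)
    qed
    ultimately show ?case using elim by linarith
  qed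
qed

lemma tail_upper_below:
  assumes v: "0 < v" "mgf (law 1) v < \<infinity>" and Kv: "ereal (K v) < critical_exponent (distr M borel T)"
    and pT: "0 < critical_exponent (distr M borel T)"
  shows "\<exists>C. \<forall>x. 1 - cdf (law_at_random_time M L T) x \<le> C * exp (- v * x)"
proof -
  have "mgf (distr M borel T) (max 0 (K v)) < \<infinity>"
    using Kv pT by (intro mgf_finite_below prob_space_T) (auto simp: max_def zero_ereal_def)
  then show ?thesis
    by (meson tail_upper[OF v, of "max 0 (K v)"] max.cobounded1 max.cobounded2)
qed

end

section \<open>Assembly of the three cases\<close>

theorem theorem11:
  fixes M :: "'a measure" and L :: "real \<Rightarrow> 'a \<Rightarrow> real" and T :: "'a \<Rightarrow> real"
    and \<mu>L \<mu>T :: "real measure" and pL pT :: ereal and F :: "real \<Rightarrow> real"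
  assumes "prob_space M"
    and "levy_process M L"
    and "T \<in> borel_measurable M"
    and "AE \<omega> in M. 0 \<le> T \<omega>"
    and "\<not> (AE \<omega> in M. T \<omega> = 0)"
    and "indep_of_process M T L"
    and "\<mu>L = distr M borel (L 1)"
    and "\<mu>T = distr M borel T"
    and "pL = critical_exponent \<mu>L"
    and "pT = critical_exponent \<mu>T"
    and "F = cdf (law_at_random_time M L T)"
    and "0 < pL" and "0 < pT"
  shows
    "(\<forall>p::real. 0 \<le> p \<and> ereal p < pL \<and> cgf \<mu>L p = pT \<and>
        (criterion_I \<mu>T \<or> criterion_II \<mu>T) \<longrightarrow>
        (\<lambda>x. ln (1 - F x)) \<sim>[at_top] (\<lambda>x. - p * x)) \<and>
     (\<forall>p::real. ereal p = pL \<and> cgf \<mu>L p = pT \<and>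
        (criterion_I \<mu>T \<or> criterion_II \<mu>T) \<and> (criterion_I \<mu>L \<or> criterion_II \<mu>L) \<longrightarrow>
        (\<lambda>x. ln (1 - F x)) \<sim>[at_top] (\<lambda>x. - p * x)) \<and>
     ((\<forall>p::real. 0 \<le> p \<and> ereal p \<le> pL \<longrightarrow> cgf \<mu>L p < pT) \<and>
        (criterion_I \<mu>L \<or> criterion_II \<mu>L) \<longrightarrow>
        (\<lambda>x. ln (1 - F x)) \<sim>[at_top] (\<lambda>x. - real_of_ereal pL * x))"
proof -
  interpret prob_space M by fact
  interpret levy_time M L T
    by standard (use assms in auto)
  have \<mu>L: "\<mu>L = law 1" using assms by (simp add: law_def)
  have P1: "prob_space (law 1)" by (rule prob_space_law) simp
  have PT: "prob_space \<mu>T" using prob_space_T assms by simp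
  have sT: "sets \<mu>T = sets borel" using assms by simp
  have cgf: "cgf \<mu>L v = (if mgf (law 1) v = \<infinity> then \<infinity> else ereal (K v))" for v
    by (simp add: cgf_def \<mu>L K_def)
  have fin_below: "mgf (law 1) v < \<infinity>" if "0 \<le> v" "ereal v < pL" for v
    using that assms \<mu>L by (intro mgf_finite_below P1) auto
  have asymp: "(\<lambda>x. ln (1 - F x)) \<sim>[at_top] (\<lambda>x. - p * x)"
    if "0 < p" "ereal p \<le> pL" "\<And>v. 0 < v \<Longrightarrow> v < p \<Longrightarrow> ereal (K v) < pT"
      "\<And>q. p < q \<Longrightarrow> \<forall>\<^sub>F x in at_top. exp (- q * x) \<le> 1 - F x" for p
  proof (rule log_tail_asymp_equiv[OF that(1) _ that(4)])
    fix v assume v: "0 < v" "v < p"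
    have "ereal v < pL" using v(2) that(2) by (metis less_ereal.simps(1) less_le_trans)
    then show "\<exists>C. \<forall>x. 1 - F x \<le> C * exp (- v * x)"
      using tail_upper_below[of v] v that(3)[OF v] fin_below[of v] assms by auto
  qed
  \<comment> \<open>Since K p > 0, the chord bound K v \<le> (v / p) K p puts K v strictly below K p
    = p_T.\<close>
  have below: "ereal (K v) < pT" if "0 < v" "v < p" "mgf (law 1) p < \<infinity>" "mgf (law 1) v < \<infinity>"
    "ereal (K p) = pT" "0 < K p" for v p
  proof -
    have "K v \<le> v / p * K p" by (intro K_le that)
    also have "\<dots> < 1 * K p" using that by (intro mult_strict_right_mono) auto
    finally show ?thesis using that(5)[symmetric] by simp
  qed
  \<comment> \<open>A criterion for T includes 0 < p_T < \<infinity>, so the equation at p forces a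
    finite generating function and K p > 0.\<close>
  have pT: "mgf (law 1) p < \<infinity> \<and> ereal (K p) = pT \<and> 0 < K p \<and> window_tail \<mu>T (K p)"
    if c: "cgf \<mu>L p = pT" "criterion_I \<mu>T \<or> criterion_II \<mu>T" for p
  proof -
    obtain \<tau> where \<tau>: "0 < \<tau>" "critical_exponent \<mu>T = ereal \<tau>" "window_tail \<mu>T \<tau>"
      using criterion_window_tail[OF PT sT c(2)] by blast
    then have "cgf \<mu>L p = ereal \<tau>" using c assms by simp
    then show ?thesis
      using \<tau> assms unfolding cgf by (auto split: if_splits simp: top.not_eq_extremum)
  qed
  have i1: "(\<lambda>x. ln (1 - F x)) \<sim>[at_top] (\<lambda>x. - p * x)"
    if p: "0 \<le> p" "ereal p < pL" "cgf \<mu>L p = pT" "criterion_I \<mu>T \<or> criterion_II \<mu>T" for p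
  proof -
    note * = pT[OF p(3,4)]
    \<comment> \<open>At p = 0 the generating function is 1 and K vanishes, whereas p_T is
      positive.\<close>
    have p0: "0 < p"
    proof (rule ccontr)
      assume "\<not> 0 < p"
      then have "p = 0" using p by simp
      then have "K p = 0" using mgf_0 by (simp add: K_def)
      then show False using * by simp
    qed
    show ?thesis
    proof (rule asymp[OF p0])
      show "ereal p \<le> pL" using p by simp
      show "ereal (K v) < pT" if "0 < v" "v < p" for v
        using * that p(2) by (intro below[of v p] fin_below) (auto intro: less_trans[of "ereal v" "ereal p"])
      show "\<forall>\<^sub>F x in at_top. exp (- q * x) \<le> 1 - F x" if "p < q" for q
        using tail_lower_of_T[OF p0 _ _ refl _ that] * p(2) assms \<mu>L by simp
    qed
  qed
  have i2: "(\<lambda>x. ln (1 - F x)) \<sim>[at_top] (\<lambda>x. - p * x)"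
    if p: "ereal p = pL" "cgf \<mu>L p = pT" "criterion_I \<mu>T \<or> criterion_II \<mu>T" "criterion_I \<mu>L \<or> criterion_II \<mu>L" for p
  proof -
    note * = pT[OF p(2,3)]
    have p0: "0 < p" using p(1) \<open>0 < pL\<close> by (metis ereal_less(2))
    show ?thesis
    proof (rule asymp[OF p0])
      show "ereal p \<le> pL" using p by simp
      show "ereal (K v) < pT" if "0 < v" "v < p" for v
        using * that fin_below[of v] p(1) below[of v p] by (metis less_ereal.simps(1) less_imp_le)
      show "\<forall>\<^sub>F x in at_top. exp (- q * x) \<le> 1 - F x" if "p < q" for q
        using tail_lower_of_L[of p q] * p that assms \<mu>L by simp
    qed
  qed
  have ii: "(\<lambda>x. ln (1 - F x)) \<sim>[at_top] (\<lambda>x. - real_of_ereal pL * x)"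
    if p: "\<forall>p::real. 0 \<le> p \<and> ereal p \<le> pL \<longrightarrow> cgf \<mu>L p < pT" "criterion_I \<mu>L \<or> criterion_II \<mu>L"
  proof -
    obtain r where r: "0 < r" "pL = ereal r"
      using criterion_window_tail[OF P1 sets_law] p(2) assms \<mu>L by metis
    \<comment> \<open>The strict inequality at the endpoint r = p_L gives a finite generating
      function there, which is what the lower bound through L requires.\<close>
    have K: "mgf (law 1) v < \<infinity> \<and> ereal (K v) < pT" if "0 \<le> v" "v \<le> r" for v
      using p(1) that r unfolding cgf by (auto split: if_splits simp: top.not_eq_extremum)
    have "(\<lambda>x. ln (1 - F x)) \<sim>[at_top] (\<lambda>x. - r * x)"
    proof (rule asymp[OF r(1)])
      show "ereal r \<le> pL" using r by simp
      show "ereal (K v) < pT" if "0 < v" "v < r" for v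
        using K[of v] that by simp
      show "\<forall>\<^sub>F x in at_top. exp (- q * x) \<le> 1 - F x" if "r < q" for q
        using tail_lower_of_L[of r q] K[of r] p(2) r that assms \<mu>L by simp
    qed
    then show ?thesis using r by simp
  qed
  show ?thesis using i1 i2 ii by blast
qed

end
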